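(* Let $X_i=\mu_i+u_i$, $1\le i\le N$, with $u_i=u_{i,N}=a(i/N)e_i$, where $a:[0,1]\to\mathbb{R}$ has bounded variation on $[0,1]$, $Ee_i=0$ for all $i\ge 1$, and for some $\sigma>0$, $N^{-1/2}\sum_{\ell=1}^{\lfloor Nt\rfloor}e_\ell\stackrel{\mathcal{D}[0,1]}{\longrightarrow}\sigma W(t)$ as $N\to\infty$ with $W$ a Wiener process. Suppose the null hypothesis $H_0:\ \mu_1=\mu_2=\cdots=\mu_N$ holds. Then, as $N\to\infty$, $$\int_0^1 Z_N^2(t)\,dt\;\stackrel{\mathcal{D}}{\to}\;\int_0^1\Gamma^2(t)\,dt.$$ If, in addition, $|Ee_ie_k|=O((|k-i|+1)^{-\kappa})$ (uniformly in $i,k$) with some $\kappa>1$, then $$\int_{1/N}^{1-1/N}\frac{Z_N^2(t)}{t(1-t)}\,dt\;\stackrel{\mathcal{D}}{\to}\;\int_0^1\frac{\Gamma^2(t)}{t(1-t)}\,dt.$$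
   Context: The CUSUM process is $$Z_N(t)=N^{-1/2}\left(\sum_{\ell=1}^{\lfloor Nt\rfloor}X_\ell-\frac{\lfloor Nt\rfloor}{N}\sum_{\ell=1}^N X_\ell\right),\quad 0\le t\le 1.$$ The limit process is $\Gamma(t)=W(b(t))-tW(b(1))$, $0\le t\le1$, where $W$ is a Wiener process (standard Brownian motion) and $b(t)=\sigma^2\int_0^t a^2(u)\,du$. $\stackrel{\mathcal{D}[0,1]}{\longrightarrow}$ is weak convergence in the Skorokhod space $\mathcal{D}[0,1]$ and $\stackrel{\mathcal{D}}{\to}$ is convergence in distribution of random variables. *)

theory Defs
  imports "HOL-Probability.Probability"
begin

section \<open>The Skorokhod space on the unit interval\<close>

text \<open>Paths are extensional outside the unit interval, so that equality of elements of the space is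
  equality on the unit interval.\<close>

definition skorokhod_space :: "(real \<Rightarrow> real) set" where
  "skorokhod_space = {f \<in> extensional {0..1}.
     (\<forall>t\<in>{0..<1}. (f \<longlongrightarrow> f t) (at_right t)) \<and>
     (\<forall>t\<in>{0<..1}. \<exists>l. (f \<longlongrightarrow> l) (at_left t))}"

definition time_changes :: "(real \<Rightarrow> real) set" where
  "time_changes = {\<tau>. strict_mono_on {0..1} \<tau> \<and> continuous_on {0..1} \<tau> \<and> \<tau> ` {0..1} = {0..1}}"

text \<open>Outside the space the set below may be empty, and its real infimum unspecified; the library's metric
  spaces demand a nonnegative distance everywhere, hence the value zero there.\<close>

definition skorokhod_dist :: "(real \<Rightarrow> real) \<Rightarrow> (real \<Rightarrow> real) \<Rightarrow> real" where
  "skorokhod_dist f g =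
     (if f \<in> skorokhod_space \<and> g \<in> skorokhod_space
      then Inf {\<epsilon>. 0 \<le> \<epsilon> \<and>
        (\<exists>\<tau>\<in>time_changes. \<forall>t\<in>{0..1}. \<bar>\<tau> t - t\<bar> \<le> \<epsilon> \<and> \<bar>f t - g (\<tau> t)\<bar> \<le> \<epsilon>)}
      else 0)"

definition skorokhod_topology :: "(real \<Rightarrow> real) topology" where
  "skorokhod_topology = Metric_space.mtopology skorokhod_space skorokhod_dist"

definition skorokhod_borel :: "(real \<Rightarrow> real) measure" where
  "skorokhod_borel = sigma skorokhod_space {U. openin skorokhod_topology U}"

text \<open>The library's topology of a metric is only meaningful once the metric axioms hold, so they are
  established here.\<close>

definition skorokhod_close :: "(real \<Rightarrow> real) \<Rightarrow> (real \<Rightarrow> real) \<Rightarrow> real \<Rightarrow> bool" where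
  "skorokhod_close f g \<epsilon> \<longleftrightarrow> 0 \<le> \<epsilon> \<and>
     (\<exists>\<tau>\<in>time_changes. \<forall>t\<in>{0..1}. \<bar>\<tau> t - t\<bar> \<le> \<epsilon> \<and> \<bar>f t - g (\<tau> t)\<bar> \<le> \<epsilon>)"

lemma skorokhod_dist_close:
  assumes "f \<in> skorokhod_space" "g \<in> skorokhod_space"
  shows "skorokhod_dist f g = Inf {\<epsilon>. skorokhod_close f g \<epsilon>}"
  using assms by (simp add: skorokhod_dist_def skorokhod_close_def)

lemma time_changes_in:
  assumes "\<tau> \<in> time_changes" "t \<in> {0..1}" shows "\<tau> t \<in> {0..1}"
  using assms by (auto simp: time_changes_def)

lemma time_changes_id: "(\<lambda>t. t) \<in> time_changes"
  by (auto simp: time_changes_def strict_mono_on_def)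

lemma skorokhod_space_bounded:
  assumes "f \<in> skorokhod_space"
  shows "\<exists>B. \<forall>t\<in>{0..1}. \<bar>f t\<bar> \<le> B"
proof -
  have loc: "\<exists>U. open U \<and> t \<in> U \<and> (\<exists>B. \<forall>s\<in>U \<inter> {0..1}. \<bar>f s\<bar> \<le> B)" if t: "t \<in> {0..1}" for t
  proof -
    have "\<exists>u B. u > t \<and> (\<forall>s. t < s \<and> s < u \<and> s \<le> 1 \<longrightarrow> \<bar>f s\<bar> \<le> B)"
    proof (cases "t < 1")
      case True
      then have "(f \<longlongrightarrow> f t) (at_right t)"
        using assms t by (auto simp: skorokhod_space_def)
      then have "eventually (\<lambda>s. dist (f s) (f t) < 1) (at_right t)"
        by (rule tendstoD) simp
      then obtain u where u: "u > t" "\<And>s. t < s \<Longrightarrow> s < u \<Longrightarrow> dist (f s) (f t) < 1"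
        unfolding eventually_at_right_field by auto
      have "\<bar>f s\<bar> \<le> \<bar>f t\<bar> + 1" if "t < s \<and> s < u \<and> s \<le> 1" for s
        using u(2)[of s] that by (auto simp: dist_real_def)
      then show ?thesis using u(1) by blast
    qed (use t in \<open>auto intro!: exI[of _ "t + 1"]\<close>)
    then obtain u B where u: "u > t" "\<And>s. t < s \<Longrightarrow> s < u \<Longrightarrow> s \<le> 1 \<Longrightarrow> \<bar>f s\<bar> \<le> B"
      by blast
    have "\<exists>v B. v < t \<and> (\<forall>s. v < s \<and> s < t \<and> 0 \<le> s \<longrightarrow> \<bar>f s\<bar> \<le> B)"
    proof (cases "0 < t")
      case True
      with t have "t \<in> {0<..1}" by simp
      then obtain l where "(f \<longlongrightarrow> l) (at_left t)"
        using assms unfolding skorokhod_space_def by blast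
      then have "eventually (\<lambda>s. dist (f s) l < 1) (at_left t)"
        by (rule tendstoD) simp
      then obtain v where v: "v < t" "\<And>s. v < s \<Longrightarrow> s < t \<Longrightarrow> dist (f s) l < 1"
        unfolding eventually_at_left_field by auto
      have "\<bar>f s\<bar> \<le> \<bar>l\<bar> + 1" if "v < s \<and> s < t \<and> 0 \<le> s" for s
        using v(2)[of s] that by (auto simp: dist_real_def)
      then show ?thesis using v(1) by blast
    qed (use t in \<open>auto intro!: exI[of _ "t - 1"]\<close>)
    then obtain v C where v: "v < t" "\<And>s. v < s \<Longrightarrow> s < t \<Longrightarrow> 0 \<le> s \<Longrightarrow> \<bar>f s\<bar> \<le> C"
      by blast
    have "\<bar>f s\<bar> \<le> max B (max C \<bar>f t\<bar>)" if "s \<in> {v<..<u} \<inter> {0..1}" for s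
      using u(2)[of s] v(2)[of s] that by (cases s t rule: linorder_cases) (auto simp: le_max_iff_disj)
    then show ?thesis
      using u(1) v(1) by (intro exI[of _ "{v<..<u}"] conjI exI[of _ "max B (max C \<bar>f t\<bar>)"]) auto
  qed
  then obtain U B where U: "\<And>t. t \<in> {0..1} \<Longrightarrow> open (U t) \<and> t \<in> U t"
    and B: "\<And>t s. t \<in> {0..1} \<Longrightarrow> s \<in> U t \<inter> {0..1} \<Longrightarrow> \<bar>f s\<bar> \<le> B t"
    by metis
  have "compact {0..1::real}" by simp
  then obtain T where T: "T \<subseteq> {0..1}" "finite T" "{0..1} \<subseteq> (\<Union>t\<in>T. U t)"
    by (rule compactE_image[where C = "{0..1}" and f = U]) (use U in auto)
  have "\<bar>f s\<bar> \<le> (\<Sum>t\<in>T. \<bar>B t\<bar>)" if s: "s \<in> {0..1}" for s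
  proof -
    obtain t where t: "t \<in> T" "s \<in> U t" using T(3) s by auto
    have "\<bar>f s\<bar> \<le> B t" using B[of t s] t s T(1) by auto
    also have "\<dots> \<le> \<bar>B t\<bar>" by simp
    also have "\<dots> \<le> (\<Sum>t\<in>T. \<bar>B t\<bar>)" by (rule member_le_sum) (use t T in auto)
    finally show ?thesis .
  qed
  then show ?thesis by blast
qed

lemma skorokhod_close_ex:
  assumes "f \<in> skorokhod_space" "g \<in> skorokhod_space"
  shows "\<exists>\<epsilon>. skorokhod_close f g \<epsilon>"
proof -
  obtain B C where "\<forall>t\<in>{0..1}. \<bar>f t\<bar> \<le> B" "\<forall>t\<in>{0..1}. \<bar>g t\<bar> \<le> C"
    using assms skorokhod_space_bounded by metis
  then have "\<forall>t\<in>{0..1}. \<bar>t - t\<bar> \<le> \<bar>B\<bar> + \<bar>C\<bar> \<and> \<bar>f t - g t\<bar> \<le> \<bar>B\<bar> + \<bar>C\<bar>"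
    by (smt (verit))
  then have "skorokhod_close f g (\<bar>B\<bar> + \<bar>C\<bar>)"
    unfolding skorokhod_close_def using time_changes_id by (intro conjI bexI[of _ "\<lambda>t. t"]) auto
  then show ?thesis by blast
qed

lemma skorokhod_close_sym:
  assumes "skorokhod_close f g \<epsilon>" shows "skorokhod_close g f \<epsilon>"
proof -
  obtain \<tau> where \<tau>: "\<tau> \<in> time_changes"
    and c: "\<And>t. t \<in> {0..1} \<Longrightarrow> \<bar>\<tau> t - t\<bar> \<le> \<epsilon> \<and> \<bar>f t - g (\<tau> t)\<bar> \<le> \<epsilon>" and \<epsilon>: "0 \<le> \<epsilon>"
    using assms by (auto simp: skorokhod_close_def)
  define \<rho> where "\<rho> = inv_into {0..1} \<tau>"
  have mono: "strict_mono_on {0..1} \<tau>" and cont: "continuous_on {0..1} \<tau>"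
    and img: "\<tau> ` {0..1} = {0..1}"
    using \<tau> by (auto simp: time_changes_def)
  have inj: "inj_on \<tau> {0..1}" using mono by (rule strict_mono_on_imp_inj_on)
  have \<rho>: "\<rho> s \<in> {0..1}" "\<tau> (\<rho> s) = s" if "s \<in> {0..1}" for s
    using that img unfolding \<rho>_def by (auto intro!: inv_into_into[of s \<tau>] f_inv_into_f simp del: atLeastAtMost_iff)
  have \<rho>\<tau>: "\<rho> (\<tau> t) = t" if "t \<in> {0..1}" for t
    using inv_into_f_f[OF inj that] by (simp add: \<rho>_def)
  have "continuous_on (\<tau> ` {0..1}) \<rho>"
    by (rule continuous_on_inv[OF cont]) (use \<rho>\<tau> in auto)
  then have "continuous_on {0..1} \<rho>" using img by simp
  moreover have "strict_mono_on {0..1} \<rho>"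
  proof (rule strict_mono_onI)
    fix r s :: real assume rs: "r \<in> {0..1}" "s \<in> {0..1}" "r < s"
    show "\<rho> r < \<rho> s"
    proof (rule ccontr)
      assume "\<not> \<rho> r < \<rho> s"
      then have "\<tau> (\<rho> s) \<le> \<tau> (\<rho> r)"
        using strict_mono_onD[OF mono \<rho>(1)[OF rs(2)] \<rho>(1)[OF rs(1)]] by (cases "\<rho> s = \<rho> r") auto
      then show False using \<rho>(2) rs by simp
    qed
  qed
  moreover have "\<rho> ` {0..1} = {0..1}"
  proof
    show "\<rho> ` {0..1} \<subseteq> {0..1}" using \<rho>(1) by blast
    show "{0..1} \<subseteq> \<rho> ` {0..1}"
    proof
      fix t :: real assume t: "t \<in> {0..1}"
      show "t \<in> \<rho> ` {0..1}" using \<rho>\<tau>[OF t] time_changes_in[OF \<tau> t] by (metis imageI)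
    qed
  qed
  ultimately have "\<rho> \<in> time_changes" by (simp add: time_changes_def)
  moreover have "\<bar>\<rho> s - s\<bar> \<le> \<epsilon> \<and> \<bar>g s - f (\<rho> s)\<bar> \<le> \<epsilon>" if "s \<in> {0..1}" for s
    using c[OF \<rho>(1)[OF that]] \<rho>(2)[OF that] by (simp add: abs_minus_commute)
  ultimately show ?thesis using \<epsilon> unfolding skorokhod_close_def by blast
qed

lemma skorokhod_close_trans:
  assumes "skorokhod_close f g \<epsilon>" "skorokhod_close g h \<delta>"
  shows "skorokhod_close f h (\<epsilon> + \<delta>)"
proof -
  obtain \<tau> where \<tau>: "\<tau> \<in> time_changes"
    and c: "\<And>t. t \<in> {0..1} \<Longrightarrow> \<bar>\<tau> t - t\<bar> \<le> \<epsilon> \<and> \<bar>f t - g (\<tau> t)\<bar> \<le> \<epsilon>" and \<epsilon>: "0 \<le> \<epsilon>"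
    using assms by (auto simp: skorokhod_close_def)
  obtain \<rho> where \<rho>: "\<rho> \<in> time_changes"
    and d: "\<And>t. t \<in> {0..1} \<Longrightarrow> \<bar>\<rho> t - t\<bar> \<le> \<delta> \<and> \<bar>g t - h (\<rho> t)\<bar> \<le> \<delta>" and \<delta>: "0 \<le> \<delta>"
    using assms by (auto simp: skorokhod_close_def)
  have img: "\<tau> ` {0..1} = {0..1}" "\<rho> ` {0..1} = {0..1}"
    using \<tau> \<rho> by (auto simp: time_changes_def)
  have "strict_mono_on {0..1} (\<lambda>t. \<rho> (\<tau> t))"
    using \<tau> \<rho> time_changes_in[OF \<tau>] by (auto simp: time_changes_def strict_mono_on_def)
  moreover have "continuous_on {0..1} (\<lambda>t. \<rho> (\<tau> t))"
    by (rule continuous_on_compose2[of "{0..1}" \<rho>]) (use \<tau> \<rho> in \<open>auto simp: time_changes_def\<close>)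
  moreover have "(\<lambda>t. \<rho> (\<tau> t)) ` {0..1} = {0..1}"
    using img by (metis image_image)
  ultimately have "(\<lambda>t. \<rho> (\<tau> t)) \<in> time_changes" by (simp add: time_changes_def)
  moreover have "\<bar>\<rho> (\<tau> t) - t\<bar> \<le> \<epsilon> + \<delta> \<and> \<bar>f t - h (\<rho> (\<tau> t))\<bar> \<le> \<epsilon> + \<delta>" if "t \<in> {0..1}" for t
    using c[OF that] d[OF time_changes_in[OF \<tau> that]] by linarith
  ultimately show ?thesis using \<epsilon> \<delta> unfolding skorokhod_close_def
    by (intro conjI bexI[of _ "\<lambda>t. \<rho> (\<tau> t)"]) auto
qed

lemma skorokhod_dist_le:
  assumes "f \<in> skorokhod_space" "g \<in> skorokhod_space" "skorokhod_close f g \<epsilon>"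
  shows "skorokhod_dist f g \<le> \<epsilon>"
  unfolding skorokhod_dist_close[OF assms(1,2)]
  by (rule cInf_lower) (use assms in \<open>auto intro!: bdd_belowI[of _ 0] simp: skorokhod_close_def\<close>)

lemma skorokhod_dist_less:
  assumes "f \<in> skorokhod_space" "g \<in> skorokhod_space" "skorokhod_dist f g < r"
  shows "\<exists>\<epsilon><r. skorokhod_close f g \<epsilon>"
  using cInf_lessD[of "{\<epsilon>. skorokhod_close f g \<epsilon>}" r] skorokhod_close_ex[OF assms(1,2)] assms(3)
  by (auto simp: skorokhod_dist_close[OF assms(1,2)])

lemma skorokhod_dist_nonneg: "0 \<le> skorokhod_dist f g"
proof (cases "f \<in> skorokhod_space \<and> g \<in> skorokhod_space")
  case True
  then have "0 \<le> Inf {\<epsilon>. skorokhod_close f g \<epsilon>}"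
    by (intro cInf_greatest) (use skorokhod_close_ex in \<open>auto simp: skorokhod_close_def\<close>)
  then show ?thesis using True by (simp add: skorokhod_dist_close)
qed (auto simp: skorokhod_dist_def)

lemma skorokhod_close_at_one:
  assumes "skorokhod_close f g \<epsilon>" shows "\<bar>f 1 - g 1\<bar> \<le> \<epsilon>"
proof -
  obtain \<tau> where \<tau>: "\<tau> \<in> time_changes"
    and c: "\<And>t. t \<in> {0..1} \<Longrightarrow> \<bar>\<tau> t - t\<bar> \<le> \<epsilon> \<and> \<bar>f t - g (\<tau> t)\<bar> \<le> \<epsilon>"
    using assms by (auto simp: skorokhod_close_def)
  have "1 \<in> \<tau> ` {0..1}" using \<tau> by (auto simp: time_changes_def)
  then obtain s where s: "s \<in> {0..1}" "\<tau> s = 1" by auto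
  have "s = 1"
  proof (rule ccontr)
    assume "s \<noteq> 1"
    then have "\<tau> s < \<tau> 1" using \<tau> s strict_mono_onD[of "{0..1}" \<tau> s 1] by (auto simp: time_changes_def)
    then show False using s time_changes_in[OF \<tau>, of 1] by auto
  qed
  then show ?thesis using c[of 1] s by auto
qed

lemma skorokhod_dist_zeroD:
  assumes f: "f \<in> skorokhod_space" and g: "g \<in> skorokhod_space" and z: "skorokhod_dist f g = 0"
  shows "f = g"
proof (rule extensionalityI[of f "{0..1}"])
  show "f \<in> extensional {0..1}" "g \<in> extensional {0..1}"
    using f g by (auto simp: skorokhod_space_def)
  fix t :: real assume t: "t \<in> {0..1}"
  have small: "\<exists>\<epsilon><r. skorokhod_close f g \<epsilon>" if "r > 0" for r
    using skorokhod_dist_less[OF f g] z that by simp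
  have "\<bar>f t - g t\<bar> \<le> 3 * e" if e: "e > 0" for e
  proof (cases "t = 1")
    case True
    then show ?thesis using small[OF e] skorokhod_close_at_one[of f g] e
      by (smt (verit))
  next
    case False
    then have "(f \<longlongrightarrow> f t) (at_right t)" "(g \<longlongrightarrow> g t) (at_right t)"
      using f g t by (auto simp: skorokhod_space_def)
    then have "eventually (\<lambda>s. dist (f s) (f t) < e \<and> dist (g s) (g t) < e) (at_right t)"
      using e by (intro eventually_conj tendstoD)
    then obtain u where u: "u > t"
      "\<And>s. t < s \<Longrightarrow> s < u \<Longrightarrow> dist (f s) (f t) < e \<and> dist (g s) (g t) < e"
      unfolding eventually_at_right_field by auto
    define w where "w = min u 1"
    define s where "s = (t + w) / 2"
    have w: "w > t" "w \<le> u" "w \<le> 1" using u False t by (auto simp: w_def)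
    obtain \<epsilon> where \<epsilon>: "\<epsilon> < min e ((w - t) / 4)" "skorokhod_close f g \<epsilon>"
      using small[of "min e ((w - t) / 4)"] e w by auto
    obtain \<tau> where c: "\<And>t. t \<in> {0..1} \<Longrightarrow> \<bar>\<tau> t - t\<bar> \<le> \<epsilon> \<and> \<bar>f t - g (\<tau> t)\<bar> \<le> \<epsilon>"
      using \<epsilon>(2) unfolding skorokhod_close_def by blast
    have s: "s \<in> {0..1}" "t < s" "s < u" using w t by (auto simp: s_def field_simps)
    have "\<bar>\<tau> s - s\<bar> < (w - t) / 4" using c[OF s(1)] \<epsilon>(1) by auto
    then have "t < \<tau> s" "\<tau> s < u" using w by (auto simp: s_def field_simps abs_if split: if_splits)
    then have "dist (g (\<tau> s)) (g t) < e" "dist (f s) (f t) < e" "\<bar>f s - g (\<tau> s)\<bar> < e"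
      using u s c[OF s(1)] \<epsilon>(1) by auto
    then show ?thesis by (simp add: dist_real_def)
  qed
  from this[of "\<bar>f t - g t\<bar> / 4"] show "f t = g t" by auto
qed

lemma Metric_space_skorokhod: "Metric_space skorokhod_space skorokhod_dist"
proof
  fix f g show "0 \<le> skorokhod_dist f g" by (rule skorokhod_dist_nonneg)
next
  fix f g
  have "skorokhod_close f g = skorokhod_close g f"
    using skorokhod_close_sym by blast
  then show "skorokhod_dist f g = skorokhod_dist g f"
    by (cases "f \<in> skorokhod_space \<and> g \<in> skorokhod_space")
      (auto simp: skorokhod_dist_close, auto simp: skorokhod_dist_def)
next
  fix f g assume fg: "f \<in> skorokhod_space" "g \<in> skorokhod_space"
  have "skorokhod_dist f f = 0"
  proof (rule antisym)
    have "skorokhod_close f f 0"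
      unfolding skorokhod_close_def using time_changes_id by (intro conjI bexI[of _ "\<lambda>t. t"]) auto
    then show "skorokhod_dist f f \<le> 0" by (rule skorokhod_dist_le[OF fg(1) fg(1)])
    show "0 \<le> skorokhod_dist f f" by (rule skorokhod_dist_nonneg)
  qed
  then show "skorokhod_dist f g = 0 \<longleftrightarrow> f = g"
    using skorokhod_dist_zeroD[OF fg] by auto
next
  fix f g h assume fgh: "f \<in> skorokhod_space" "g \<in> skorokhod_space" "h \<in> skorokhod_space"
  show "skorokhod_dist f h \<le> skorokhod_dist f g + skorokhod_dist g h"
  proof (rule field_le_epsilon)
    fix e :: real assume e: "e > 0"
    obtain \<epsilon> where "\<epsilon> < skorokhod_dist f g + e/2" "skorokhod_close f g \<epsilon>"
      using skorokhod_dist_less[OF fgh(1,2), of "skorokhod_dist f g + e/2"] e by auto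
    moreover obtain \<delta> where "\<delta> < skorokhod_dist g h + e/2" "skorokhod_close g h \<delta>"
      using skorokhod_dist_less[OF fgh(2,3), of "skorokhod_dist g h + e/2"] e by auto
    ultimately show "skorokhod_dist f h \<le> skorokhod_dist f g + skorokhod_dist g h + e"
      using skorokhod_dist_le[OF fgh(1,3) skorokhod_close_trans[of f g \<epsilon> h \<delta>]] by linarith
  qed
qed

section \<open>Convergence in distribution\<close>

text \<open>Weak convergence of random elements of the Skorokhod space; the random elements of the sequence
  are defined on one probability space, the limit possibly on another.\<close>

definition skorokhod_weak_conv ::
    "'a measure \<Rightarrow> (nat \<Rightarrow> 'a \<Rightarrow> real \<Rightarrow> real) \<Rightarrow> 'b measure \<Rightarrow> ('b \<Rightarrow> real \<Rightarrow> real) \<Rightarrow> bool" where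
  "skorokhod_weak_conv M X M' Y \<longleftrightarrow>
     (\<forall>n. X n \<in> M \<rightarrow>\<^sub>M skorokhod_borel) \<and> Y \<in> M' \<rightarrow>\<^sub>M skorokhod_borel \<and>
     (\<forall>F. continuous_map skorokhod_topology euclideanreal F \<and>
          (\<exists>B. \<forall>f\<in>skorokhod_space. \<bar>F f\<bar> \<le> B) \<longrightarrow>
        (\<lambda>n. \<integral>\<omega>. F (X n \<omega>) \<partial>M) \<longlonglongrightarrow> (\<integral>\<omega>. F (Y \<omega>) \<partial>M'))"

definition conv_in_distr ::
    "'a measure \<Rightarrow> (nat \<Rightarrow> 'a \<Rightarrow> real) \<Rightarrow> 'b measure \<Rightarrow> ('b \<Rightarrow> real) \<Rightarrow> bool" where
  "conv_in_distr M X M' Y \<longleftrightarrow>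
     (\<forall>n. X n \<in> borel_measurable M) \<and> Y \<in> borel_measurable M' \<and>
     weak_conv_m (\<lambda>n. distr M borel (X n)) (distr M' borel Y)"

section \<open>The Wiener process and the CUSUM process\<close>

definition wiener_process :: "'b measure \<Rightarrow> (real \<Rightarrow> 'b \<Rightarrow> real) \<Rightarrow> bool" where
  "wiener_process M W \<longleftrightarrow> prob_space M \<and>
     (\<forall>t\<ge>0. W t \<in> borel_measurable M) \<and>
     (\<forall>\<omega>\<in>space M. W 0 \<omega> = 0 \<and> continuous_on {0..} (\<lambda>t. W t \<omega>)) \<and>
     (\<forall>s t. 0 \<le> s \<and> s < t \<longrightarrow>
        distributed M lborel (\<lambda>\<omega>. W t \<omega> - W s \<omega>) (normal_density 0 (sqrt (t - s)))) \<and>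
     (\<forall>n (\<tau> :: nat \<Rightarrow> real). 0 \<le> \<tau> 0 \<and> mono \<tau> \<longrightarrow>
        prob_space.indep_vars M (\<lambda>_. borel) (\<lambda>i \<omega>. W (\<tau> (Suc i)) \<omega> - W (\<tau> i) \<omega>) {..<n})"

definition bounded_variation_on :: "real \<Rightarrow> real \<Rightarrow> (real \<Rightarrow> real) \<Rightarrow> bool" where
  "bounded_variation_on c d f \<longleftrightarrow>
     (\<exists>B. \<forall>n (\<tau> :: nat \<Rightarrow> real). mono_on {..n} \<tau> \<and> \<tau> ` {..n} \<subseteq> {c..d} \<longrightarrow>
        (\<Sum>i<n. \<bar>f (\<tau> (Suc i)) - f (\<tau> i)\<bar>) \<le> B)"

text \<open>The data may form a triangular array: \<open>X N l\<close> is the \<open>l\<close>-th observation in a sample of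
  size \<open>N\<close>.\<close>

definition cusum :: "(nat \<Rightarrow> nat \<Rightarrow> 'a \<Rightarrow> real) \<Rightarrow> nat \<Rightarrow> real \<Rightarrow> 'a \<Rightarrow> real" where
  "cusum X N t \<omega> = 1 / sqrt (real N) *
     ((\<Sum>l=1..nat \<lfloor>real N * t\<rfloor>. X N l \<omega>) - real_of_int \<lfloor>real N * t\<rfloor> / real N * (\<Sum>l=1..N. X N l \<omega>))"

definition variance_clock :: "real \<Rightarrow> (real \<Rightarrow> real) \<Rightarrow> real \<Rightarrow> real" where
  "variance_clock \<sigma> a t = \<sigma>\<^sup>2 * (LBINT u:{0..t}. (a u)\<^sup>2)"

definition limit_process ::
    "(real \<Rightarrow> 'b \<Rightarrow> real) \<Rightarrow> real \<Rightarrow> (real \<Rightarrow> real) \<Rightarrow> real \<Rightarrow> 'b \<Rightarrow> real" where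
  "limit_process W \<sigma> a t \<omega> = W (variance_clock \<sigma> a t) \<omega> - t * W (variance_clock \<sigma> a 1) \<omega>"

end

theory Submission
  imports Defs
begin

text \<open>Write \<open>f\<close> for the rescaled partial sum path of the innovations \<open>e\<close>. Under the null hypothesis the means
cancel in the CUSUM process, which becomes the bridge built from the weighted sums
\<open>U N k = (\<Sum>l=1..k. a (l/N) * (f (l/N) - f ((l-1)/N)))\<close>, a discrete form of the integral of \<open>a\<close> against \<open>f\<close>.
Since \<open>a\<close> has bounded variation, summation by parts inside each cell of a coarse grid of mesh \<open>1/m\<close> replaces \<open>U N\<close>
by \<open>U m\<close>, uniformly in time and in \<open>N\<close>, at the price of a constant times the oscillation of \<open>f\<close> over distances
\<open>1/m\<close> (lemma \<open>coarse_grid\<close>). Hence the integral of the squared CUSUM process against a bounded weight differs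
little from a functional of \<open>f (1/m), \<dots>, f 1\<close> alone (\<open>bridge_energy_coarse_grid\<close>).

For fixed \<open>m\<close> this finite functional and the oscillation are continuous at continuous paths, so the functional
central limit theorem transports them to the path \<open>\<sigma> W\<close> (\<open>skorokhod_continuous_limit_mapping\<close>). Its law
there is identified by a change of clock: the increments \<open>\<sigma> a (l/m) (W (l/m) - W ((l-1)/m))\<close> are independent
centred Gaussians, and so are the increments of \<open>W\<close> along the clock that advances by
\<open>\<sigma>\<^sup>2 a (l/m)\<^sup>2 / m\<close> in the \<open>l\<close>-th step, with the same variances (\<open>bridge_energy_law\<close>). As \<open>m\<close> grows these clocks
converge to the variance clock \<open>b\<close>, and path continuity of \<open>W\<close> gives convergence to the functional of \<open>\<Gamma>\<close>
(\<open>bridge_energy_tendsto_limit\<close>). Together these steps prove \<open>energy_convergence\<close>, of which the first claim is the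
case of weight one.

For the weight \<open>1 / (t (1 - t))\<close> the integral is cut off at distance \<open>\<delta>\<close> from the endpoints, where the weight is
bounded. Summable covariances give \<open>E (Z\<^sub>N t)\<^sup>2 \<le> C t (1 - t)\<close> away from the last \<open>1/N\<close>, so the discarded part has
expectation of order \<open>\<delta>\<close> uniformly in \<open>N\<close> (\<open>tail_energy_bound\<close>); the same bound for \<open>\<Gamma>\<close> and Tonelli's theorem show
that the limiting integral is almost surely finite and is the limit of its truncations.\<close>

section \<open>Convergence in distribution through Lipschitz test functions\<close>

text \<open>Convergence in distribution is tested on bounded Lipschitz functions: they turn closeness of random variables in
probability, or in mean, into closeness of expectations.\<close>

definition lipschitz_test :: "real \<Rightarrow> (real \<Rightarrow> real) \<Rightarrow> bool" where
  "lipschitz_test L \<psi> \<longleftrightarrow>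
     0 \<le> L \<and> (\<forall>x. 0 \<le> \<psi> x \<and> \<psi> x \<le> 1) \<and> (\<forall>x y. \<bar>\<psi> x - \<psi> y\<bar> \<le> L * \<bar>x - y\<bar>)"

lemma lipschitz_test_bounds:
  assumes "lipschitz_test L \<psi>" shows "0 \<le> L" "0 \<le> \<psi> x" "\<psi> x \<le> 1" "\<bar>\<psi> x - \<psi> y\<bar> \<le> min 1 (L * \<bar>x - y\<bar>)"
proof -
  show *: "0 \<le> L" "0 \<le> \<psi> x" "\<psi> x \<le> 1" using assms by (auto simp: lipschitz_test_def)
  have "0 \<le> \<psi> x" "\<psi> x \<le> 1" "0 \<le> \<psi> y" "\<psi> y \<le> 1" "\<bar>\<psi> x - \<psi> y\<bar> \<le> L * \<bar>x - y\<bar>"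
    using assms by (auto simp: lipschitz_test_def)
  then show "\<bar>\<psi> x - \<psi> y\<bar> \<le> min 1 (L * \<bar>x - y\<bar>)" by auto
qed

lemma lipschitz_test_isCont:
  assumes "lipschitz_test L \<psi>" shows "isCont \<psi> x"
  unfolding continuous_at_eps_delta
proof (intro allI impI)
  fix e :: real assume e: "e > 0"
  have L: "0 \<le> L" using lipschitz_test_bounds(1)[OF assms] .
  have "dist (\<psi> y) (\<psi> x) < e" if "dist y x < e / (L + 1)" for y
  proof -
    have "\<bar>\<psi> y - \<psi> x\<bar> \<le> L * \<bar>y - x\<bar>" using lipschitz_test_bounds(4)[OF assms] by simp
    also have "\<dots> \<le> (L + 1) * \<bar>y - x\<bar>" using L by (intro mult_right_mono) auto
    also have "\<dots> < e" using that L by (simp add: dist_real_def field_simps)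
    finally show ?thesis by (simp add: dist_real_def)
  qed
  then show "\<exists>d>0. \<forall>y. dist y x < d \<longrightarrow> dist (\<psi> y) (\<psi> x) < e"
    using e L by (intro exI[of _ "e / (L + 1)"]) auto
qed

lemma lipschitz_test_measurable:
  assumes "lipschitz_test L \<psi>" shows "\<psi> \<in> borel_measurable borel"
  using lipschitz_test_isCont[OF assms]
  by (intro borel_measurable_continuous_onI continuous_at_imp_continuous_on) auto

lemma lipschitz_test_cts_step:
  assumes [arith]: "x < y" shows "lipschitz_test (1 / (y - x)) (cts_step x y)"
proof -
  have "\<bar>cts_step x y s - cts_step x y t\<bar> \<le> 1 / (y - x) * \<bar>s - t\<bar>" for s t
    by (auto simp: cts_step_def divide_simps)
  then show ?thesis by (auto simp: lipschitz_test_def cts_step_def divide_simps)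
qed

text \<open>The piecewise linear functions \<open>cts_step\<close>, which squeeze the distribution function between two of its values, are
themselves Lipschitz test functions.\<close>

lemma conv_in_distrI:
  assumes "prob_space M" "prob_space M'"
    and X: "\<And>n. X n \<in> borel_measurable M" and Y: "Y \<in> borel_measurable M'"
    and lim: "\<And>L \<psi>. lipschitz_test L \<psi> \<Longrightarrow> (\<lambda>n. \<integral>\<omega>. \<psi> (X n \<omega>) \<partial>M) \<longlonglongrightarrow> (\<integral>\<omega>. \<psi> (Y \<omega>) \<partial>M')"
  shows "conv_in_distr M X M' Y"
proof -
  interpret M: prob_space M by fact
  interpret M': prob_space M' by fact
  have "weak_conv_m (\<lambda>n. distr M borel (X n)) (distr M' borel Y)"
  proof (rule integral_cts_step_conv_imp_weak_conv)
    show "real_distribution (distr M borel (X n))" for n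
      using X by (rule M.real_distribution_distr)
    show "real_distribution (distr M' borel Y)"
      using Y by (rule M'.real_distribution_distr)
    fix x y :: real assume "x < y"
    then have t: "lipschitz_test (1 / (y - x)) (cts_step x y)" by (rule lipschitz_test_cts_step)
    show "(\<lambda>n. integral\<^sup>L (distr M borel (X n)) (cts_step x y)) \<longlonglongrightarrow> integral\<^sup>L (distr M' borel Y) (cts_step x y)"
      using lim[OF t] X Y lipschitz_test_measurable[OF t] by (simp add: integral_distr)
  qed
  then show ?thesis using X Y by (simp add: conv_in_distr_def)
qed

text \<open>The bound \<open>D\<close> is a variable of its own because the quantity whose convergence is known usually
only dominates \<open>min 1 (L * \<bar>X - Y\<bar>)\<close>.\<close>

lemma (in prob_space) expectation_test_diff:
  assumes \<psi>: "lipschitz_test L \<psi>" and [measurable]: "X \<in> borel_measurable M" "Y \<in> borel_measurable M" "D \<in> borel_measurable M"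
    and D: "\<And>\<omega>. \<omega> \<in> space M \<Longrightarrow> min 1 (L * \<bar>X \<omega> - Y \<omega>\<bar>) \<le> D \<omega>" "\<And>\<omega>. \<omega> \<in> space M \<Longrightarrow> D \<omega> \<le> 1"
  shows "\<bar>expectation (\<lambda>\<omega>. \<psi> (X \<omega>)) - expectation (\<lambda>\<omega>. \<psi> (Y \<omega>))\<bar> \<le> expectation D"
proof -
  note [measurable] = lipschitz_test_measurable[OF \<psi>]
  note b = lipschitz_test_bounds[OF \<psi>]
  have i: "integrable M (\<lambda>\<omega>. \<psi> (X \<omega>))" "integrable M (\<lambda>\<omega>. \<psi> (Y \<omega>))"
    by (rule integrable_const_bound[where B=1]; use b in auto)+
  have Dpos: "0 \<le> D \<omega>" if "\<omega> \<in> space M" for \<omega>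
    using D(1)[OF that] b(1) by (smt (verit) mult_nonneg_nonneg)
  have iD: "integrable M D"
    by (rule integrable_const_bound[where B=1]) (use D(2) Dpos in \<open>auto\<close>)
  have "\<bar>expectation (\<lambda>\<omega>. \<psi> (X \<omega>)) - expectation (\<lambda>\<omega>. \<psi> (Y \<omega>))\<bar> = \<bar>expectation (\<lambda>\<omega>. \<psi> (X \<omega>) - \<psi> (Y \<omega>))\<bar>"
    using i by simp
  also have "\<dots> \<le> expectation (\<lambda>\<omega>. \<bar>\<psi> (X \<omega>) - \<psi> (Y \<omega>)\<bar>)"
    by (rule integral_abs_bound)
  also have "\<dots> \<le> expectation D"
    using i iD order_trans[OF b(4) D(1)] by (intro integral_mono) auto
  finally show ?thesis .
qed

section \<open>The continuous mapping theorem on the Skorokhod space\<close>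

lemma skorokhod_topspace: "topspace skorokhod_topology = skorokhod_space"
  unfolding skorokhod_topology_def
  by (rule Metric_space.topspace_mtopology[OF Metric_space_skorokhod])

lemma space_skorokhod_borel [simp]: "space skorokhod_borel = skorokhod_space"
  by (simp add: skorokhod_borel_def space_measure_of_conv)

lemma continuous_map_skorokhod_measurable:
  assumes F: "continuous_map skorokhod_topology euclideanreal F"
  shows "F \<in> borel_measurable skorokhod_borel"
proof (rule borel_measurableI)
  fix S :: "real set" assume "open S"
  then have "openin skorokhod_topology {f \<in> topspace skorokhod_topology. F f \<in> S}"
    using F by (intro openin_continuous_map_preimage[OF F]) auto
  moreover have "{f \<in> topspace skorokhod_topology. F f \<in> S} = F -` S \<inter> space skorokhod_borel"
    by (auto simp: skorokhod_topspace)
  moreover have "{U. openin skorokhod_topology U} \<subseteq> Pow skorokhod_space"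
    using openin_subset skorokhod_topspace by fastforce
  ultimately show "F -` S \<inter> space skorokhod_borel \<in> sets skorokhod_borel"
    by (simp add: skorokhod_borel_def sets_measure_of)
qed

text \<open>The infimal convolution of \<open>\<Psi>\<close> with \<open>k\<close> times the metric: the largest \<open>k\<close>-Lipschitz function below \<open>\<Psi>\<close>. It serves to
bring a functional that is continuous only at some paths within reach of weak convergence, which speaks about
functionals that are continuous everywhere.\<close>

definition lipschitz_minorant :: "((real \<Rightarrow> real) \<Rightarrow> real) \<Rightarrow> nat \<Rightarrow> (real \<Rightarrow> real) \<Rightarrow> real" where
  "lipschitz_minorant \<Psi> k f = (INF g\<in>skorokhod_space. \<Psi> g + real k * skorokhod_dist f g)"

context
  fixes \<Psi> :: "(real \<Rightarrow> real) \<Rightarrow> real"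
  assumes \<Psi>01: "\<And>f. f \<in> skorokhod_space \<Longrightarrow> 0 \<le> \<Psi> f \<and> \<Psi> f \<le> 1"
begin

interpretation D: Metric_space skorokhod_space skorokhod_dist by (rule Metric_space_skorokhod)

lemma minorant_bdd: "bdd_below ((\<lambda>g. \<Psi> g + real k * skorokhod_dist f g) ` skorokhod_space)"
  using \<Psi>01 by (intro bdd_belowI2[of _ 0]) (auto intro: add_nonneg_nonneg)

lemma minorant_le:
  assumes "g \<in> skorokhod_space"
  shows "lipschitz_minorant \<Psi> k f \<le> \<Psi> g + real k * skorokhod_dist f g"
  unfolding lipschitz_minorant_def by (rule cINF_lower[OF minorant_bdd assms])

lemma minorant_le_self: "f \<in> skorokhod_space \<Longrightarrow> lipschitz_minorant \<Psi> k f \<le> \<Psi> f"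
  using minorant_le[of f k f] by simp

lemma minorant_nonneg: "f \<in> skorokhod_space \<Longrightarrow> 0 \<le> lipschitz_minorant \<Psi> k f"
  unfolding lipschitz_minorant_def using \<Psi>01
  by (intro cINF_greatest) (auto intro: add_nonneg_nonneg)

lemma minorant_lipschitz:
  assumes fg: "f \<in> skorokhod_space" "g \<in> skorokhod_space"
  shows "lipschitz_minorant \<Psi> k f \<le> lipschitz_minorant \<Psi> k g + real k * skorokhod_dist f g"
proof -
  have "lipschitz_minorant \<Psi> k f - real k * skorokhod_dist f g \<le> \<Psi> h + real k * skorokhod_dist g h"
    if h: "h \<in> skorokhod_space" for h
  proof -
    have "real k * skorokhod_dist f h \<le> real k * (skorokhod_dist f g + skorokhod_dist g h)"
      by (intro mult_left_mono D.triangle fg h) auto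
    then show ?thesis using minorant_le[OF h, of k f] by (simp add: algebra_simps)
  qed
  then have "lipschitz_minorant \<Psi> k f - real k * skorokhod_dist f g \<le> lipschitz_minorant \<Psi> k g"
    unfolding lipschitz_minorant_def[of _ _ g] using fg by (intro cINF_greatest) auto
  then show ?thesis by simp
qed

lemma minorant_continuous: "continuous_map skorokhod_topology euclideanreal (lipschitz_minorant \<Psi> k)"
proof -
  have "\<exists>\<delta>>0. \<forall>x. x \<in> skorokhod_space \<and> skorokhod_dist a x < \<delta> \<longrightarrow>
      dist (lipschitz_minorant \<Psi> k a) (lipschitz_minorant \<Psi> k x) < e"
    if a: "a \<in> skorokhod_space" and e: "e > 0" for a and e :: real
  proof (intro exI[of _ "e / (real k + 1)"] conjI allI impI)
    show "e / (real k + 1) > 0" using e by simp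
    fix x assume x: "x \<in> skorokhod_space \<and> skorokhod_dist a x < e / (real k + 1)"
    have "real k * skorokhod_dist a x \<le> (real k + 1) * skorokhod_dist a x"
      by (intro mult_right_mono) auto
    also have "\<dots> < e" using x by (simp add: field_simps)
    finally have "real k * skorokhod_dist a x < e" .
    then show "dist (lipschitz_minorant \<Psi> k a) (lipschitz_minorant \<Psi> k x) < e"
      using minorant_lipschitz[of a x k] minorant_lipschitz[of x a k] a x D.commute[of a x]
      by (auto simp: dist_real_def)
  qed
  then show ?thesis
    unfolding skorokhod_topology_def mtopology_is_euclidean[symmetric]
    by (subst D.metric_continuous_map) (auto intro: Met_TC.Metric_space_axioms)
qed

text \<open>Where \<open>\<Psi>\<close> is continuous the minorants recover its value: paths near \<open>f\<close> have nearly the value \<open>\<Psi> f\<close>, and for paths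
farther than \<open>\<delta>\<close> the penalty \<open>k \<delta>\<close> exceeds the range of \<open>\<Psi>\<close>.\<close>

lemma minorant_tendsto:
  assumes f: "f \<in> skorokhod_space"
    and cont: "\<And>e. e > 0 \<Longrightarrow> \<exists>\<delta>>0. \<forall>g\<in>skorokhod_space. skorokhod_dist f g < \<delta> \<longrightarrow> \<bar>\<Psi> g - \<Psi> f\<bar> < e"
  shows "(\<lambda>k. lipschitz_minorant \<Psi> k f) \<longlonglongrightarrow> \<Psi> f"
proof (rule LIMSEQ_I)
  fix e :: real assume e: "e > 0"
  obtain \<delta> where \<delta>: "\<delta> > 0" "\<And>g. g \<in> skorokhod_space \<Longrightarrow> skorokhod_dist f g < \<delta> \<Longrightarrow> \<bar>\<Psi> g - \<Psi> f\<bar> < e / 2"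
    using cont[of "e/2"] e by auto
  \<comment> \<open>beyond \<open>k0\<close> the penalty for a path at distance at least \<open>\<delta>\<close> is at least one\<close>
  obtain k0 :: nat where k0: "1 / \<delta> < real k0" using reals_Archimedean2 by blast
  show "\<exists>k0. \<forall>k\<ge>k0. norm (lipschitz_minorant \<Psi> k f - \<Psi> f) < e"
  proof (intro exI[of _ k0] allI impI)
    fix k assume k: "k0 \<le> k"
    have kd: "1 \<le> real k * \<delta>"
    proof -
      have "1 \<le> real k0 * \<delta>" using k0 \<delta>(1) by (simp add: field_simps)
      also have "\<dots> \<le> real k * \<delta>" using k \<delta>(1) by (intro mult_right_mono) auto
      finally show ?thesis .
    qed
    have "\<Psi> f - e / 2 \<le> \<Psi> g + real k * skorokhod_dist f g" if g: "g \<in> skorokhod_space" for g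
    proof (cases "skorokhod_dist f g < \<delta>")
      case True
      have "0 \<le> real k * skorokhod_dist f g" by simp
      then show ?thesis using \<delta>(2)[OF g True] by linarith
    next
      case False
      then have "1 \<le> real k * skorokhod_dist f g"
        using kd by (smt (verit) mult_left_mono of_nat_0_le_iff)
      then show ?thesis using \<Psi>01[OF g] \<Psi>01[OF f] e by linarith
    qed
    then have "\<Psi> f - e / 2 \<le> lipschitz_minorant \<Psi> k f"
      unfolding lipschitz_minorant_def using f by (intro cINF_greatest) auto
    then show "norm (lipschitz_minorant \<Psi> k f - \<Psi> f) < e"
      using minorant_le_self[OF f, of k] e by simp
  qed
qed

text \<open>Half of the continuous mapping theorem. A Lipschitz minorant is a bounded continuous functional below \<open>\<Psi>\<close>, so weak
convergence applies to it; at the limit it loses at most \<open>e/2\<close> by dominated convergence.\<close>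

lemma skorokhod_lower_semicontinuity:
  assumes "prob_space M" "prob_space M'" and conv: "skorokhod_weak_conv M X M' Y"
    and [measurable]: "\<And>n. (\<lambda>\<omega>. \<Psi> (X n \<omega>)) \<in> borel_measurable M" "(\<lambda>\<omega>. \<Psi> (Y \<omega>)) \<in> borel_measurable M'"
    and cont: "\<And>\<omega> e. \<omega> \<in> space M' \<Longrightarrow> e > 0 \<Longrightarrow>
      \<exists>\<delta>>0. \<forall>g\<in>skorokhod_space. skorokhod_dist (Y \<omega>) g < \<delta> \<longrightarrow> \<bar>\<Psi> g - \<Psi> (Y \<omega>)\<bar> < e"
    and e: "e > 0"
  shows "\<forall>\<^sub>F n in sequentially. (\<integral>\<omega>. \<Psi> (Y \<omega>) \<partial>M') - e < (\<integral>\<omega>. \<Psi> (X n \<omega>) \<partial>M)"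
proof -
  interpret M: prob_space M by fact
  interpret M': prob_space M' by fact
  have X: "X n \<in> M \<rightarrow>\<^sub>M skorokhod_borel" and Y: "Y \<in> M' \<rightarrow>\<^sub>M skorokhod_borel" for n
    using conv by (auto simp: skorokhod_weak_conv_def)
  have Xs: "X n \<omega> \<in> skorokhod_space" if "\<omega> \<in> space M" for n \<omega>
    using measurable_space[OF X that] by simp
  have Ys: "Y \<omega> \<in> skorokhod_space" if "\<omega> \<in> space M'" for \<omega>
    using measurable_space[OF Y that] by simp
  have ym [measurable]: "(\<lambda>\<omega>. lipschitz_minorant \<Psi> k (Y \<omega>)) \<in> borel_measurable M'"
    and xm [measurable]: "(\<lambda>\<omega>. lipschitz_minorant \<Psi> k (X n \<omega>)) \<in> borel_measurable M" for k n
    using continuous_map_skorokhod_measurable[OF minorant_continuous] X Y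
    by (auto intro: measurable_compose)
  have m01: "\<bar>lipschitz_minorant \<Psi> k f\<bar> \<le> 1" if "f \<in> skorokhod_space" for k f
    using minorant_nonneg[OF that, of k] minorant_le_self[OF that, of k] \<Psi>01[OF that] by auto
  have "(\<lambda>k. \<integral>\<omega>. lipschitz_minorant \<Psi> k (Y \<omega>) \<partial>M') \<longlonglongrightarrow> (\<integral>\<omega>. \<Psi> (Y \<omega>) \<partial>M')"
    by (rule integral_dominated_convergence[where w="\<lambda>_. 1"])
      (use m01 Ys minorant_tendsto cont in auto)
  then have "\<forall>\<^sub>F k in sequentially. (\<integral>\<omega>. \<Psi> (Y \<omega>) \<partial>M') - e/2 < (\<integral>\<omega>. lipschitz_minorant \<Psi> k (Y \<omega>) \<partial>M')"
    using e by (intro order_tendstoD) auto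
  then obtain k where k: "(\<integral>\<omega>. \<Psi> (Y \<omega>) \<partial>M') - e/2 < (\<integral>\<omega>. lipschitz_minorant \<Psi> k (Y \<omega>) \<partial>M')"
    by (meson eventually_happens' sequentially_bot)
  have "(\<lambda>n. \<integral>\<omega>. lipschitz_minorant \<Psi> k (X n \<omega>) \<partial>M) \<longlonglongrightarrow> (\<integral>\<omega>. lipschitz_minorant \<Psi> k (Y \<omega>) \<partial>M')"
    using conv minorant_continuous m01 unfolding skorokhod_weak_conv_def by blast
  then have "\<forall>\<^sub>F n in sequentially. (\<integral>\<omega>. lipschitz_minorant \<Psi> k (Y \<omega>) \<partial>M') - e/2 < (\<integral>\<omega>. lipschitz_minorant \<Psi> k (X n \<omega>) \<partial>M)"
    using e by (intro order_tendstoD) auto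
  then show ?thesis
  proof eventually_elim
    fix n assume *: "(\<integral>\<omega>. lipschitz_minorant \<Psi> k (Y \<omega>) \<partial>M') - e/2 < (\<integral>\<omega>. lipschitz_minorant \<Psi> k (X n \<omega>) \<partial>M)"
    have "(\<integral>\<omega>. lipschitz_minorant \<Psi> k (X n \<omega>) \<partial>M) \<le> (\<integral>\<omega>. \<Psi> (X n \<omega>) \<partial>M)"
      using \<Psi>01 Xs m01 minorant_le_self
      by (intro integral_mono M.integrable_const_bound[where B=1]) (auto)
    then show "(\<integral>\<omega>. \<Psi> (Y \<omega>) \<partial>M') - e < (\<integral>\<omega>. \<Psi> (X n \<omega>) \<partial>M)"
      using k * by linarith
  qed
qed

end

text \<open>The lower bound applied to \<open>\<Psi>\<close> and to \<open>1 - \<Psi>\<close>.\<close>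

lemma skorokhod_continuous_mapping:
  fixes \<Psi> :: "(real \<Rightarrow> real) \<Rightarrow> real"
  assumes "prob_space M" "prob_space M'" and conv: "skorokhod_weak_conv M X M' Y"
    and \<Psi>01: "\<And>f. f \<in> skorokhod_space \<Longrightarrow> 0 \<le> \<Psi> f \<and> \<Psi> f \<le> 1"
    and meas: "\<And>n. (\<lambda>\<omega>. \<Psi> (X n \<omega>)) \<in> borel_measurable M" "(\<lambda>\<omega>. \<Psi> (Y \<omega>)) \<in> borel_measurable M'"
    and cont: "\<And>\<omega> e. \<omega> \<in> space M' \<Longrightarrow> e > 0 \<Longrightarrow>
      \<exists>\<delta>>0. \<forall>g\<in>skorokhod_space. skorokhod_dist (Y \<omega>) g < \<delta> \<longrightarrow> \<bar>\<Psi> g - \<Psi> (Y \<omega>)\<bar> < e"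
  shows "(\<lambda>n. \<integral>\<omega>. \<Psi> (X n \<omega>) \<partial>M) \<longlonglongrightarrow> (\<integral>\<omega>. \<Psi> (Y \<omega>) \<partial>M')"
proof (rule tendstoI)
  fix e :: real assume e: "e > 0"
  interpret M: prob_space M by fact
  interpret M': prob_space M' by fact
  have Xs: "X n \<omega> \<in> skorokhod_space" if "\<omega> \<in> space M" for n \<omega>
    using conv measurable_space[OF _ that, of "X n" skorokhod_borel] by (auto simp: skorokhod_weak_conv_def)
  have Ys: "Y \<omega> \<in> skorokhod_space" if "\<omega> \<in> space M'" for \<omega>
    using conv measurable_space[OF _ that, of Y skorokhod_borel] by (auto simp: skorokhod_weak_conv_def)
  have i: "integrable M (\<lambda>\<omega>. \<Psi> (X n \<omega>))" for n
    by (rule M.integrable_const_bound[where B=1]) (use \<Psi>01 Xs meas in auto)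
  have i': "integrable M' (\<lambda>\<omega>. \<Psi> (Y \<omega>))"
    by (rule M'.integrable_const_bound[where B=1]) (use \<Psi>01 Ys meas in auto)
  have cont': "\<exists>\<delta>>0. \<forall>g\<in>skorokhod_space. skorokhod_dist (Y \<omega>) g < \<delta> \<longrightarrow> \<bar>(1 - \<Psi> g) - (1 - \<Psi> (Y \<omega>))\<bar> < e"
    if "\<omega> \<in> space M'" "e > 0" for \<omega> e
    using cont[OF that] by (simp add: abs_minus_commute)
  have "\<forall>\<^sub>F n in sequentially. (\<integral>\<omega>. 1 - \<Psi> (Y \<omega>) \<partial>M') - e < (\<integral>\<omega>. 1 - \<Psi> (X n \<omega>) \<partial>M)"
    by (rule skorokhod_lower_semicontinuity[of "\<lambda>f. 1 - \<Psi> f"])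
      (use assms cont' e in \<open>auto\<close>)
  moreover have "\<forall>\<^sub>F n in sequentially. (\<integral>\<omega>. \<Psi> (Y \<omega>) \<partial>M') - e < (\<integral>\<omega>. \<Psi> (X n \<omega>) \<partial>M)"
    by (rule skorokhod_lower_semicontinuity[of "\<Psi>"]) (use assms e in \<open>auto\<close>)
  ultimately show "\<forall>\<^sub>F n in sequentially. dist (\<integral>\<omega>. \<Psi> (X n \<omega>) \<partial>M) (\<integral>\<omega>. \<Psi> (Y \<omega>) \<partial>M') < e"
    by eventually_elim (use i i' in \<open>simp add: dist_real_def M.prob_space M'.prob_space\<close>)
qed

text \<open>A time change that is close to the identity moves a uniformly continuous path only a little, so near a continuous
path the Skorokhod metric controls the uniform distance.\<close>

lemma skorokhod_near_continuous_imp_uniform: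
  assumes f: "f \<in> skorokhod_space" and cont: "continuous_on {0..1} f" and e: "e > 0"
  shows "\<exists>\<delta>>0. \<forall>g\<in>skorokhod_space. skorokhod_dist f g < \<delta> \<longrightarrow> (\<forall>t\<in>{0..1}. \<bar>g t - f t\<bar> \<le> e)"
proof -
  have "uniformly_continuous_on {0..1} f"
    using cont by (intro compact_uniformly_continuous) auto
  then obtain d where d: "d > 0" "\<And>s t. s \<in> {0..1} \<Longrightarrow> t \<in> {0..1} \<Longrightarrow> dist s t < d \<Longrightarrow> dist (f s) (f t) < e / 2"
    unfolding uniformly_continuous_on_def using e by (metis half_gt_zero)
  show ?thesis
  proof (intro exI[of _ "min d (e/2)"] conjI ballI impI)
    show "min d (e/2) > 0" using d e by simp
    fix g t assume g: "g \<in> skorokhod_space" and lt: "skorokhod_dist f g < min d (e/2)" and t: "t \<in> {0..1::real}"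
    obtain \<epsilon> where \<epsilon>: "\<epsilon> < min d (e/2)" "skorokhod_close f g \<epsilon>"
      using skorokhod_dist_less[OF f g lt] by auto
    obtain \<tau> where \<tau>: "\<tau> \<in> time_changes" "\<And>t. t \<in> {0..1} \<Longrightarrow> \<bar>\<tau> t - t\<bar> \<le> \<epsilon> \<and> \<bar>g t - f (\<tau> t)\<bar> \<le> \<epsilon>"
      using skorokhod_close_sym[OF \<epsilon>(2)] unfolding skorokhod_close_def by blast
    have "dist (f (\<tau> t)) (f t) < e / 2"
      using \<tau>(2)[OF t] \<epsilon>(1) by (intro d(2) time_changes_in[OF \<tau>(1) t] t) (auto simp: dist_real_def)
    moreover have "\<bar>g t - f (\<tau> t)\<bar> \<le> e / 2" using \<tau>(2)[OF t] \<epsilon>(1) by simp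
    ultimately show "\<bar>g t - f t\<bar> \<le> e" unfolding dist_real_def by linarith
  qed
qed

text \<open>If the functional were discontinuous at a path of the limit, there would be paths ever closer to it in the Skorokhod
metric on which the functional stays away from its value there; as the limit path is continuous, they converge
to it uniformly.\<close>

lemma skorokhod_continuous_limit_mapping:
  fixes \<Psi> :: "(real \<Rightarrow> real) \<Rightarrow> real"
  assumes M: "prob_space M" and M': "prob_space M'" and conv: "skorokhod_weak_conv M X M' Y"
    and \<Psi>01: "\<And>f. f \<in> skorokhod_space \<Longrightarrow> 0 \<le> \<Psi> f \<and> \<Psi> f \<le> 1"
    and meas: "\<And>n. (\<lambda>\<omega>. \<Psi> (X n \<omega>)) \<in> borel_measurable M" "(\<lambda>\<omega>. \<Psi> (Y \<omega>)) \<in> borel_measurable M'"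
    and paths: "\<And>\<omega>. \<omega> \<in> space M' \<Longrightarrow> continuous_on {0..1} (Y \<omega>)"
    and lim: "\<And>\<omega> g. \<omega> \<in> space M' \<Longrightarrow> (\<And>n. g n \<in> skorokhod_space) \<Longrightarrow>
      uniform_limit {0..1} g (Y \<omega>) sequentially \<Longrightarrow> (\<lambda>n. \<Psi> (g n)) \<longlonglongrightarrow> \<Psi> (Y \<omega>)"
  shows "(\<lambda>n. \<integral>\<omega>. \<Psi> (X n \<omega>) \<partial>M) \<longlonglongrightarrow> (\<integral>\<omega>. \<Psi> (Y \<omega>) \<partial>M')"
proof (rule skorokhod_continuous_mapping[OF M M' conv \<Psi>01 meas])
  fix \<omega> and e :: real assume \<omega>: "\<omega> \<in> space M'" and e: "e > 0"
  have Y: "Y \<omega> \<in> skorokhod_space"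
    using conv measurable_space[OF _ \<omega>, of Y skorokhod_borel] by (auto simp: skorokhod_weak_conv_def)
  show "\<exists>\<delta>>0. \<forall>g\<in>skorokhod_space. skorokhod_dist (Y \<omega>) g < \<delta> \<longrightarrow> \<bar>\<Psi> g - \<Psi> (Y \<omega>)\<bar> < e"
  proof (rule ccontr)
    assume neg: "\<not> ?thesis"
    have "\<exists>g\<in>skorokhod_space. (\<forall>t\<in>{0..1}. \<bar>g t - Y \<omega> t\<bar> \<le> 1 / real (Suc n)) \<and> \<not> \<bar>\<Psi> g - \<Psi> (Y \<omega>)\<bar> < e" for n
    proof -
      obtain \<delta> where "\<delta> > 0" "\<forall>g\<in>skorokhod_space. skorokhod_dist (Y \<omega>) g < \<delta> \<longrightarrow> (\<forall>t\<in>{0..1}. \<bar>g t - Y \<omega> t\<bar> \<le> 1 / real (Suc n))"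
        using skorokhod_near_continuous_imp_uniform[OF Y paths[OF \<omega>], of "1 / real (Suc n)"] by auto
      then show ?thesis using neg by metis
    qed
    then obtain g where g: "\<And>n. g n \<in> skorokhod_space" "\<And>n t. t \<in> {0..1} \<Longrightarrow> \<bar>g n t - Y \<omega> t\<bar> \<le> 1 / real (Suc n)"
      "\<And>n. \<not> \<bar>\<Psi> (g n) - \<Psi> (Y \<omega>)\<bar> < e" by metis
    have "uniform_limit {0..1} g (Y \<omega>) sequentially"
    proof (rule uniform_limitI)
      fix d :: real assume "d > 0"
      then obtain n0 where n0: "1 / real (Suc n0) < d" using nat_approx_posE by metis
      show "\<forall>\<^sub>F n in sequentially. \<forall>t\<in>{0..1}. dist (g n t) (Y \<omega> t) < d"
        using eventually_ge_at_top[of n0]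
      proof eventually_elim
        fix n assume "n0 \<le> n"
        then have "1 / real (Suc n) \<le> 1 / real (Suc n0)" by (intro divide_left_mono) auto
        then show "\<forall>t\<in>{0..1}. dist (g n t) (Y \<omega> t) < d"
          using g(2)[of _ n] n0 by (fastforce simp: dist_real_def)
      qed
    qed
    then have "(\<lambda>n. \<Psi> (g n)) \<longlonglongrightarrow> \<Psi> (Y \<omega>)" using lim[OF \<omega>] g(1) by blast
    then have "\<forall>\<^sub>F n in sequentially. \<bar>\<Psi> (g n) - \<Psi> (Y \<omega>)\<bar> < e"
      using e by (auto dest: tendstoD simp: dist_real_def)
    then show False using g(3) by (simp)
  qed
qed

section \<open>Functions of bounded variation\<close>

text \<open>The function \<open>v t\<close> is the total variation of \<open>a\<close> on \<open>{c..t}\<close>. Appending the points \<open>s\<close> and \<open>t\<close> to a partition of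
\<open>{c..s}\<close> gives a partition of \<open>{c..t}\<close>, whence the superadditivity.\<close>

lemma bounded_variation_dominated:
  assumes bv: "bounded_variation_on c d a" and "c \<le> d"
  obtains v where "\<And>s t. c \<le> s \<Longrightarrow> s \<le> t \<Longrightarrow> t \<le> d \<Longrightarrow> \<bar>a t - a s\<bar> \<le> v t - v s"
proof -
  define S where "S t = {(\<Sum>i<n. \<bar>a (\<tau> (Suc i)) - a (\<tau> i)\<bar>) | n \<tau>.
      mono_on {..n} \<tau> \<and> \<tau> ` {..n::nat} \<subseteq> {c..t}}" for t :: real
  obtain B where B: "\<And>n (\<tau> :: nat \<Rightarrow> real). mono_on {..n} \<tau> \<Longrightarrow> \<tau> ` {..n} \<subseteq> {c..d} \<Longrightarrow>
      (\<Sum>i<n. \<bar>a (\<tau> (Suc i)) - a (\<tau> i)\<bar>) \<le> B"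
    using bv unfolding bounded_variation_on_def by blast
  have bdd: "bdd_above (S t)" if "t \<le> d" for t
    using that by (intro bdd_aboveI[of _ B]) (auto simp: S_def intro!: B)
  have "\<bar>a t - a s\<bar> \<le> Sup (S t) - Sup (S s)" if st: "c \<le> s" "s \<le> t" "t \<le> d" for s t
  proof -
    have "x \<le> Sup (S t) - \<bar>a t - a s\<bar>" if x: "x \<in> S s" for x
    proof -
      obtain n and \<tau> :: "nat \<Rightarrow> real" where n: "mono_on {..n} \<tau>" "\<tau> ` {..n} \<subseteq> {c..s}"
        and x: "x = (\<Sum>i<n. \<bar>a (\<tau> (Suc i)) - a (\<tau> i)\<bar>)"
        using x by (auto simp: S_def)
      define \<rho> where "\<rho> i = (if i \<le> n then \<tau> i else if i = Suc n then s else t)" for i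
      have le: "\<tau> i \<le> s" "c \<le> \<tau> i" if "i \<le> n" for i using n(2) that by auto
      have "mono_on {..Suc (Suc n)} \<rho>"
      proof (rule mono_onI)
        fix i j :: nat assume "i \<le> j"
        then show "\<rho> i \<le> \<rho> j"
          using le[of i] st mono_onD[OF n(1), of i j] by (auto simp: \<rho>_def)
      qed
      moreover have "\<rho> ` {..Suc (Suc n)} \<subseteq> {c..t}"
        using le st by (force simp: \<rho>_def)
      ultimately have "(\<Sum>i<Suc (Suc n). \<bar>a (\<rho> (Suc i)) - a (\<rho> i)\<bar>) \<in> S t"
        unfolding S_def by blast
      then have "(\<Sum>i<Suc (Suc n). \<bar>a (\<rho> (Suc i)) - a (\<rho> i)\<bar>) \<le> Sup (S t)"
        by (rule cSup_upper[OF _ bdd[OF st(3)]])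
      moreover have "(\<Sum>i<n. \<bar>a (\<rho> (Suc i)) - a (\<rho> i)\<bar>) = x"
        unfolding x by (intro sum.cong) (auto simp: \<rho>_def)
      ultimately show ?thesis by (simp add: \<rho>_def)
    qed
    moreover have "0 \<in> S s"
      unfolding S_def using st by (intro CollectI exI[of _ 0] exI[of _ "\<lambda>_. c"]) (auto simp: mono_on_def)
    ultimately have "Sup (S s) \<le> Sup (S t) - \<bar>a t - a s\<bar>"
      by (intro cSup_least) auto
    then show ?thesis by simp
  qed
  then show ?thesis by (rule that)
qed

text \<open>Bounded variation enters every estimate below through a dominating function, whose increments telescope when error
terms are added over a grid. Such a function is nondecreasing.\<close>

locale variation_dominated =
  fixes a v :: "real \<Rightarrow> real" and A :: real
  assumes dom: "\<And>s t. 0 \<le> s \<Longrightarrow> s \<le> t \<Longrightarrow> t \<le> 1 \<Longrightarrow> \<bar>a t - a s\<bar> \<le> v t - v s"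
    and A: "\<And>t. 0 \<le> t \<Longrightarrow> t \<le> 1 \<Longrightarrow> \<bar>a t\<bar> \<le> A"
begin

lemma A_nonneg: "0 \<le> A" using A[of 0] by simp

lemma v_mono: "0 \<le> s \<Longrightarrow> s \<le> t \<Longrightarrow> t \<le> 1 \<Longrightarrow> v s \<le> v t"
  using dom[of s t] by simp

end

section \<open>Oscillation of a path\<close>

text \<open>The modulus of continuity with the two times restricted to the rationals. A countable index set makes it a
measurable function of a random path, and it loses nothing here, because the paths to which it is applied are
continuous or constant between grid points.\<close>

definition osc :: "real \<Rightarrow> (real \<Rightarrow> real) \<Rightarrow> real" where
  "osc h f = (SUP p\<in>{p. fst p \<in> \<rat> \<inter> {0..1} \<and> snd p \<in> \<rat> \<inter> {0..1} \<and> \<bar>fst p - snd p\<bar> \<le> h}.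
     \<bar>f (fst p) - f (snd p)\<bar>)"

abbreviation bounded_path :: "(real \<Rightarrow> real) \<Rightarrow> bool" where
  "bounded_path f \<equiv> \<exists>B. \<forall>t\<in>{0..1}. \<bar>f t\<bar> \<le> B"

lemma osc_bdd:
  assumes "bounded_path f"
  shows "bdd_above ((\<lambda>p. \<bar>f (fst p) - f (snd p)\<bar>) `
    {p. fst p \<in> \<rat> \<inter> {0..1} \<and> snd p \<in> \<rat> \<inter> {0..1} \<and> \<bar>fst p - snd p\<bar> \<le> h})"
proof -
  obtain B where "\<And>t. t \<in> {0..1} \<Longrightarrow> \<bar>f t\<bar> \<le> B" using assms by blast
  then have "\<bar>f s - f t\<bar> \<le> 2 * B" if "s \<in> {0..1}" "t \<in> {0..1}" for s t
    using that by (smt (verit))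
  then show ?thesis by (intro bdd_aboveI2[of _ _ "2 * B"]) auto
qed

lemma osc_ge:
  assumes "bounded_path f" "s \<in> \<rat>" "t \<in> \<rat>" "s \<in> {0..1}" "t \<in> {0..1}" "\<bar>s - t\<bar> \<le> h"
  shows "\<bar>f s - f t\<bar> \<le> osc h f"
  unfolding osc_def
  using cSUP_upper[OF _ osc_bdd[OF assms(1), of h], of "(s, t)"] assms by simp

lemma osc_le:
  assumes "0 \<le> h" "\<And>s t. s \<in> {0..1} \<Longrightarrow> t \<in> {0..1} \<Longrightarrow> \<bar>s - t\<bar> \<le> h \<Longrightarrow> s \<in> \<rat> \<Longrightarrow> t \<in> \<rat> \<Longrightarrow> \<bar>f s - f t\<bar> \<le> c"
  shows "osc h f \<le> c"
  unfolding osc_def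
proof (rule cSUP_least)
  have "(0, 0) \<in> {p. fst p \<in> \<rat> \<inter> {0..1::real} \<and> snd p \<in> \<rat> \<inter> {0..1::real} \<and> \<bar>fst p - snd p\<bar> \<le> h}"
    using assms(1) by simp
  then show "{p. fst p \<in> \<rat> \<inter> {0..1::real} \<and> snd p \<in> \<rat> \<inter> {0..1::real} \<and> \<bar>fst p - snd p\<bar> \<le> h} \<noteq> {}" by blast
qed (use assms(2) in auto)

lemma osc_nonneg: "bounded_path f \<Longrightarrow> 0 \<le> h \<Longrightarrow> 0 \<le> osc h f"
  using osc_ge[of f 0 0 h] by simp

lemma osc_mono: "bounded_path f \<Longrightarrow> 0 \<le> h \<Longrightarrow> h \<le> h' \<Longrightarrow> osc h f \<le> osc h' f"
  by (rule osc_le, assumption, rule osc_ge) (assumption | linarith)+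

lemma osc_perturb:
  assumes "bounded_path f" "0 \<le> h" "\<And>t. t \<in> {0..1} \<Longrightarrow> \<bar>g t - f t\<bar> \<le> e"
  shows "osc h g \<le> osc h f + 2 * e"
proof (rule osc_le[OF assms(2)])
  fix s t :: real assume st: "s \<in> {0..1}" "t \<in> {0..1}" "\<bar>s - t\<bar> \<le> h" "s \<in> \<rat>" "t \<in> \<rat>"
  show "\<bar>g s - g t\<bar> \<le> osc h f + 2 * e"
    using osc_ge[OF assms(1) st(4,5,1,2,3)] assms(3)[OF st(1)] assms(3)[OF st(2)] by linarith
qed

lemma continuous_bounded_path:
  assumes "continuous_on {0..1} f" shows "bounded_path f"
proof -
  have "bounded (f ` {0..1})" using assms by (intro compact_imp_bounded compact_continuous_image) auto
  then show ?thesis by (auto simp: bounded_iff)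
qed

lemma osc_tendsto_0:
  assumes "continuous_on {0..1} f"
  shows "(\<lambda>m. osc (1 / real m) f) \<longlonglongrightarrow> 0"
proof (rule LIMSEQ_I)
  fix e :: real assume e: "e > 0"
  have b: "bounded_path f" using assms by (rule continuous_bounded_path)
  have "uniformly_continuous_on {0..1} f"
    using assms by (intro compact_uniformly_continuous) auto
  then obtain d where d: "d > 0" "\<And>s t. s \<in> {0..1} \<Longrightarrow> t \<in> {0..1} \<Longrightarrow> dist s t < d \<Longrightarrow> dist (f s) (f t) < e / 2"
    unfolding uniformly_continuous_on_def using e by (metis half_gt_zero)
  obtain m0 :: nat where m0: "m0 > 0" "1 / real m0 < d"
    using d(1) by (metis nat_approx_posE zero_less_Suc)
  show "\<exists>m0. \<forall>m\<ge>m0. norm (osc (1 / real m) f - 0) < e"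
  proof (intro exI[of _ m0] allI impI)
    fix m assume m: "m0 \<le> m"
    have "1 / real m \<le> 1 / real m0" using m m0 by (intro divide_left_mono) auto
    then have "1 / real m < d" using m0(2) by simp
    then have "osc (1 / real m) f \<le> e / 2"
      using d(2) by (intro osc_le) (auto simp: dist_real_def intro!: less_imp_le)
    then show "norm (osc (1 / real m) f - 0) < e" using osc_nonneg[OF b, of "1 / real m"] e by simp
  qed
qed

lemma osc_measurable:
  assumes "\<And>t. t \<in> {0..1} \<Longrightarrow> (\<lambda>\<omega>. Y \<omega> t) \<in> borel_measurable M"
    and "\<And>\<omega>. \<omega> \<in> space M \<Longrightarrow> bounded_path (Y \<omega>)"
  shows "(\<lambda>\<omega>. osc h (Y \<omega>)) \<in> borel_measurable M"
  unfolding osc_def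
proof (rule borel_measurable_cSUP)
  have "countable (\<rat> \<times> \<rat> :: (real \<times> real) set)" using countable_rat by blast
  then show "countable {p. fst p \<in> \<rat> \<inter> {0..1::real} \<and> snd p \<in> \<rat> \<inter> {0..1::real} \<and> \<bar>fst p - snd p\<bar> \<le> h}"
    by (rule countable_subset[rotated]) auto
  fix p :: "real \<times> real"
  assume "p \<in> {p. fst p \<in> \<rat> \<inter> {0..1::real} \<and> snd p \<in> \<rat> \<inter> {0..1::real} \<and> \<bar>fst p - snd p\<bar> \<le> h}"
  then have [measurable]: "(\<lambda>\<omega>. Y \<omega> (fst p)) \<in> borel_measurable M" "(\<lambda>\<omega>. Y \<omega> (snd p)) \<in> borel_measurable M"
    using assms(1) by auto
  show "(\<lambda>\<omega>. \<bar>Y \<omega> (fst p) - Y \<omega> (snd p)\<bar>) \<in> borel_measurable M" by measurable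
qed (rule osc_bdd[OF assms(2)])

lemma osc_uniform_limit:
  assumes b: "bounded_path f" "\<And>n. bounded_path (g n)" and h: "0 \<le> h"
    and lim: "uniform_limit {0..1} g f sequentially"
  shows "(\<lambda>n. osc h (g n)) \<longlonglongrightarrow> osc h f"
proof (rule tendstoI)
  fix e :: real assume e: "e > 0"
  have "\<forall>\<^sub>F n in sequentially. \<forall>t\<in>{0..1}. dist (g n t) (f t) < e / 3"
    using uniform_limitD[OF lim, of "e/3"] e by simp
  then show "\<forall>\<^sub>F n in sequentially. dist (osc h (g n)) (osc h f) < e"
  proof eventually_elim
    fix n assume "\<forall>t\<in>{0..1}. dist (g n t) (f t) < e / 3"
    then have *: "\<bar>g n t - f t\<bar> \<le> e / 3" "\<bar>f t - g n t\<bar> \<le> e / 3" if "t \<in> {0..1}" for t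
      using that by (auto simp: dist_real_def abs_minus_commute intro: less_imp_le)
    show "dist (osc h (g n)) (osc h f) < e"
      using osc_perturb[OF b(1) h *(1)] osc_perturb[OF b(2) h *(2)] e
      by (simp add: dist_real_def abs_less_iff)
  qed
qed

section \<open>Weighted sums of path increments\<close>

definition weighted_sum :: "(real \<Rightarrow> real) \<Rightarrow> (real \<Rightarrow> real) \<Rightarrow> nat \<Rightarrow> nat \<Rightarrow> real" where
  "weighted_sum a f n k = (\<Sum>l=1..k. a (real l / real n) * (f (real l / real n) - f (real (l - 1) / real n)))"

lemma sum_telescope_Ioc:
  fixes g :: "nat \<Rightarrow> real"
  assumes "p \<le> q" shows "(\<Sum>l\<in>{p<..q}. g l - g (l - 1)) = g q - g p"
  using assms
proof (induction q rule: dec_induct)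
  case (step q)
  have "{p<..Suc q} = insert (Suc q) {p<..q}" using step.hyps by auto
  then show ?case using step.IH by simp
qed simp

text \<open>Summation by parts in inductive form. Passing from \<open>q\<close> to \<open>Suc q\<close>, the reference value \<open>a y\<close> is exchanged for
\<open>a (x (Suc q))\<close>, which makes the new last term vanish; the exchange costs \<open>a (x (Suc q)) - a y\<close> times the
total increment of \<open>f\<close>, that is at most \<open>w * (v y - v (x (Suc q)))\<close>, and these costs telescope.\<close>

lemma summation_by_parts_bound:
  fixes a v f :: "real \<Rightarrow> real" and x :: "nat \<Rightarrow> real" and w z y :: real
  assumes dom: "\<And>s t. 0 \<le> s \<Longrightarrow> s \<le> t \<Longrightarrow> t \<le> 1 \<Longrightarrow> \<bar>a t - a s\<bar> \<le> v t - v s"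
    and w: "0 \<le> w" and x: "mono x" and z: "0 \<le> z"
    and "p \<le> q" "\<And>l. p < l \<Longrightarrow> l \<le> q \<Longrightarrow> z \<le> x l \<and> \<bar>f (x l) - f (x p)\<bar> \<le> w"
    and "z \<le> y" "p < q \<Longrightarrow> x q \<le> y" "y \<le> 1"
  shows "\<bar>\<Sum>l\<in>{p<..q}. (a (x l) - a y) * (f (x l) - f (x (l - 1)))\<bar> \<le> w * (v y - v z)"
  using assms(5-)
proof (induction q arbitrary: y rule: dec_induct)
  case base
  have "0 \<le> v y - v z" using dom[of z y] z base by linarith
  then show ?case using w by simp
next
  case (step q)
  have q: "z \<le> x (Suc q)" "\<bar>f (x (Suc q)) - f (x p)\<bar> \<le> w" "x (Suc q) \<le> y"
    using step by auto
  have IH: "\<bar>\<Sum>l\<in>{p<..q}. (a (x l) - a (x (Suc q))) * (f (x l) - f (x (l - 1)))\<bar> \<le> w * (v (x (Suc q)) - v z)"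
    using step.prems q x by (intro step.IH) (auto simp: mono_def)
  have ins: "{p<..Suc q} = insert (Suc q) {p<..q}" using step.hyps by auto
  have tele: "(\<Sum>l\<in>{p<..q}. f (x l) - f (x (l - 1))) = f (x q) - f (x p)"
    using sum_telescope_Ioc[OF step.hyps(1), of "\<lambda>l. f (x l)"] .
  have "(\<Sum>l\<in>{p<..Suc q}. (a (x l) - a y) * (f (x l) - f (x (l - 1)))) =
      (\<Sum>l\<in>{p<..q}. (a (x l) - a (x (Suc q))) * (f (x l) - f (x (l - 1))))
      + (a (x (Suc q)) - a y) * (\<Sum>l\<in>{p<..q}. f (x l) - f (x (l - 1)))
      + (a (x (Suc q)) - a y) * (f (x (Suc q)) - f (x q))"
    unfolding ins sum_distrib_left by (simp add: sum.distrib[symmetric] algebra_simps)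
  also have "\<dots> = (\<Sum>l\<in>{p<..q}. (a (x l) - a (x (Suc q))) * (f (x l) - f (x (l - 1))))
      + (a (x (Suc q)) - a y) * (f (x (Suc q)) - f (x p))"
    unfolding tele by (simp add: algebra_simps)
  finally have eq: "(\<Sum>l\<in>{p<..Suc q}. (a (x l) - a y) * (f (x l) - f (x (l - 1)))) = \<dots>" .
  have "\<bar>(a (x (Suc q)) - a y) * (f (x (Suc q)) - f (x p))\<bar> \<le> (v y - v (x (Suc q))) * w"
    unfolding abs_mult using q dom[of "x (Suc q)" y] z step.prems
    by (intro mult_mono) (auto simp: abs_minus_commute)
  then show ?case unfolding eq using IH by (simp add: algebra_simps abs_le_iff)
qed

text \<open>The setting of a rescaled partial sum path, which is determined by its values at the multiples of \<open>1/N\<close>.\<close>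

locale step_path = variation_dominated a v A
  for a v :: "real \<Rightarrow> real" and A :: real +
  fixes f :: "real \<Rightarrow> real" and N :: nat
  assumes N: "0 < N"
    and bounded: "bounded_path f"
    and step: "\<And>t. 0 \<le> t \<Longrightarrow> t \<le> 1 \<Longrightarrow> f t = f (real (nat \<lfloor>real N * t\<rfloor>) / real N)"
begin

abbreviation "K \<equiv> v 1 - v 0 + A"

lemma K_nonneg: "0 \<le> K" using v_mono[of 0 1] A_nonneg by simp

text \<open>On a short time interval the weight may be frozen at its right end point: the error is the oscillation of the path
times the variation of the weight over that interval. Rationality of \<open>s\<close> makes it an admissible time for \<open>osc\<close>; the
time \<open>t\<close> may be arbitrary because \<open>f t\<close> equals the value at a grid point.\<close>

lemma block_estimate:
  assumes s: "s \<in> \<rat>" "0 \<le> s" and t: "s \<le> t" "t \<le> 1" "t - s \<le> h"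
  shows "\<bar>weighted_sum a f N (nat \<lfloor>real N * t\<rfloor>) - weighted_sum a f N (nat \<lfloor>real N * s\<rfloor>) - a t * (f t - f s)\<bar>
      \<le> osc h f * (v t - v s)"
    and "\<bar>f t - f s\<bar> \<le> osc h f"
proof -
  define p where "p = nat \<lfloor>real N * s\<rfloor>"
  define q where "q = nat \<lfloor>real N * t\<rfloor>"
  define x where "x l = real l / real N" for l
  have "real N * s \<le> real N * t" using t by (intro mult_left_mono) auto
  then have pq: "p \<le> q" unfolding p_def q_def by (intro nat_mono floor_mono)
  have ft: "f t = f (x q)" and fs: "f s = f (x p)"
    using step[of t] step[of s] s t by (auto simp: p_def q_def x_def)
  have xq: "x q \<le> t"
    unfolding x_def q_def using N s t by (simp add: field_simps) 
  have xl: "s \<le> x l" "x l \<le> t" "\<bar>f (x l) - f (x p)\<bar> \<le> osc h f" if l: "p < l" "l \<le> q" for l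
  proof -
    have "real N * s < real l" using l(1) unfolding p_def by linarith
    then show sl: "s \<le> x l" using N by (simp add: x_def field_simps)
    have "x l \<le> x q" using l(2) by (simp add: x_def divide_right_mono)
    then show lt: "x l \<le> t" using xq by simp
    have "x l \<in> \<rat>" by (simp add: x_def)
    then show "\<bar>f (x l) - f (x p)\<bar> \<le> osc h f"
      unfolding fs[symmetric] using s t sl lt by (intro osc_ge bounded) auto
  qed
  have h: "0 \<le> h" using t by simp
  show fts: "\<bar>f t - f s\<bar> \<le> osc h f"
    using xl(3)[of q] pq osc_nonneg[OF bounded h] unfolding ft fs by (cases "p = q") auto
  have "{1..q} = {1..p} \<union> {p<..q}" using pq by auto
  then have split: "weighted_sum a f N q = weighted_sum a f N p + (\<Sum>l\<in>{p<..q}. a (x l) * (f (x l) - f (x (l - 1))))"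
    unfolding weighted_sum_def x_def by (subst sum.union_disjoint[symmetric]) auto
  have tele: "(\<Sum>l\<in>{p<..q}. f (x l) - f (x (l - 1))) = f (x q) - f (x p)"
    using sum_telescope_Ioc[OF pq, of "\<lambda>l. f (x l)"] .
  have "weighted_sum a f N q - weighted_sum a f N p - a t * (f t - f s)
      = (\<Sum>l\<in>{p<..q}. a (x l) * (f (x l) - f (x (l - 1)))) - a t * (\<Sum>l\<in>{p<..q}. f (x l) - f (x (l - 1)))"
    unfolding split tele ft fs by simp
  also have "\<dots> = (\<Sum>l\<in>{p<..q}. (a (x l) - a t) * (f (x l) - f (x (l - 1))))"
    unfolding sum_distrib_left by (simp add: sum_subtractf[symmetric] algebra_simps)
  also have "\<bar>\<dots>\<bar> \<le> osc h f * (v t - v s)"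
  proof (rule summation_by_parts_bound[OF dom])
    show "mono x" by (auto simp: mono_def x_def divide_right_mono)
  qed (use xl s t pq xq osc_nonneg[OF bounded h] in auto)
  finally show "\<bar>weighted_sum a f N (nat \<lfloor>real N * t\<rfloor>) - weighted_sum a f N (nat \<lfloor>real N * s\<rfloor>) - a t * (f t - f s)\<bar>
      \<le> osc h f * (v t - v s)" unfolding p_def q_def .
qed

text \<open>The block estimate for the single block from \<open>0\<close> to \<open>t\<close>, where the weighted sum starts at zero.\<close>

lemma weighted_sum_bound:
  assumes t: "0 \<le> t" "t \<le> 1"
  shows "\<bar>weighted_sum a f N (nat \<lfloor>real N * t\<rfloor>)\<bar> \<le> K * osc 1 f"
proof -
  have o: "0 \<le> osc 1 f" using osc_nonneg[OF bounded] by simp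
  have 0: "weighted_sum a f N (nat \<lfloor>real N * 0\<rfloor>) = 0" by (simp add: weighted_sum_def)
  have "\<bar>a t * (f t - f 0)\<bar> \<le> A * osc 1 f"
    unfolding abs_mult using A[of t] block_estimate(2)[of 0 t 1] t A_nonneg
    by (intro mult_mono) auto
  moreover have "osc 1 f * (v t - v 0) \<le> osc 1 f * (v 1 - v 0)"
    using o v_mono[of t 1] t by (intro mult_left_mono) auto
  moreover have "\<bar>weighted_sum a f N (nat \<lfloor>real N * t\<rfloor>) - a t * (f t - f 0)\<bar> \<le> osc 1 f * (v t - v 0)"
    using block_estimate(1)[of 0 t 1] 0 t by simp
  ultimately show ?thesis by (simp add: algebra_simps)
qed

lemma coarse_grid_at_nodes:
  assumes m: "0 < m" and k: "k \<le> m"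
  shows "\<bar>weighted_sum a f N (nat \<lfloor>real N * (real k / real m)\<rfloor>) - weighted_sum a f m k\<bar>
    \<le> osc (1 / real m) f * (v (real k / real m) - v 0)"
  using k
proof (induction k)
  case 0
  then show ?case by (simp add: weighted_sum_def)
next
  case (Suc k)
  let ?s = "real k / real m" and ?t = "real (Suc k) / real m"
  have "\<bar>weighted_sum a f N (nat \<lfloor>real N * ?t\<rfloor>) - weighted_sum a f N (nat \<lfloor>real N * ?s\<rfloor>) - a ?t * (f ?t - f ?s)\<bar>
      \<le> osc (1 / real m) f * (v ?t - v ?s)"
    by (rule block_estimate) (use m Suc.prems in \<open>auto simp: field_simps\<close>)
  moreover have "weighted_sum a f m (Suc k) = weighted_sum a f m k + a ?t * (f ?t - f ?s)"
    by (simp add: weighted_sum_def)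
  moreover have "\<bar>weighted_sum a f N (nat \<lfloor>real N * ?s\<rfloor>) - weighted_sum a f m k\<bar>
    \<le> osc (1 / real m) f * (v ?s - v 0)" using Suc by simp
  ultimately show ?case by (simp add: algebra_simps abs_le_iff)
qed

text \<open>At the nodes of the coarse grid the block errors add up to the variation of \<open>a\<close> up to that node; the incomplete
last cell contributes one more block and the frozen term \<open>a t * (f t - f s)\<close>, which accounts for the summand \<open>A\<close>
of \<open>K\<close>.\<close>

lemma coarse_grid:
  assumes m: "0 < m" and t: "0 \<le> t" "t \<le> 1"
  shows "\<bar>weighted_sum a f N (nat \<lfloor>real N * t\<rfloor>) - weighted_sum a f m (nat \<lfloor>real m * t\<rfloor>)\<bar>
    \<le> K * osc (1 / real m) f"
proof -
  define k where "k = nat \<lfloor>real m * t\<rfloor>"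
  define s where "s = real k / real m"
  define w where "w = osc (1 / real m) f"
  have w: "0 \<le> w" using osc_nonneg[OF bounded] by (simp add: w_def)
  have km: "real k \<le> real m * t" "real m * t < real k + 1" using t by (auto simp: k_def)
  have "real m * t \<le> real m" using t by (simp add: mult_left_le)
  then have k: "k \<le> m" using km by linarith
  have "t \<le> (real k + 1) / real m" using km m by (simp add: field_simps)
  then have ts: "t - s \<le> 1 / real m" by (simp add: s_def add_divide_distrib)
  have s: "s \<in> \<rat>" "0 \<le> s" "s \<le> t"
    using km m by (auto simp: s_def field_simps)
  have e1: "\<bar>weighted_sum a f N (nat \<lfloor>real N * t\<rfloor>) - weighted_sum a f N (nat \<lfloor>real N * s\<rfloor>) - a t * (f t - f s)\<bar>
      \<le> w * (v t - v s)"
    unfolding w_def using s t ts by (intro block_estimate) auto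
  have e2: "\<bar>weighted_sum a f N (nat \<lfloor>real N * s\<rfloor>) - weighted_sum a f m k\<bar> \<le> w * (v s - v 0)"
    unfolding w_def s_def by (rule coarse_grid_at_nodes[OF m k])
  have e3: "\<bar>a t * (f t - f s)\<bar> \<le> A * w"
    unfolding abs_mult w_def using A[of t] block_estimate(2)[of s t "1 / real m"] s t ts A_nonneg
    by (intro mult_mono) auto
  have e4: "w * (v t - v 0) \<le> w * (v 1 - v 0)"
    using w v_mono[of t 1] t by (intro mult_left_mono) auto
  have "\<bar>weighted_sum a f N (nat \<lfloor>real N * t\<rfloor>) - weighted_sum a f m k\<bar> \<le> w * (v t - v s) + w * (v s - v 0) + A * w"
    using e1 e2 e3 by linarith
  also have "\<dots> = w * (v t - v 0) + A * w" by (simp add: algebra_simps)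
  also have "\<dots> \<le> w * (v 1 - v 0) + A * w" using e4 by simp
  finally show ?thesis unfolding k_def[symmetric] w_def[symmetric] by (simp add: algebra_simps)
qed

end

section \<open>Quadratic functionals of bridges\<close>

definition bridge :: "nat \<Rightarrow> (nat \<Rightarrow> real) \<Rightarrow> nat \<Rightarrow> real" where
  "bridge n y k = y k - real k / real n * y n"

text \<open>The times with grid index \<open>k\<close> form the \<open>k\<close>-th cell of the grid of mesh \<open>1/n\<close>. For \<open>k = n > 0\<close> it is the null set \<open>{1}\<close>.\<close>

definition cell_weight :: "(real \<Rightarrow> real) \<Rightarrow> nat \<Rightarrow> nat \<Rightarrow> real" where
  "cell_weight r n k = (LBINT t:{0..1}. (if nat \<lfloor>real n * t\<rfloor> = k then r t else 0))"

lemma floor_grid_le: "0 \<le> t \<Longrightarrow> t \<le> 1 \<Longrightarrow> nat \<lfloor>real n * t\<rfloor> \<le> n"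
proof -
  assume t: "0 \<le> t" "t \<le> 1"
  have "real n * t \<le> real n" using t by (simp add: mult_left_le)
  then show ?thesis by linarith
qed

text \<open>A process that depends on time only through its grid index has a finite sum as its integral. This reduces
measurability, continuity and expectations of such integrals to finitely many values.\<close>

lemma set_integral_floor_grid:
  assumes r: "set_integrable lborel {0..1} r"
  shows "set_integrable lborel {0..1} (\<lambda>t. g (nat \<lfloor>real n * t\<rfloor>) * r t)"
    and "(LBINT t:{0..1}. g (nat \<lfloor>real n * t\<rfloor>) * r t) = (\<Sum>k\<le>n. g k * cell_weight r n k)"
proof -
  have [measurable]: "(\<lambda>t. nat \<lfloor>real n * t\<rfloor>) \<in> borel \<rightarrow>\<^sub>M count_space UNIV" by measurable
  have i: "integrable lborel (\<lambda>t. g k * (indicator {0..1} t *\<^sub>R (if nat \<lfloor>real n * t\<rfloor> = k then r t else 0)))" for k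
  proof (intro integrable_mult_right)
    have "integrable lborel (\<lambda>t. indicator {0..1} t *\<^sub>R r t)" using r by (simp add: set_integrable_def)
    then have "integrable lborel (\<lambda>t. indicator {t. nat \<lfloor>real n * t\<rfloor> = k} t *\<^sub>R (indicator {0..1} t *\<^sub>R r t))"
      by (rule integrable_mult_indicator[rotated]) measurable
    moreover have "(\<lambda>t. indicator {t. nat \<lfloor>real n * t\<rfloor> = k} t *\<^sub>R (indicator {0..1} t *\<^sub>R r t)) =
        (\<lambda>t. indicator {0..1} t *\<^sub>R (if nat \<lfloor>real n * t\<rfloor> = k then r t else 0))"
      by (auto simp: fun_eq_iff indicator_def)
    ultimately show "integrable lborel (\<lambda>t. indicator {0..1} t *\<^sub>R (if nat \<lfloor>real n * t\<rfloor> = k then r t else 0))"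
      by simp
  qed
  have eq: "indicator {0..1} t *\<^sub>R (g (nat \<lfloor>real n * t\<rfloor>) * r t) =
      (\<Sum>k\<le>n. g k * (indicator {0..1} t *\<^sub>R (if nat \<lfloor>real n * t\<rfloor> = k then r t else 0)))" for t :: real
    using floor_grid_le[of t n] by (auto simp: indicator_def if_distrib[of "(*) _"] sum.delta' cong: if_cong)
  show "set_integrable lborel {0..1} (\<lambda>t. g (nat \<lfloor>real n * t\<rfloor>) * r t)"
    unfolding set_integrable_def eq using i by (intro Bochner_Integration.integrable_sum) auto
  show "(LBINT t:{0..1}. g (nat \<lfloor>real n * t\<rfloor>) * r t) = (\<Sum>k\<le>n. g k * cell_weight r n k)"
    unfolding set_lebesgue_integral_def eq cell_weight_def using i
    by (subst Bochner_Integration.integral_sum) auto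
qed

text \<open>The integral over the unit interval of \<open>(bridge n y (nat \<lfloor>n * t\<rfloor>))\<^sup>2 * r t\<close>, in the form of a finite sum.\<close>

definition bridge_energy :: "(real \<Rightarrow> real) \<Rightarrow> nat \<Rightarrow> (nat \<Rightarrow> real) \<Rightarrow> real" where
  "bridge_energy r n y = (\<Sum>k\<le>n. (bridge n y k)\<^sup>2 * cell_weight r n k)"

definition bounded_weight :: "(real \<Rightarrow> real) \<Rightarrow> real \<Rightarrow> bool" where
  "bounded_weight r R \<longleftrightarrow> r \<in> borel_measurable borel \<and> (\<forall>t. \<bar>r t\<bar> \<le> R)"

lemma bounded_weight_integrable:
  assumes "bounded_weight r R" shows "set_integrable lborel {0..1} r"
  unfolding set_integrable_def
proof (rule integrableI_bounded_set_indicator[of _ _ _ R])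
  show "AE x in lborel. x \<in> {0..1} \<longrightarrow> norm (r x) \<le> R"
    using assms by (auto simp: bounded_weight_def)
qed (use assms in \<open>auto simp: bounded_weight_def\<close>)

text \<open>Both energies are integrals of squared bridges. The bridges differ by two grid errors and by the rounding of \<open>t\<close> in
the linear term, at most \<open>1/m\<close>; the squares differ by this difference times the sum of the bridges.\<close>

lemma (in step_path) bridge_energy_coarse_grid:
  assumes m: "0 < m" "m \<le> N" and r: "bounded_weight r R"
  shows "\<bar>bridge_energy r N (weighted_sum a f N) - bridge_energy r m (weighted_sum a f m)\<bar>
    \<le> 7 * R * K\<^sup>2 * osc 1 f * (2 * osc (1 / real m) f + osc 1 f / real m)"
proof -
  let ?U = "weighted_sum a f N" and ?Y = "weighted_sum a f m"
  define w1 where "w1 = osc 1 f"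
  define wm where "wm = osc (1 / real m) f"
  have w: "0 \<le> wm" "wm \<le> w1" 
    using osc_nonneg[OF bounded, of "1 / real m"] osc_mono[OF bounded, of "1 / real m" 1] m by (auto simp: wm_def w1_def)
  have K: "0 \<le> K" by (rule K_nonneg)
  define b1 where "b1 = K * w1"
  define bm where "bm = K * wm"
  \<comment> \<open>two grid errors \<open>bm\<close>, and the rounding of the time in the linear term against the final value\<close>
  define \<eta> where "\<eta> = 2 * bm + b1 / real m"
  have b: "0 \<le> bm" "bm \<le> b1"
    using w K by (auto simp: bm_def b1_def mult_left_mono)
  have R: "0 \<le> R" using r abs_ge_zero[of "r 0"] order_trans unfolding bounded_weight_def by blast
  have pt: "\<bar>(bridge N ?U (nat \<lfloor>real N * t\<rfloor>))\<^sup>2 - (bridge m ?Y (nat \<lfloor>real m * t\<rfloor>))\<^sup>2\<bar> \<le> \<eta> * (7 * b1)"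
    if t: "0 \<le> t" "t \<le> 1" for t
  proof -
    define q where "q = nat \<lfloor>real N * t\<rfloor>"
    define k where "k = nat \<lfloor>real m * t\<rfloor>"
    have km: "real k \<le> real m * t" "real m * t < real k + 1" 
      and qN: "real q \<le> real N * t" "real N * t < real q + 1" using t by (auto simp: k_def q_def)
    have mN: "real m \<le> real N" "0 < real m" "0 < real N" using m by auto
    have "real k / real m \<le> t" "t \<le> real k / real m + 1 / real m" "real q / real N \<le> t" "t \<le> real q / real N + 1 / real N"
      "1 / real N \<le> 1 / real m"
      using km qN mN by (auto simp: field_simps)
    then have d: "\<bar>real q / real N - real k / real m\<bar> \<le> 1 / real m" by linarith
    have k1: "0 \<le> real k / real m" "real k / real m \<le> 1" "0 \<le> real q / real N" "real q / real N \<le> 1"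
      using floor_grid_le[OF t, of m] floor_grid_le[OF t, of N] mN by (auto simp: k_def q_def field_simps)
    have e: "\<bar>?U q - ?Y k\<bar> \<le> bm" unfolding q_def k_def wm_def bm_def by (rule coarse_grid[OF m(1) t])
    have e1: "\<bar>?U N - ?Y m\<bar> \<le> bm" using coarse_grid[OF m(1), of 1] by (simp add: wm_def bm_def)
    have u: "\<bar>?U q\<bar> \<le> b1" unfolding q_def w1_def b1_def by (rule weighted_sum_bound[OF t])
    have u1: "\<bar>?U N\<bar> \<le> b1" using weighted_sum_bound[of 1] by (simp add: w1_def b1_def)
    have tri: "\<bar>x - y - z\<bar> \<le> X + Y + Z" if "\<bar>x\<bar> \<le> X" "\<bar>y\<bar> \<le> Y" "\<bar>z\<bar> \<le> Z" for x y z X Y Z :: real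
      using that by linarith
    have eq: "bridge N ?U q - bridge m ?Y k
        = (?U q - ?Y k) - real k / real m * (?U N - ?Y m) - (real q / real N - real k / real m) * ?U N"
      by (simp add: bridge_def algebra_simps)
    have y: "\<bar>real k / real m * (?U N - ?Y m)\<bar> \<le> 1 * bm"
      unfolding abs_mult using k1 e1 by (intro mult_mono) auto
    have z: "\<bar>(real q / real N - real k / real m) * ?U N\<bar> \<le> 1 / real m * b1"
      unfolding abs_mult using d u1 by (intro mult_mono) auto
    have diff: "\<bar>bridge N ?U q - bridge m ?Y k\<bar> \<le> \<eta>"
      using tri[OF e y z] unfolding eq \<eta>_def by simp
    have uq: "\<bar>real q / real N * ?U N\<bar> \<le> 1 * b1"
      unfolding abs_mult using k1 u1 by (intro mult_mono) auto
    have big: "\<bar>bridge N ?U q\<bar> \<le> 2 * b1"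
      using tri[OF u uq, of 0 0] unfolding bridge_def by simp
    have "b1 / real m \<le> b1 / 1" using m b by (intro divide_left_mono) auto
    then have "\<eta> \<le> 3 * b1" unfolding \<eta>_def using b by simp
    then have sum: "\<bar>bridge N ?U q + bridge m ?Y k\<bar> \<le> 7 * b1" using diff big by linarith
    have "\<bar>(bridge N ?U q)\<^sup>2 - (bridge m ?Y k)\<^sup>2\<bar> = \<bar>bridge N ?U q - bridge m ?Y k\<bar> * \<bar>bridge N ?U q + bridge m ?Y k\<bar>"
      by (simp add: power2_eq_square abs_mult[symmetric] algebra_simps)
    also have "\<dots> \<le> \<eta> * (7 * b1)" using diff sum by (intro mult_mono) auto
    finally show ?thesis unfolding q_def k_def .
  qed
  note ri = bounded_weight_integrable[OF r]
  have i: "set_integrable lborel {0..1} (\<lambda>t. (bridge N ?U (nat \<lfloor>real N * t\<rfloor>))\<^sup>2 * r t)"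
    "set_integrable lborel {0..1} (\<lambda>t. (bridge m ?Y (nat \<lfloor>real m * t\<rfloor>))\<^sup>2 * r t)"
    using set_integral_floor_grid(1)[OF ri, of "\<lambda>k. (bridge N ?U k)\<^sup>2" N]
      set_integral_floor_grid(1)[OF ri, of "\<lambda>k. (bridge m ?Y k)\<^sup>2" m] by auto
  have "\<bar>bridge_energy r N ?U - bridge_energy r m ?Y\<bar> =
      \<bar>LBINT t:{0..1}. (bridge N ?U (nat \<lfloor>real N * t\<rfloor>))\<^sup>2 * r t - (bridge m ?Y (nat \<lfloor>real m * t\<rfloor>))\<^sup>2 * r t\<bar>"
    using set_integral_floor_grid(2)[OF ri, of "\<lambda>k. (bridge N ?U k)\<^sup>2" N]
      set_integral_floor_grid(2)[OF ri, of "\<lambda>k. (bridge m ?Y k)\<^sup>2" m] i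
    unfolding bridge_energy_def by (simp add: set_integral_diff)
  also have "\<dots> \<le> (LBINT t:{0..1}. \<bar>(bridge N ?U (nat \<lfloor>real N * t\<rfloor>))\<^sup>2 * r t - (bridge m ?Y (nat \<lfloor>real m * t\<rfloor>))\<^sup>2 * r t\<bar>)"
    using set_integral_norm_bound[OF set_integral_diff(1)[OF i]] by simp
  also have "\<dots> \<le> (LBINT t:{0..1::real}. \<eta> * (7 * b1) * R)"
  proof (rule set_integral_mono)
    show "set_integrable lborel {0..1} (\<lambda>t. \<bar>(bridge N ?U (nat \<lfloor>real N * t\<rfloor>))\<^sup>2 * r t - (bridge m ?Y (nat \<lfloor>real m * t\<rfloor>))\<^sup>2 * r t\<bar>)"
      using set_integrable_abs[OF set_integral_diff(1)[OF i]] .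
    show "set_integrable lborel {0..1::real} (\<lambda>t. \<eta> * (7 * b1) * R)"
      by (auto simp: set_integrable_def)
    fix t :: real assume t: "t \<in> {0..1}"
    have "\<bar>((bridge N ?U (nat \<lfloor>real N * t\<rfloor>))\<^sup>2 - (bridge m ?Y (nat \<lfloor>real m * t\<rfloor>))\<^sup>2) * r t\<bar> \<le> \<eta> * (7 * b1) * R"
      unfolding abs_mult using pt[of t] t r R by (intro mult_mono) (auto simp: bounded_weight_def)
    then show "\<bar>(bridge N ?U (nat \<lfloor>real N * t\<rfloor>))\<^sup>2 * r t - (bridge m ?Y (nat \<lfloor>real m * t\<rfloor>))\<^sup>2 * r t\<bar> \<le> \<eta> * (7 * b1) * R"
      by (simp add: left_diff_distrib)
  qed
  also have "\<dots> = 7 * R * K\<^sup>2 * w1 * (2 * wm + w1 / real m)"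
  proof -
    have "(2 * (k * wm) + k * w1 / real m) * (7 * (k * w1)) * R = 7 * R * k\<^sup>2 * w1 * (2 * wm + w1 / real m)" for k
      by (simp add: power2_eq_square algebra_simps)
    then show ?thesis by (simp add: set_lebesgue_integral_def \<eta>_def bm_def b1_def)
  qed
  finally show ?thesis unfolding w1_def wm_def .
qed

lemma weighted_sum_tendsto:
  assumes "\<And>t. t \<in> {0..1} \<Longrightarrow> (\<lambda>i. g i t) \<longlonglongrightarrow> f t" "k \<le> n"
  shows "(\<lambda>i. weighted_sum a (g i) n k) \<longlonglongrightarrow> weighted_sum a f n k"
  unfolding weighted_sum_def using assms(2)
  by (intro tendsto_sum tendsto_mult tendsto_diff tendsto_const assms(1)) (auto simp: divide_le_eq_1)

lemma bridge_energy_tendsto: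
  assumes "\<And>k. k \<le> n \<Longrightarrow> (\<lambda>i. y i k) \<longlonglongrightarrow> z k"
  shows "(\<lambda>i. bridge_energy r n (y i)) \<longlonglongrightarrow> bridge_energy r n z"
  unfolding bridge_energy_def bridge_def by (intro tendsto_intros assms) auto

lemma bridge_energy_measurable:
  assumes "\<And>k. k \<le> n \<Longrightarrow> (\<lambda>\<omega>. y \<omega> k) \<in> borel_measurable M"
  shows "(\<lambda>\<omega>. bridge_energy r n (y \<omega>)) \<in> borel_measurable M"
  unfolding bridge_energy_def bridge_def
  by (intro borel_measurable_sum borel_measurable_times borel_measurable_power borel_measurable_diff
      borel_measurable_const assms) auto

lemma bridge_energy_cong:
  assumes "\<And>k. k \<le> n \<Longrightarrow> y k = z k" shows "bridge_energy r n y = bridge_energy r n z"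
  unfolding bridge_energy_def bridge_def using assms by (intro sum.cong) auto

lemma weighted_sum_measurable:
  assumes "\<And>t. t \<in> {0..1} \<Longrightarrow> (\<lambda>\<omega>. f \<omega> t) \<in> borel_measurable M" "k \<le> n"
  shows "(\<lambda>\<omega>. weighted_sum a (f \<omega>) n k) \<in> borel_measurable M"
  unfolding weighted_sum_def using assms(2)
  by (intro borel_measurable_sum borel_measurable_times borel_measurable_diff
      borel_measurable_const assms(1)) (auto simp: divide_le_eq_1)

section \<open>Increments of the Wiener process\<close>

locale wiener =
  fixes M' :: "'b measure" and W :: "real \<Rightarrow> 'b \<Rightarrow> real"
  assumes W: "wiener_process M' W"
begin

sublocale prob_space M' using W by (simp add: wiener_process_def)

lemma W_measurable: "0 \<le> t \<Longrightarrow> W t \<in> borel_measurable M'"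
  using W by (simp add: wiener_process_def)

lemma W_zero: "\<omega> \<in> space M' \<Longrightarrow> W 0 \<omega> = 0"
  using W by (simp add: wiener_process_def)

lemma W_continuous: "\<omega> \<in> space M' \<Longrightarrow> continuous_on {0..} (\<lambda>t. W t \<omega>)"
  using W by (simp add: wiener_process_def)

lemma W_increment_normal:
  "0 \<le> s \<Longrightarrow> s < t \<Longrightarrow> distributed M' lborel (\<lambda>\<omega>. W t \<omega> - W s \<omega>) (normal_density 0 (sqrt (t - s)))"
  using W by (simp add: wiener_process_def)

lemma W_indep_increments:
  "0 \<le> \<tau> 0 \<Longrightarrow> mono \<tau> \<Longrightarrow> indep_vars (\<lambda>_. borel) (\<lambda>i \<omega>. W (\<tau> (Suc i)) \<omega> - W (\<tau> i) \<omega>) {..<n::nat}"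
  using W by (simp add: wiener_process_def)

text \<open>A centred Gaussian is determined by its variance. Variance zero is a separate case, since then the increment has no
density; both sides are constantly zero.\<close>

lemma increment_scaling:
  assumes s: "0 \<le> s" "s \<le> t" and s': "0 \<le> s'" "s' \<le> t'" and c: "c\<^sup>2 * (t - s) = t' - s'"
  shows "distr M' borel (\<lambda>\<omega>. c * (W t \<omega> - W s \<omega>)) = distr M' borel (\<lambda>\<omega>. W t' \<omega> - W s' \<omega>)"
proof (cases "s' = t'")
  case True
  then have "c = 0 \<or> s = t" using c by auto
  then have "(\<lambda>\<omega>. c * (W t \<omega> - W s \<omega>)) = (\<lambda>\<omega>. W t' \<omega> - W s' \<omega>)" using True by auto
  then show ?thesis by simp
next
  case False
  then have lt': "s' < t'" using s' by simp
  then have c0: "c \<noteq> 0" and lt: "s < t" using c s by (auto simp: order_less_le)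
  have sq: "\<bar>c\<bar> * sqrt (t - s) = sqrt (t' - s')" unfolding c[symmetric] by (simp add: real_sqrt_mult)
  have "distributed M' lborel (\<lambda>\<omega>. 0 + c * (W t \<omega> - W s \<omega>)) (normal_density (0 + c * 0) (\<bar>c\<bar> * sqrt (t - s)))"
    by (rule normal_density_affine[OF W_increment_normal[OF s(1) lt] _ c0]) (use lt in simp)
  then have 1: "distributed M' lborel (\<lambda>\<omega>. c * (W t \<omega> - W s \<omega>)) (normal_density 0 (sqrt (t' - s')))"
    by (simp add: sq)
  have "distr M' lborel (\<lambda>\<omega>. c * (W t \<omega> - W s \<omega>)) = distr M' lborel (\<lambda>\<omega>. W t' \<omega> - W s' \<omega>)"
    using distributed_distr_eq_density[OF 1] distributed_distr_eq_density[OF W_increment_normal[OF s'(1) lt']] by simp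
  moreover have "distr M' borel X = distr M' lborel X" for X :: "'b \<Rightarrow> real"
    by (rule distr_cong) auto
  ultimately show ?thesis by simp
qed

text \<open>By independence the joint law of the increments is the product of the marginals, and these agree.\<close>

lemma scaled_increments_law:
  fixes h :: "(nat \<Rightarrow> real) \<Rightarrow> real"
  assumes n: "0 < n" and \<tau>: "0 \<le> \<tau> 0" "mono \<tau>" and \<rho>: "0 \<le> \<rho> 0" "mono \<rho>"
    and c: "\<And>i. i < n \<Longrightarrow> (c i)\<^sup>2 * (\<tau> (Suc i) - \<tau> i) = \<rho> (Suc i) - \<rho> i"
    and h [measurable]: "h \<in> borel_measurable (Pi\<^sub>M {..<n} (\<lambda>_. borel))"
  shows "(\<integral>\<omega>. h (\<lambda>i\<in>{..<n}. c i * (W (\<tau> (Suc i)) \<omega> - W (\<tau> i) \<omega>)) \<partial>M')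
    = (\<integral>\<omega>. h (\<lambda>i\<in>{..<n}. W (\<rho> (Suc i)) \<omega> - W (\<rho> i) \<omega>) \<partial>M')"
proof -
  let ?X = "\<lambda>i \<omega>. c i * (W (\<tau> (Suc i)) \<omega> - W (\<tau> i) \<omega>)"
  let ?Y = "\<lambda>i \<omega>. W (\<rho> (Suc i)) \<omega> - W (\<rho> i) \<omega>"
  have pos: "0 \<le> \<tau> i" "0 \<le> \<rho> i" "\<tau> i \<le> \<tau> (Suc i)" "\<rho> i \<le> \<rho> (Suc i)" for i
    using \<tau> \<rho> by (auto simp: mono_def intro: order_trans)
  note [measurable] = W_measurable[OF pos(1)] W_measurable[OF pos(2)]
  have X: "indep_vars (\<lambda>_. borel) ?X {..<n}"
    by (rule indep_vars_compose2[OF W_indep_increments[OF \<tau>], of n "\<lambda>i x. c i * x"]) simp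
  have Y: "indep_vars (\<lambda>_. borel) ?Y {..<n}"
    by (rule W_indep_increments[OF \<rho>])
  have "distr M' (Pi\<^sub>M {..<n} (\<lambda>_. borel)) (\<lambda>\<omega>. \<lambda>i\<in>{..<n}. ?X i \<omega>) = Pi\<^sub>M {..<n} (\<lambda>i. distr M' borel (?X i))"
    by (rule indep_vars_iff_distr_eq_PiM[THEN iffD1, OF _ _ X]) (use n in auto)
  also have "\<dots> = Pi\<^sub>M {..<n} (\<lambda>i. distr M' borel (?Y i))"
    by (intro PiM_cong increment_scaling pos c) auto
  also have "\<dots> = distr M' (Pi\<^sub>M {..<n} (\<lambda>_. borel)) (\<lambda>\<omega>. \<lambda>i\<in>{..<n}. ?Y i \<omega>)"
    by (rule indep_vars_iff_distr_eq_PiM[THEN iffD1, OF _ _ Y, symmetric]) (use n in auto)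
  finally have "(\<integral>x. h x \<partial>distr M' (Pi\<^sub>M {..<n} (\<lambda>_. borel)) (\<lambda>\<omega>. \<lambda>i\<in>{..<n}. ?X i \<omega>)) =
      (\<integral>x. h x \<partial>distr M' (Pi\<^sub>M {..<n} (\<lambda>_. borel)) (\<lambda>\<omega>. \<lambda>i\<in>{..<n}. ?Y i \<omega>))" by simp
  then show ?thesis by (subst (asm) (1 2) integral_distr) measurable
qed

end

text \<open>The variance clock of the step function that takes the value \<open>a (l/m)\<close> on the \<open>l\<close>-th cell, at the node \<open>k/m\<close>.\<close>

definition step_clock :: "real \<Rightarrow> (real \<Rightarrow> real) \<Rightarrow> nat \<Rightarrow> nat \<Rightarrow> real" where
  "step_clock \<sigma> a m k = (\<Sum>l=1..k. \<sigma>\<^sup>2 * (a (real l / real m))\<^sup>2 / real m)"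

lemma step_clock_Suc: "step_clock \<sigma> a m (Suc k) = step_clock \<sigma> a m k + \<sigma>\<^sup>2 * (a (real (Suc k) / real m))\<^sup>2 / real m"
  by (simp add: step_clock_def)

lemma step_clock_mono: "mono (step_clock \<sigma> a m)"
  by (rule incseq_SucI) (simp add: step_clock_Suc)

lemma step_clock_0: "step_clock \<sigma> a m 0 = 0"
  by (simp add: step_clock_def)

lemma step_clock_nonneg: "0 \<le> step_clock \<sigma> a m k"
  using monoD[OF step_clock_mono, of 0 k \<sigma> a m] by (simp add: step_clock_0)

text \<open>The energy is a function of the increments. Those of the weighted sums, \<open>\<sigma> a (l/m) (W (l/m) - W ((l-1)/m))\<close>, have
variance \<open>\<sigma>\<^sup>2 a (l/m)\<^sup>2 / m\<close>, which is exactly the step of the clock.\<close>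

lemma (in wiener) bridge_energy_law:
  fixes \<psi> :: "real \<Rightarrow> real"
  assumes m: "0 < m" and \<psi>: "\<psi> \<in> borel_measurable borel"
  shows "(\<integral>\<omega>. \<psi> (bridge_energy r m (weighted_sum a (\<lambda>t\<in>{0..1}. \<sigma> * W t \<omega>) m)) \<partial>M')
    = (\<integral>\<omega>. \<psi> (bridge_energy r m (\<lambda>k. W (step_clock \<sigma> a m k) \<omega>)) \<partial>M')"
proof -
  define \<tau> where "\<tau> i = real i / real m" for i
  define c where "c i = \<sigma> * a (real (Suc i) / real m)" for i
  \<comment> \<open>intersecting with \<open>{..<m}\<close> confines \<open>h\<close> to the coordinates of the finite product, on which it has to be measurable\<close>
  define h where "h d = \<psi> (bridge_energy r m (\<lambda>k. \<Sum>i\<in>{..<m} \<inter> {..<k}. d i))" for d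
  have h: "h \<in> borel_measurable (Pi\<^sub>M {..<m} (\<lambda>_. borel))"
    unfolding h_def
    by (intro measurable_compose[OF bridge_energy_measurable \<psi>] borel_measurable_sum) auto
  have 1: "bridge_energy r m (weighted_sum a (\<lambda>t\<in>{0..1}. \<sigma> * W t \<omega>) m) =
      bridge_energy r m (\<lambda>k. \<Sum>i\<in>{..<m} \<inter> {..<k}. (\<lambda>i\<in>{..<m}. c i * (W (\<tau> (Suc i)) \<omega> - W (\<tau> i) \<omega>)) i)" for \<omega>
  proof (rule bridge_energy_cong)
    fix k assume k: "k \<le> m"
    have "weighted_sum a (\<lambda>t\<in>{0..1}. \<sigma> * W t \<omega>) m k = (\<Sum>l=1..k. c (l - 1) * (W (\<tau> l) \<omega> - W (\<tau> (l - 1)) \<omega>))"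
      unfolding weighted_sum_def using k
      by (intro sum.cong refl) (auto simp: c_def \<tau>_def divide_le_eq_1 algebra_simps)
    also have "\<dots> = (\<Sum>i<k. c i * (W (\<tau> (Suc i)) \<omega> - W (\<tau> i) \<omega>))"
      by (rule sum.reindex_bij_witness[of _ Suc "\<lambda>l. l - 1"]) auto
    also have "\<dots> = (\<Sum>i\<in>{..<m} \<inter> {..<k}. (\<lambda>i\<in>{..<m}. c i * (W (\<tau> (Suc i)) \<omega> - W (\<tau> i) \<omega>)) i)"
      using k by (intro sum.cong) auto
    finally show "weighted_sum a (\<lambda>t\<in>{0..1}. \<sigma> * W t \<omega>) m k = \<dots>" .
  qed
  have 2: "bridge_energy r m (\<lambda>k. W (step_clock \<sigma> a m k) \<omega>) =
      bridge_energy r m (\<lambda>k. \<Sum>i\<in>{..<m} \<inter> {..<k}.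
        (\<lambda>i\<in>{..<m}. W (step_clock \<sigma> a m (Suc i)) \<omega> - W (step_clock \<sigma> a m i) \<omega>) i)"
    if \<omega>: "\<omega> \<in> space M'" for \<omega>
  proof (rule bridge_energy_cong)
    fix k assume k: "k \<le> m"
    have "(\<Sum>i\<in>{..<m} \<inter> {..<k}. (\<lambda>i\<in>{..<m}. W (step_clock \<sigma> a m (Suc i)) \<omega> - W (step_clock \<sigma> a m i) \<omega>) i)
        = (\<Sum>i<k. W (step_clock \<sigma> a m (Suc i)) \<omega> - W (step_clock \<sigma> a m i) \<omega>)"
      using k by (intro sum.cong) auto
    also have "\<dots> = W (step_clock \<sigma> a m k) \<omega>"
      using W_zero[OF \<omega>] by (subst sum_lessThan_telescope) (simp add: step_clock_0)
    finally show "W (step_clock \<sigma> a m k) \<omega> = (\<Sum>i\<in>{..<m} \<inter> {..<k}.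
        (\<lambda>i\<in>{..<m}. W (step_clock \<sigma> a m (Suc i)) \<omega> - W (step_clock \<sigma> a m i) \<omega>) i)" by simp
  qed
  have "(\<integral>\<omega>. \<psi> (bridge_energy r m (weighted_sum a (\<lambda>t\<in>{0..1}. \<sigma> * W t \<omega>) m)) \<partial>M')
      = (\<integral>\<omega>. h (\<lambda>i\<in>{..<m}. c i * (W (\<tau> (Suc i)) \<omega> - W (\<tau> i) \<omega>)) \<partial>M')"
    unfolding 1 h_def ..
  also have "\<dots> = (\<integral>\<omega>. h (\<lambda>i\<in>{..<m}. W (step_clock \<sigma> a m (Suc i)) \<omega> - W (step_clock \<sigma> a m i) \<omega>) \<partial>M')"
  proof (rule scaled_increments_law[OF m _ _ _ step_clock_mono _ h])
    show "mono \<tau>" by (auto simp: mono_def \<tau>_def divide_right_mono)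
    show "(c i)\<^sup>2 * (\<tau> (Suc i) - \<tau> i) = step_clock \<sigma> a m (Suc i) - step_clock \<sigma> a m i" for i
      by (simp add: c_def \<tau>_def step_clock_Suc power_mult_distrib diff_divide_distrib[symmetric])
  qed (auto simp: \<tau>_def step_clock_0)
  also have "\<dots> = (\<integral>\<omega>. \<psi> (bridge_energy r m (\<lambda>k. W (step_clock \<sigma> a m k) \<omega>)) \<partial>M')"
    unfolding h_def by (intro Bochner_Integration.integral_cong refl) (simp add: 2)
  finally show ?thesis .
qed

section \<open>The variance clock and the limit process\<close>

lemma set_integral_const_bounds:
  fixes g :: "real \<Rightarrow> real"
  assumes "s \<le> t" "set_integrable lborel {s<..t} g" "\<And>u. s < u \<Longrightarrow> u \<le> t \<Longrightarrow> \<bar>g u - y\<bar> \<le> c"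
  shows "\<bar>(LBINT u:{s<..t}. g u) - y * (t - s)\<bar> \<le> c * (t - s)"
proof -
  have i: "set_integrable lborel {s<..t} (\<lambda>_. z)" for z :: real
    unfolding set_integrable_def using assms(1) by (intro integrable_scaleR_left) (simp add: integrable_indicator_iff)
  have e: "(LBINT u:{s<..t}. z) = z * (t - s)" for z :: real
    using assms(1) by (simp add: set_lebesgue_integral_def)
  have "(LBINT u:{s<..t}. g u) \<le> (LBINT u:{s<..t}. y + c)"
    using assms i by (intro set_integral_mono) (auto simp: abs_le_iff algebra_simps)
  moreover have "(LBINT u:{s<..t}. y - c) \<le> (LBINT u:{s<..t}. g u)"
    using assms i by (intro set_integral_mono) (auto simp: abs_le_iff algebra_simps)
  ultimately show ?thesis unfolding e by (simp add: abs_le_iff algebra_simps)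
qed

lemma floor_ratio_tendsto:
  assumes "0 \<le> t"
  shows "(\<lambda>m. real (nat \<lfloor>real m * t\<rfloor>) / real m) \<longlonglongrightarrow> t"
proof (rule tendsto_sandwich)
  show "\<forall>\<^sub>F m in sequentially. t - 1 / real m \<le> real (nat \<lfloor>real m * t\<rfloor>) / real m"
    using eventually_gt_at_top[of 0]
  proof eventually_elim
    fix m :: nat assume m: "0 < m"
    have "real m * t - 1 \<le> real (nat \<lfloor>real m * t\<rfloor>)" by linarith
    then have "(real m * t - 1) / real m \<le> real (nat \<lfloor>real m * t\<rfloor>) / real m" by (rule divide_right_mono) simp
    then show "t - 1 / real m \<le> real (nat \<lfloor>real m * t\<rfloor>) / real m" using m by (simp add: diff_divide_distrib)
  qed
  show "\<forall>\<^sub>F m in sequentially. real (nat \<lfloor>real m * t\<rfloor>) / real m \<le> t"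
    using eventually_gt_at_top[of 0]
  proof eventually_elim
    fix m :: nat assume m: "0 < m"
    have "0 \<le> real m * t" using assms by simp
    then have "real (nat \<lfloor>real m * t\<rfloor>) \<le> real m * t" by linarith
    then show "real (nat \<lfloor>real m * t\<rfloor>) / real m \<le> t" using m by (simp add: divide_le_eq mult.commute)
  qed
  show "(\<lambda>m. t - 1 / real m) \<longlonglongrightarrow> t" using tendsto_diff[OF tendsto_const lim_const_over_n[of 1]] by simp
qed simp

context variation_dominated
begin

text \<open>Both \<open>v\<close> and \<open>v - a\<close> are nondecreasing on the unit interval.\<close>

lemma measurable_on_unit_interval: "a \<in> borel_measurable (restrict_space borel {0..1})"
proof -
  have "mono_on {0..1} v" using v_mono by (auto simp: mono_on_def)
  moreover have "mono_on {0..1} (\<lambda>t. v t - a t)"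
  proof (rule mono_onI)
    fix s t :: real assume "s \<in> {0..1}" "t \<in> {0..1}" "s \<le> t"
    then show "v s - a s \<le> v t - a t" using dom[of s t] by auto
  qed
  ultimately have "(\<lambda>t. v t - (v t - a t)) \<in> borel_measurable (restrict_space borel {0..1})"
    by (intro borel_measurable_diff borel_measurable_mono_on_fnc)
  then show ?thesis by simp
qed

lemma a_square_integrable:
  assumes "S \<in> sets borel" "S \<subseteq> {0..1}"
  shows "set_integrable lborel S (\<lambda>u. (a u)\<^sup>2)"
proof -
  have "set_integrable lborel {0..1} (\<lambda>u. (a u)\<^sup>2)"
    unfolding set_integrable_def
  proof (rule integrableI_bounded_set[of "{0..1}" _ _ "A\<^sup>2"])
    have "(\<lambda>u. (a u)\<^sup>2) \<in> borel_measurable (restrict_space borel {0..1})"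
      by (intro borel_measurable_power measurable_on_unit_interval)
    then show "(\<lambda>x. indicat_real {0..1} x *\<^sub>R (a x)\<^sup>2) \<in> borel_measurable lborel"
      by (subst (asm) borel_measurable_restrict_space_iff) auto
    show "AE x in lborel. x \<in> {0..1} \<longrightarrow> norm (indicat_real {0..1} x *\<^sub>R (a x)\<^sup>2) \<le> A\<^sup>2"
    proof (intro AE_I2 impI)
      fix x :: real assume "x \<in> {0..1}"
      then have "\<bar>a x\<bar>\<^sup>2 \<le> A\<^sup>2" using A[of x] by (intro power_mono) auto
      then show "norm (indicat_real {0..1} x *\<^sub>R (a x)\<^sup>2) \<le> A\<^sup>2" by (simp add: indicator_def)
    qed
  qed auto
  then show ?thesis by (rule set_integrable_subset) (use assms in auto)
qed

lemma clock_increment: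
  assumes "0 \<le> s" "s \<le> t" "t \<le> 1"
  shows "variance_clock \<sigma> a t - variance_clock \<sigma> a s = \<sigma>\<^sup>2 * (LBINT u:{s<..t}. (a u)\<^sup>2)"
proof -
  have "{0..t} = {0..s} \<union> {s<..t}" using assms by auto
  moreover have "(LBINT u:{0..s} \<union> {s<..t}. (a u)\<^sup>2) = (LBINT u:{0..s}. (a u)\<^sup>2) + (LBINT u:{s<..t}. (a u)\<^sup>2)"
    using assms by (intro set_integral_Un a_square_integrable) auto
  ultimately show ?thesis by (simp add: variance_clock_def algebra_simps)
qed

lemma clock_lipschitz:
  assumes st: "0 \<le> s" "s \<le> t" "t \<le> 1"
  shows "0 \<le> variance_clock \<sigma> a t - variance_clock \<sigma> a s"
    "variance_clock \<sigma> a t - variance_clock \<sigma> a s \<le> \<sigma>\<^sup>2 * A\<^sup>2 * (t - s)"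
proof -
  have "\<bar>(a u)\<^sup>2 - A\<^sup>2 / 2\<bar> \<le> A\<^sup>2 / 2" if "s < u" "u \<le> t" for u
  proof -
    have "\<bar>a u\<bar>\<^sup>2 \<le> A\<^sup>2" using A[of u] that st by (intro power_mono) auto
    then show ?thesis unfolding abs_le_iff using zero_le_power2[of "a u"] by simp
  qed
  then have "\<bar>(LBINT u:{s<..t}. (a u)\<^sup>2) - A\<^sup>2 / 2 * (t - s)\<bar> \<le> A\<^sup>2 / 2 * (t - s)"
    using st by (intro set_integral_const_bounds a_square_integrable) auto
  then have "0 \<le> (LBINT u:{s<..t}. (a u)\<^sup>2)" "(LBINT u:{s<..t}. (a u)\<^sup>2) \<le> A\<^sup>2 * (t - s)"
    unfolding abs_le_iff by (auto simp: mult.commute)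
  then show "0 \<le> variance_clock \<sigma> a t - variance_clock \<sigma> a s"
    "variance_clock \<sigma> a t - variance_clock \<sigma> a s \<le> \<sigma>\<^sup>2 * A\<^sup>2 * (t - s)"
    unfolding clock_increment[OF st] by (auto simp: mult.assoc intro: mult_left_mono)
qed

lemma clock_zero: "variance_clock \<sigma> a 0 = 0"
proof -
  have "AE u in lborel. indicator {0..0} u *\<^sub>R (a u)\<^sup>2 = 0"
    using AE_lborel_singleton[of 0] by eventually_elim simp
  then have "(LBINT u:{0..0}. (a u)\<^sup>2) = 0"
    unfolding set_lebesgue_integral_def by (rule integral_eq_zero_AE)
  then show ?thesis by (simp add: variance_clock_def)
qed

lemma clock_nonneg: "0 \<le> t \<Longrightarrow> t \<le> 1 \<Longrightarrow> 0 \<le> variance_clock \<sigma> a t"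
  using clock_lipschitz(1)[of 0 t \<sigma>] by (simp add: clock_zero)

lemma clock_continuous: "continuous_on {0..1} (variance_clock \<sigma> a)"
proof (rule continuous_on_subset)
  have "(\<sigma>\<^sup>2 * A\<^sup>2)-lipschitz_on {0..1} (variance_clock \<sigma> a)"
  proof (rule lipschitz_onI)
    fix s t :: real assume "s \<in> {0..1}" "t \<in> {0..1}"
    then show "dist (variance_clock \<sigma> a s) (variance_clock \<sigma> a t) \<le> \<sigma>\<^sup>2 * A\<^sup>2 * dist s t"
      using clock_lipschitz[of s t \<sigma>] clock_lipschitz[of t s \<sigma>]
      by (cases "s \<le> t") (auto simp: dist_real_def abs_if)
  qed simp
  then show "continuous_on {0..1} (variance_clock \<sigma> a)" by (rule lipschitz_on_continuous_on)
qed auto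

text \<open>The clock is a Riemann integral of \<open>a\<^sup>2\<close>, and on one cell \<open>a\<^sup>2\<close> varies by at most \<open>2 A\<close> times the variation of \<open>a\<close> over
it. Hence the Riemann sum is off by \<open>O(1/m)\<close>.\<close>

lemma step_clock_close:
  assumes m: "0 < m" and k: "k \<le> m"
  shows "\<bar>variance_clock \<sigma> a (real k / real m) - step_clock \<sigma> a m k\<bar>
    \<le> \<sigma>\<^sup>2 * (2 * A / real m) * (v (real k / real m) - v 0)"
  using k
proof (induction k)
  case 0
  then show ?case by (simp add: clock_zero step_clock_0)
next
  case (Suc k)
  let ?s = "real k / real m" and ?t = "real (Suc k) / real m"
  have st: "0 \<le> ?s" "?s \<le> ?t" "?t \<le> 1" and d: "?t - ?s = 1 / real m"
    using Suc.prems m by (auto simp: divide_right_mono diff_divide_distrib[symmetric])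
  have "\<bar>(a u)\<^sup>2 - (a ?t)\<^sup>2\<bar> \<le> 2 * A * (v ?t - v ?s)" if u: "?s < u" "u \<le> ?t" for u
  proof -
    have "\<bar>(a u)\<^sup>2 - (a ?t)\<^sup>2\<bar> = \<bar>a u + a ?t\<bar> * \<bar>a ?t - a u\<bar>"
      by (simp add: power2_eq_square abs_mult[symmetric] abs_minus_commute algebra_simps)
    also have "\<dots> \<le> (2 * A) * (v ?t - v ?s)"
      using A[of u] A[of ?t] dom[of u ?t] v_mono[of ?s u] u st A_nonneg
      by (intro mult_mono) auto
    finally show ?thesis .
  qed
  moreover have "{?s<..?t} \<subseteq> {0..1}"
    by (intro subsetI) (use st in \<open>simp only: greaterThanAtMost_iff atLeastAtMost_iff; linarith\<close>)
  ultimately have "\<bar>(LBINT u:{?s<..?t}. (a u)\<^sup>2) - (a ?t)\<^sup>2 * (?t - ?s)\<bar> \<le> 2 * A * (v ?t - v ?s) * (?t - ?s)"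
    using st by (intro set_integral_const_bounds a_square_integrable) auto
  then have "\<sigma>\<^sup>2 * \<bar>(LBINT u:{?s<..?t}. (a u)\<^sup>2) - (a ?t)\<^sup>2 / real m\<bar> \<le> \<sigma>\<^sup>2 * (2 * A * (v ?t - v ?s) / real m)"
    unfolding d by (intro mult_left_mono) auto
  moreover have "\<sigma>\<^sup>2 * \<bar>(LBINT u:{?s<..?t}. (a u)\<^sup>2) - (a ?t)\<^sup>2 / real m\<bar> =
      \<bar>(variance_clock \<sigma> a ?t - variance_clock \<sigma> a ?s) - (step_clock \<sigma> a m (Suc k) - step_clock \<sigma> a m k)\<bar>"
  proof -
    have "\<sigma>\<^sup>2 * \<bar>x\<bar> = \<bar>\<sigma>\<^sup>2 * x\<bar>" for x by (simp add: abs_mult)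
    then show ?thesis unfolding clock_increment[OF st] step_clock_Suc by (simp add: right_diff_distrib)
  qed
  ultimately have 1: "\<bar>(variance_clock \<sigma> a ?t - variance_clock \<sigma> a ?s) - (step_clock \<sigma> a m (Suc k) - step_clock \<sigma> a m k)\<bar>
      \<le> \<sigma>\<^sup>2 * (2 * A / real m) * (v ?t - v ?s)" by (simp add: mult.assoc)
  have 2: "\<bar>variance_clock \<sigma> a ?s - step_clock \<sigma> a m k\<bar> \<le> \<sigma>\<^sup>2 * (2 * A / real m) * (v ?s - v 0)"
    using Suc by simp
  have "\<bar>variance_clock \<sigma> a ?t - step_clock \<sigma> a m (Suc k)\<bar>
      \<le> \<sigma>\<^sup>2 * (2 * A / real m) * (v ?t - v ?s) + \<sigma>\<^sup>2 * (2 * A / real m) * (v ?s - v 0)"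
    using 1 2 by linarith
  also have "\<dots> = \<sigma>\<^sup>2 * (2 * A / real m) * (v ?t - v 0)"
    unfolding distrib_left[symmetric] by simp
  finally show ?case .
qed

lemma step_clock_le:
  assumes "k \<le> m" shows "step_clock \<sigma> a m k \<le> \<sigma>\<^sup>2 * A\<^sup>2"
proof (cases "m = 0")
  case True
  then show ?thesis using assms by (simp add: step_clock_0)
next
  case False
  have "step_clock \<sigma> a m k \<le> (\<Sum>l=1..k. \<sigma>\<^sup>2 * A\<^sup>2 / real m)"
    unfolding step_clock_def
  proof (intro sum_mono divide_right_mono mult_left_mono)
    fix l assume "l \<in> {1..k}"
    then have "\<bar>a (real l / real m)\<bar>\<^sup>2 \<le> A\<^sup>2"
      using A[of "real l / real m"] assms by (intro power_mono) (auto simp: divide_le_eq_1)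
    then show "(a (real l / real m))\<^sup>2 \<le> A\<^sup>2" by simp
  qed auto
  also have "\<dots> = (real k / real m) * (\<sigma>\<^sup>2 * A\<^sup>2)" by simp
  also have "\<dots> \<le> 1 * (\<sigma>\<^sup>2 * A\<^sup>2)" using assms False by (intro mult_right_mono) auto
  finally show ?thesis by simp
qed

lemma step_clock_tendsto:
  assumes t: "0 \<le> t" "t \<le> 1"
  shows "(\<lambda>m. step_clock \<sigma> a m (nat \<lfloor>real m * t\<rfloor>)) \<longlonglongrightarrow> variance_clock \<sigma> a t"
proof (rule LIM_zero_cancel, rule tendsto_rabs_zero_cancel, rule tendsto_sandwich)
    show "\<forall>\<^sub>F m in sequentially. 0 \<le> \<bar>step_clock \<sigma> a m (nat \<lfloor>real m * t\<rfloor>) - variance_clock \<sigma> a t\<bar>" by simp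
    show "\<forall>\<^sub>F m in sequentially. \<bar>step_clock \<sigma> a m (nat \<lfloor>real m * t\<rfloor>) - variance_clock \<sigma> a t\<bar>
        \<le> (\<sigma>\<^sup>2 * 2 * A * (v 1 - v 0) + \<sigma>\<^sup>2 * A\<^sup>2) / real m"
      using eventually_gt_at_top[of 0]
    proof eventually_elim
      fix m :: nat assume m: "0 < m"
      define k where "k = nat \<lfloor>real m * t\<rfloor>"
      have km: "real k \<le> real m * t" "real m * t < real k + 1" using t by (auto simp: k_def)
      have k: "k \<le> m" unfolding k_def by (rule floor_grid_le[OF t])
      have "t \<le> (real k + 1) / real m" using km m by (simp add: field_simps)
      then have "t - real k / real m \<le> 1 / real m" by (simp add: add_divide_distrib)
      then have s: "0 \<le> real k / real m" "real k / real m \<le> t" "t - real k / real m \<le> 1 / real m"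
        using km m by (auto simp: field_simps)
      have "\<bar>variance_clock \<sigma> a (real k / real m) - step_clock \<sigma> a m k\<bar>
          \<le> \<sigma>\<^sup>2 * (2 * A / real m) * (v (real k / real m) - v 0)"
        by (rule step_clock_close[OF m k])
      also have "\<dots> \<le> \<sigma>\<^sup>2 * (2 * A / real m) * (v 1 - v 0)"
        using v_mono[of "real k / real m" 1] s t A_nonneg by (intro mult_left_mono) auto
      finally have 1: "\<bar>variance_clock \<sigma> a (real k / real m) - step_clock \<sigma> a m k\<bar> \<le> \<sigma>\<^sup>2 * (2 * A / real m) * (v 1 - v 0)" .
      have "variance_clock \<sigma> a t - variance_clock \<sigma> a (real k / real m) \<le> \<sigma>\<^sup>2 * A\<^sup>2 * (t - real k / real m)"
        "0 \<le> variance_clock \<sigma> a t - variance_clock \<sigma> a (real k / real m)"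
        using clock_lipschitz[of "real k / real m" t \<sigma>] s t by auto
      moreover have "\<sigma>\<^sup>2 * A\<^sup>2 * (t - real k / real m) \<le> \<sigma>\<^sup>2 * A\<^sup>2 * (1 / real m)"
        using s by (intro mult_left_mono) auto
      ultimately have "\<bar>step_clock \<sigma> a m k - variance_clock \<sigma> a t\<bar>
          \<le> \<sigma>\<^sup>2 * (2 * A / real m) * (v 1 - v 0) + \<sigma>\<^sup>2 * A\<^sup>2 * (1 / real m)"
        using 1 by linarith
      also have "\<dots> = (\<sigma>\<^sup>2 * 2 * A * (v 1 - v 0) + \<sigma>\<^sup>2 * A\<^sup>2) / real m" by (simp add: add_divide_distrib)
      finally show "\<bar>step_clock \<sigma> a m (nat \<lfloor>real m * t\<rfloor>) - variance_clock \<sigma> a t\<bar>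
        \<le> (\<sigma>\<^sup>2 * 2 * A * (v 1 - v 0) + \<sigma>\<^sup>2 * A\<^sup>2) / real m" unfolding k_def .
    qed
    show "(\<lambda>m. (\<sigma>\<^sup>2 * 2 * A * (v 1 - v 0) + \<sigma>\<^sup>2 * A\<^sup>2) / real m) \<longlonglongrightarrow> 0" by (rule lim_const_over_n)
qed simp

end

locale wiener_clock = wiener M' W + variation_dominated a v A
  for M' :: "'b measure" and W and a v :: "real \<Rightarrow> real" and A +
  fixes \<sigma> :: real
begin

lemma limit_process_continuous:
  assumes \<omega>: "\<omega> \<in> space M'"
  shows "continuous_on {0..1} (\<lambda>t. limit_process W \<sigma> a t \<omega>)"
  unfolding limit_process_def
  using clock_nonneg
  by (intro continuous_intros continuous_on_compose2[OF W_continuous[OF \<omega>] clock_continuous]) auto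

lemma limit_process_measurable: "0 \<le> t \<Longrightarrow> t \<le> 1 \<Longrightarrow> limit_process W \<sigma> a t \<in> borel_measurable M'"
  unfolding limit_process_def
  using W_measurable[OF clock_nonneg[of t \<sigma>]] W_measurable[OF clock_nonneg[of 1 \<sigma>]] by measurable

text \<open>All clocks stay in a compact interval, on which the path of \<open>W\<close> is bounded, so dominated convergence applies to the
integral over time.\<close>

lemma bridge_energy_tendsto_limit:
  assumes \<omega>: "\<omega> \<in> space M'" and r: "bounded_weight r R"
  shows "(\<lambda>m. bridge_energy r m (\<lambda>k. W (step_clock \<sigma> a m k) \<omega>)) \<longlonglongrightarrow>
    (LBINT t:{0..1}. (limit_process W \<sigma> a t \<omega>)\<^sup>2 * r t)"
proof -
  define y where "y m k = W (step_clock \<sigma> a m k) \<omega>" for m k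
  have "continuous_on {0..\<sigma>\<^sup>2 * A\<^sup>2} (\<lambda>t. W t \<omega>)"
    using W_continuous[OF \<omega>] by (rule continuous_on_subset) auto
  then have "bounded ((\<lambda>t. W t \<omega>) ` {0..\<sigma>\<^sup>2 * A\<^sup>2})" by (intro compact_imp_bounded compact_continuous_image) auto
  then obtain B where "\<forall>t\<in>{0..\<sigma>\<^sup>2 * A\<^sup>2}. \<bar>W t \<omega>\<bar> \<le> B"
    by (auto simp: bounded_iff)
  then have B: "\<And>t. 0 \<le> t \<Longrightarrow> t \<le> \<sigma>\<^sup>2 * A\<^sup>2 \<Longrightarrow> \<bar>W t \<omega>\<bar> \<le> B" by auto
  have yB: "\<bar>y m k\<bar> \<le> B" if "k \<le> m" for m k
    unfolding y_def using that step_clock_nonneg step_clock_le by (intro B) auto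
  have B0: "0 \<le> B" using yB[of 0 0] by simp
  have R: "0 \<le> R" using r abs_ge_zero[of "r 0"] order_trans unfolding bounded_weight_def by blast
  have brB: "\<bar>(bridge m (y m) k)\<^sup>2\<bar> \<le> (2 * B)\<^sup>2" if "k \<le> m" for m k
  proof -
    have "\<bar>real k / real m * y m m\<bar> \<le> 1 * B"
      unfolding abs_mult using that yB[of m m] by (intro mult_mono) (auto simp: divide_le_eq_1)
    then have "\<bar>bridge m (y m) k\<bar> \<le> 2 * B"
      using yB[OF that] abs_triangle_ineq4[of "y m k" "real k / real m * y m m"] unfolding bridge_def by simp
    then have "\<bar>bridge m (y m) k\<bar>\<^sup>2 \<le> (2 * B)\<^sup>2" by (intro power_mono) auto
    then show ?thesis by simp
  qed
  note ri = bounded_weight_integrable[OF r]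
  have lim: "(\<lambda>m. bridge m (y m) (nat \<lfloor>real m * t\<rfloor>)) \<longlonglongrightarrow> limit_process W \<sigma> a t \<omega>" if t: "0 \<le> t" "t \<le> 1" for t
  proof -
    have W: "(\<lambda>m. W (step_clock \<sigma> a m (nat \<lfloor>real m * s\<rfloor>)) \<omega>) \<longlonglongrightarrow> W (variance_clock \<sigma> a s) \<omega>"
      if s: "0 \<le> s" "s \<le> 1" for s
      using clock_nonneg[OF s] step_clock_nonneg
      by (intro continuous_on_tendsto_compose[OF W_continuous[OF \<omega>] step_clock_tendsto[OF s]]) auto
    have "(\<lambda>m. y m m) \<longlonglongrightarrow> W (variance_clock \<sigma> a 1) \<omega>" using W[of 1] by (simp add: y_def)
    then show ?thesis
      unfolding bridge_def limit_process_def using W[OF t] t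
      by (intro tendsto_intros floor_ratio_tendsto) (auto simp: y_def)
  qed
  have "(\<lambda>m. LBINT t:{0..1}. (bridge m (y m) (nat \<lfloor>real m * t\<rfloor>))\<^sup>2 * r t) \<longlonglongrightarrow>
      (LBINT t:{0..1}. (limit_process W \<sigma> a t \<omega>)\<^sup>2 * r t)"
    unfolding set_lebesgue_integral_def
  proof (rule integral_dominated_convergence[where w="\<lambda>t. indicator {0..1} t *\<^sub>R ((2 * B)\<^sup>2 * R)"])
    show "(\<lambda>t. indicator {0..1} t *\<^sub>R ((bridge m (y m) (nat \<lfloor>real m * t\<rfloor>))\<^sup>2 * r t)) \<in> borel_measurable lborel" for m
      using set_integral_floor_grid(1)[OF ri, of "\<lambda>k. (bridge m (y m) k)\<^sup>2" m]
      by (simp add: set_integrable_def)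
    have "set_integrable lborel {0..1} (\<lambda>t. (limit_process W \<sigma> a t \<omega>)\<^sup>2)"
      unfolding set_integrable_def using limit_process_continuous[OF \<omega>]
      by (intro borel_integrable_compact continuous_intros) auto
    then have "(\<lambda>t. (indicator {0..1} t *\<^sub>R (limit_process W \<sigma> a t \<omega>)\<^sup>2) * r t) \<in> borel_measurable lborel"
      using r by (intro borel_measurable_times) (auto simp: set_integrable_def bounded_weight_def)
    then show "(\<lambda>t. indicator {0..1} t *\<^sub>R ((limit_process W \<sigma> a t \<omega>)\<^sup>2 * r t)) \<in> borel_measurable lborel"
      by (simp add: mult.assoc)
    show "AE t in lborel. (\<lambda>m. indicator {0..1} t *\<^sub>R ((bridge m (y m) (nat \<lfloor>real m * t\<rfloor>))\<^sup>2 * r t)) \<longlonglongrightarrow>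
        indicator {0..1} t *\<^sub>R ((limit_process W \<sigma> a t \<omega>)\<^sup>2 * r t)"
    proof (intro AE_I2)
      fix t :: real
      show "(\<lambda>m. indicator {0..1} t *\<^sub>R ((bridge m (y m) (nat \<lfloor>real m * t\<rfloor>))\<^sup>2 * r t)) \<longlonglongrightarrow>
        indicator {0..1} t *\<^sub>R ((limit_process W \<sigma> a t \<omega>)\<^sup>2 * r t)"
        by (cases "t \<in> {0..1}") (auto intro!: tendsto_intros lim)
    qed
    show "AE t in lborel. norm (indicator {0..1} t *\<^sub>R ((bridge m (y m) (nat \<lfloor>real m * t\<rfloor>))\<^sup>2 * r t)) \<le> indicator {0..1} t *\<^sub>R ((2 * B)\<^sup>2 * R)" for m
    proof (intro AE_I2)
      fix t :: real
      have "\<bar>(bridge m (y m) (nat \<lfloor>real m * t\<rfloor>))\<^sup>2\<bar> * \<bar>r t\<bar> \<le> (2 * B)\<^sup>2 * R" if "t \<in> {0..1}"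
        using brB[OF floor_grid_le[of t m]] that r by (intro mult_mono) (auto simp: bounded_weight_def)
      then show "norm (indicator {0..1} t *\<^sub>R ((bridge m (y m) (nat \<lfloor>real m * t\<rfloor>))\<^sup>2 * r t)) \<le> indicator {0..1} t *\<^sub>R ((2 * B)\<^sup>2 * R)"
        by (cases "t \<in> {0..1}") (auto simp: abs_mult)
    qed
  qed simp
  moreover have "(LBINT t:{0..1}. (bridge m (y m) (nat \<lfloor>real m * t\<rfloor>))\<^sup>2 * r t) = bridge_energy r m (y m)" for m
    using set_integral_floor_grid(2)[OF ri, of "\<lambda>k. (bridge m (y m) k)\<^sup>2" m] unfolding bridge_energy_def .
  ultimately show ?thesis by (simp add: y_def[abs_def])
qed

lemma limit_energy_measurable:
  assumes r: "bounded_weight r R"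
  shows "(\<lambda>\<omega>. LBINT t:{0..1}. (limit_process W \<sigma> a t \<omega>)\<^sup>2 * r t) \<in> borel_measurable M'"
  by (rule borel_measurable_LIMSEQ_real[OF bridge_energy_tendsto_limit[OF _ r]])
    (auto intro!: bridge_energy_measurable W_measurable step_clock_nonneg)

end

section \<open>Convergence of weighted quadratic functionals\<close>

definition partial_sum_path :: "(nat \<Rightarrow> 'a \<Rightarrow> real) \<Rightarrow> nat \<Rightarrow> 'a \<Rightarrow> real \<Rightarrow> real" where
  "partial_sum_path e N \<omega> = (\<lambda>t\<in>{0..1}. 1 / sqrt (real N) * (\<Sum>l=1..nat \<lfloor>real N * t\<rfloor>. e l \<omega>))"

lemma partial_sum_path_grid:
  assumes "0 < N" "k \<le> N"
  shows "partial_sum_path e N \<omega> (real k / real N) = 1 / sqrt (real N) * (\<Sum>l=1..k. e l \<omega>)"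
proof -
  have "real N * (real k / real N) = real k" using assms by simp
  then show ?thesis using assms unfolding partial_sum_path_def by (simp add: divide_le_eq_1)
qed

lemma partial_sum_path_step:
  assumes "0 < N" "0 \<le> t" "t \<le> 1"
  shows "partial_sum_path e N \<omega> t = partial_sum_path e N \<omega> (real (nat \<lfloor>real N * t\<rfloor>) / real N)"
  unfolding partial_sum_path_grid[OF assms(1) floor_grid_le[OF assms(2,3)]]
  using assms by (simp add: partial_sum_path_def)

lemma weighted_sum_partial_sum_path:
  assumes "0 < N" "k \<le> N"
  shows "weighted_sum a (partial_sum_path e N \<omega>) N k = 1 / sqrt (real N) * (\<Sum>l=1..k. a (real l / real N) * e l \<omega>)"
  unfolding weighted_sum_def sum_distrib_left
proof (rule sum.cong)
  fix l assume l: "l \<in> {1..k}"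
  then obtain j where j: "l = Suc j" by (cases l) auto
  show "a (real l / real N) * (partial_sum_path e N \<omega> (real l / real N) - partial_sum_path e N \<omega> (real (l - 1) / real N))
      = 1 / sqrt (real N) * (a (real l / real N) * e l \<omega>)"
    using l assms partial_sum_path_grid[of N l e \<omega>] partial_sum_path_grid[of N "l - 1" e \<omega>]
    by (simp add: j algebra_simps)
qed simp

lemma partial_sum_path_measurable:
  assumes "\<And>i. 1 \<le> i \<Longrightarrow> e i \<in> borel_measurable M"
  shows "(\<lambda>\<omega>. partial_sum_path e N \<omega> t) \<in> borel_measurable M"
  unfolding partial_sum_path_def using assms by (cases "t \<in> {0..1}") (auto intro!: borel_measurable_sum)

lemma bridge_energy_partial_sum_measurable:
  assumes "\<And>i. 1 \<le> i \<Longrightarrow> e i \<in> borel_measurable M"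
  shows "(\<lambda>\<omega>. bridge_energy r n (weighted_sum a (partial_sum_path e N \<omega>) n)) \<in> borel_measurable M"
  by (intro bridge_energy_measurable weighted_sum_measurable partial_sum_path_measurable assms)

text \<open>The three approximations are combined with a coarse grid size \<open>m\<close> chosen first: between sample size \<open>N\<close> and grid
\<open>m\<close> the error is \<open>gap m\<close>, whose expectation passes to the limit path and is small there because that path is
continuous; between the partial sums and \<open>\<sigma> W\<close> the continuous mapping theorem applies; between grid \<open>m\<close> and the
limit process the path is moved to the clock.\<close>

lemma (in wiener_clock) energy_convergence:
  fixes M :: "'a measure" and e :: "nat \<Rightarrow> 'a \<Rightarrow> real" and \<psi> :: "real \<Rightarrow> real"
  assumes M: "prob_space M" and e: "\<And>i. 1 \<le> i \<Longrightarrow> e i \<in> borel_measurable M"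
    and fclt: "skorokhod_weak_conv M (partial_sum_path e) M' (\<lambda>\<omega>. \<lambda>t\<in>{0..1}. \<sigma> * W t \<omega>)"
    and r: "bounded_weight r R" and \<psi>: "lipschitz_test L \<psi>"
  shows "(\<lambda>N. \<integral>\<omega>. \<psi> (bridge_energy r N (weighted_sum a (partial_sum_path e N \<omega>) N)) \<partial>M)
    \<longlonglongrightarrow> (\<integral>\<omega>. \<psi> (LBINT t:{0..1}. (limit_process W \<sigma> a t \<omega>)\<^sup>2 * r t) \<partial>M')"
proof (rule tendstoI)
  fix \<epsilon> :: real assume \<epsilon>: "\<epsilon> > 0"
  interpret M: prob_space M by fact
  define S where "S = partial_sum_path e"
  define Y where "Y \<omega> = (\<lambda>t\<in>{0..1}. \<sigma> * W t \<omega>)" for \<omega>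
  define K where "K = v 1 - v 0 + A"
  \<comment> \<open>the bound of the coarse grid lemma, scaled by the Lipschitz constant and truncated\<close>
  define gap where "gap m f = min 1 (L * (7 * R * K\<^sup>2 * osc 1 f * (2 * osc (1 / real m) f + osc 1 f / real m)))" for m f
  define Q where "Q \<omega> = (LBINT t:{0..1}. (limit_process W \<sigma> a t \<omega>)\<^sup>2 * r t)" for \<omega>
  define F where "F m f = bridge_energy r m (weighted_sum a f m)" for m f
  note \<psi>b = lipschitz_test_bounds[OF \<psi>]
  note [measurable] = lipschitz_test_measurable[OF \<psi>]
  have K: "0 \<le> K" using v_mono[of 0 1] A_nonneg by (simp add: K_def)
  have R: "0 \<le> R" using r abs_ge_zero[of "r 0"] order_trans unfolding bounded_weight_def by blast
  have conv: "skorokhod_weak_conv M S M' Y" using fclt unfolding S_def Y_def .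
  have SD: "S N \<omega> \<in> skorokhod_space" if "\<omega> \<in> space M" for N \<omega>
    using conv measurable_space[OF _ that, of "S N" skorokhod_borel] by (auto simp: skorokhod_weak_conv_def)
  have Sb: "bounded_path (S N \<omega>)" if "\<omega> \<in> space M" for N \<omega>
    using skorokhod_space_bounded[OF SD[OF that]] .
  have Yc: "continuous_on {0..1} (Y \<omega>)" if "\<omega> \<in> space M'" for \<omega>
  proof -
    have "continuous_on {0..1} (\<lambda>t. \<sigma> * W t \<omega>)"
      using W_continuous[OF that] by (intro continuous_intros) (auto intro: continuous_on_subset)
    then show ?thesis by (rule continuous_on_cong[THEN iffD1, rotated -1]) (auto simp: Y_def)
  qed
  note Yb = continuous_bounded_path[OF Yc]
  have Sm: "(\<lambda>\<omega>. S N \<omega> t) \<in> borel_measurable M" for N t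
    unfolding S_def by (rule partial_sum_path_measurable[OF e])
  have Ym: "(\<lambda>\<omega>. Y \<omega> t) \<in> borel_measurable M'" if "t \<in> {0..1}" for t
    using that W_measurable[of t] unfolding Y_def by simp
  have [measurable]: "(\<lambda>\<omega>. osc h (S N \<omega>)) \<in> borel_measurable M" "(\<lambda>\<omega>. osc h (Y \<omega>)) \<in> borel_measurable M'" for h N
    using osc_measurable[OF Sm Sb] osc_measurable[OF Ym Yb] by auto
  have gm [measurable]: "(\<lambda>\<omega>. gap m (S N \<omega>)) \<in> borel_measurable M" "(\<lambda>\<omega>. gap m (Y \<omega>)) \<in> borel_measurable M'" for m N
    unfolding gap_def by measurable
  have Fm [measurable]: "(\<lambda>\<omega>. F m (S N \<omega>)) \<in> borel_measurable M" "(\<lambda>\<omega>. F m (Y \<omega>)) \<in> borel_measurable M'" for m N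
    unfolding F_def by (intro bridge_energy_measurable weighted_sum_measurable Sm Ym; assumption)+
  have Qm [measurable]: "Q \<in> borel_measurable M'"
    unfolding Q_def by (rule limit_energy_measurable[OF r])
  have gap01: "0 \<le> gap m f \<and> gap m f \<le> 1" if "bounded_path f" for m f
  proof -
    have "0 \<le> L * (7 * R * K\<^sup>2 * osc 1 f * (2 * osc (1 / real m) f + osc 1 f / real m))"
      using \<psi>b(1) R osc_nonneg[OF that, of 1] osc_nonneg[OF that, of "1 / real m"]
      by (intro mult_nonneg_nonneg add_nonneg_nonneg divide_nonneg_nonneg) auto
    then show ?thesis by (simp add: gap_def)
  qed
  have "(\<lambda>m. \<integral>\<omega>. gap m (Y \<omega>) \<partial>M') \<longlonglongrightarrow> (\<integral>\<omega>. 0 \<partial>M')"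
  proof (rule integral_dominated_convergence[where w="\<lambda>_. 1"])
    show "AE \<omega> in M'. (\<lambda>m. gap m (Y \<omega>)) \<longlonglongrightarrow> 0"
    proof (intro AE_I2)
      fix \<omega> assume \<omega>: "\<omega> \<in> space M'"
      have "(\<lambda>m. gap m (Y \<omega>)) \<longlonglongrightarrow> min 1 (L * (7 * R * K\<^sup>2 * osc 1 (Y \<omega>) * (2 * 0 + 0)))"
        unfolding gap_def by (intro tendsto_intros osc_tendsto_0 Yc \<omega> lim_const_over_n)
      then show "(\<lambda>m. gap m (Y \<omega>)) \<longlonglongrightarrow> 0" by simp
    qed
    show "AE \<omega> in M'. norm (gap m (Y \<omega>)) \<le> 1" for m
      using gap01[OF Yb] by (intro AE_I2) auto
  qed auto
  then have lim1: "\<forall>\<^sub>F m in sequentially. (\<integral>\<omega>. gap m (Y \<omega>) \<partial>M') < \<epsilon> / 4"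
    using \<epsilon> by (intro order_tendstoD(2)) auto
  have "(\<lambda>m. \<integral>\<omega>. \<psi> (bridge_energy r m (\<lambda>k. W (step_clock \<sigma> a m k) \<omega>)) \<partial>M') \<longlonglongrightarrow> (\<integral>\<omega>. \<psi> (Q \<omega>) \<partial>M')"
  proof (rule integral_dominated_convergence[where w="\<lambda>_. 1"])
    show "AE \<omega> in M'. (\<lambda>m. \<psi> (bridge_energy r m (\<lambda>k. W (step_clock \<sigma> a m k) \<omega>))) \<longlonglongrightarrow> \<psi> (Q \<omega>)"
      unfolding Q_def by (intro AE_I2 isCont_tendsto_compose[OF lipschitz_test_isCont[OF \<psi>]] bridge_energy_tendsto_limit[OF _ r])
    show "(\<lambda>\<omega>. \<psi> (bridge_energy r m (\<lambda>k. W (step_clock \<sigma> a m k) \<omega>))) \<in> borel_measurable M'" for m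
      by (intro measurable_compose[OF bridge_energy_measurable lipschitz_test_measurable[OF \<psi>]] W_measurable step_clock_nonneg)
    show "AE \<omega> in M'. norm (\<psi> (bridge_energy r m (\<lambda>k. W (step_clock \<sigma> a m k) \<omega>))) \<le> 1" for m
      using \<psi>b(2,3) by (intro AE_I2) auto
  qed auto
  then have lim2: "\<forall>\<^sub>F m in sequentially. dist (\<integral>\<omega>. \<psi> (bridge_energy r m (\<lambda>k. W (step_clock \<sigma> a m k) \<omega>)) \<partial>M') (\<integral>\<omega>. \<psi> (Q \<omega>) \<partial>M') < \<epsilon> / 4"
    by (rule tendstoD) (use \<epsilon> in simp)
  obtain m where m: "0 < m" and m1: "(\<integral>\<omega>. gap m (Y \<omega>) \<partial>M') < \<epsilon> / 4"
    and m2: "dist (\<integral>\<omega>. \<psi> (bridge_energy r m (\<lambda>k. W (step_clock \<sigma> a m k) \<omega>)) \<partial>M') (\<integral>\<omega>. \<psi> (Q \<omega>) \<partial>M') < \<epsilon> / 4"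
    using eventually_happens'[OF sequentially_bot eventually_conj[OF eventually_gt_at_top[of 0] eventually_conj[OF lim1 lim2]]]
    by blast
  have m2': "\<bar>(\<integral>\<omega>. \<psi> (F m (Y \<omega>)) \<partial>M') - (\<integral>\<omega>. \<psi> (Q \<omega>) \<partial>M')\<bar> < \<epsilon> / 4"
    using m2 bridge_energy_law[OF m lipschitz_test_measurable[OF \<psi>], of r a \<sigma>] unfolding F_def Y_def dist_real_def by simp
  have c1: "(\<lambda>N. \<integral>\<omega>. gap m (S N \<omega>) \<partial>M) \<longlonglongrightarrow> (\<integral>\<omega>. gap m (Y \<omega>) \<partial>M')"
  proof (rule skorokhod_continuous_limit_mapping[OF M prob_space_axioms conv])
    fix \<omega> and g :: "nat \<Rightarrow> real \<Rightarrow> real"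
    assume \<omega>: "\<omega> \<in> space M'" and g: "\<And>n. g n \<in> skorokhod_space" "uniform_limit {0..1} g (Y \<omega>) sequentially"
    have o: "(\<lambda>n. osc h (g n)) \<longlonglongrightarrow> osc h (Y \<omega>)" if "0 \<le> h" for h
      using osc_uniform_limit[OF Yb[OF \<omega>] skorokhod_space_bounded[OF g(1)] that g(2)] .
    show "(\<lambda>n. gap m (g n)) \<longlonglongrightarrow> gap m (Y \<omega>)"
      unfolding gap_def using m by (intro tendsto_intros o) auto
  qed (use gap01 skorokhod_space_bounded gm Yc in auto)
  have c2: "(\<lambda>N. \<integral>\<omega>. \<psi> (F m (S N \<omega>)) \<partial>M) \<longlonglongrightarrow> (\<integral>\<omega>. \<psi> (F m (Y \<omega>)) \<partial>M')"
  proof (rule skorokhod_continuous_limit_mapping[OF M prob_space_axioms conv])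
    fix \<omega> and g :: "nat \<Rightarrow> real \<Rightarrow> real"
    assume \<omega>: "\<omega> \<in> space M'" and g: "\<And>n. g n \<in> skorokhod_space" "uniform_limit {0..1} g (Y \<omega>) sequentially"
    have pt: "(\<lambda>n. g n t) \<longlonglongrightarrow> Y \<omega> t" if "t \<in> {0..1}" for t
      using tendsto_uniform_limitI[OF g(2) that] .
    show "(\<lambda>n. \<psi> (F m (g n))) \<longlonglongrightarrow> \<psi> (F m (Y \<omega>))"
      unfolding F_def
      by (intro isCont_tendsto_compose[OF lipschitz_test_isCont[OF \<psi>]] bridge_energy_tendsto weighted_sum_tendsto pt)
  qed (use \<psi>b Yc in auto)
  have "\<forall>\<^sub>F N in sequentially. (\<integral>\<omega>. gap m (S N \<omega>) \<partial>M) < \<epsilon> / 4"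
    using c1 m1 by (rule order_tendstoD(2))
  moreover have "\<forall>\<^sub>F N in sequentially. dist (\<integral>\<omega>. \<psi> (F m (S N \<omega>)) \<partial>M) (\<integral>\<omega>. \<psi> (F m (Y \<omega>)) \<partial>M') < \<epsilon> / 4"
    using c2 by (rule tendstoD) (use \<epsilon> in simp)
  ultimately have "\<forall>\<^sub>F N in sequentially. dist (\<integral>\<omega>. \<psi> (F N (S N \<omega>)) \<partial>M) (\<integral>\<omega>. \<psi> (Q \<omega>) \<partial>M') < \<epsilon>"
    using eventually_ge_at_top[of m]
  proof eventually_elim
    fix N assume N1: "(\<integral>\<omega>. gap m (S N \<omega>) \<partial>M) < \<epsilon> / 4"
      and N2: "dist (\<integral>\<omega>. \<psi> (F m (S N \<omega>)) \<partial>M) (\<integral>\<omega>. \<psi> (F m (Y \<omega>)) \<partial>M') < \<epsilon> / 4" and N: "m \<le> N"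
    have "\<bar>M.expectation (\<lambda>\<omega>. \<psi> (F N (S N \<omega>))) - M.expectation (\<lambda>\<omega>. \<psi> (F m (S N \<omega>)))\<bar> \<le> M.expectation (\<lambda>\<omega>. gap m (S N \<omega>))"
    proof (rule M.expectation_test_diff[OF \<psi> Fm(1) Fm(1) gm(1)])
      fix \<omega> assume \<omega>: "\<omega> \<in> space M"
      have N0: "0 < N" using m N by simp
      have sp: "step_path a v A (S N \<omega>) N"
      proof unfold_locales
        show "S N \<omega> t = S N \<omega> (real (nat \<lfloor>real N * t\<rfloor>) / real N)" if "0 \<le> t" "t \<le> 1" for t
          unfolding S_def using N0 that by (rule partial_sum_path_step)
      qed (use N0 Sb[OF \<omega>] in auto)
      have "L * \<bar>F N (S N \<omega>) - F m (S N \<omega>)\<bar> \<le>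
          L * (7 * R * K\<^sup>2 * osc 1 (S N \<omega>) * (2 * osc (1 / real m) (S N \<omega>) + osc 1 (S N \<omega>) / real m))"
        using step_path.bridge_energy_coarse_grid[OF sp m N r] \<psi>b(1) unfolding F_def K_def
        by (intro mult_left_mono)
      then show "min 1 (L * \<bar>F N (S N \<omega>) - F m (S N \<omega>)\<bar>) \<le> gap m (S N \<omega>)"
        unfolding gap_def by simp
    qed (use gap01 Sb in auto)
    then show "dist (\<integral>\<omega>. \<psi> (F N (S N \<omega>)) \<partial>M) (\<integral>\<omega>. \<psi> (Q \<omega>) \<partial>M') < \<epsilon>"
      using N1 N2 m2' \<epsilon> unfolding dist_real_def by linarith
  qed
  then show "\<forall>\<^sub>F N in sequentially. dist (\<integral>\<omega>. \<psi> (bridge_energy r N (weighted_sum a (partial_sum_path e N \<omega>) N)) \<partial>M)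
      (\<integral>\<omega>. \<psi> (LBINT t:{0..1}. (limit_process W \<sigma> a t \<omega>)\<^sup>2 * r t) \<partial>M') < \<epsilon>"
    unfolding F_def S_def Q_def .
qed

section \<open>Second moments of bridges\<close>

text \<open>Each distance \<open>\<bar>k - i\<bar>\<close> occurs at most twice, once on either side of \<open>i\<close>.\<close>

lemma power_kernel_sum_le:
  assumes \<kappa>: "\<kappa> > 1" and B: "finite B"
  shows "(\<Sum>k\<in>B. (\<bar>real k - real i\<bar> + 1) powr (- \<kappa>)) \<le> 2 * (\<Sum>n. real (Suc n) powr (- \<kappa>))"
proof -
  let ?g = "\<lambda>n. real (Suc n) powr (- \<kappa>)"
  have "summable (\<lambda>n. real n powr (- \<kappa>))" using \<kappa> by (simp add: summable_real_powr_iff)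
  then have sg: "summable ?g" by (subst summable_Suc_iff)
  have le: "(\<Sum>k\<in>S. ?g (h k)) \<le> suminf ?g" if "finite S" "inj_on h S" for S and h :: "nat \<Rightarrow> nat"
  proof -
    have "(\<Sum>k\<in>S. ?g (h k)) = sum ?g (h ` S)" using that(2) by (simp add: sum.reindex)
    also have "\<dots> \<le> suminf ?g" using that(1) by (intro sum_le_suminf sg) auto
    finally show ?thesis .
  qed
  have "(\<Sum>k\<in>B. (\<bar>real k - real i\<bar> + 1) powr (- \<kappa>)) =
      (\<Sum>k\<in>B \<inter> {..i}. (\<bar>real k - real i\<bar> + 1) powr (- \<kappa>)) + (\<Sum>k\<in>B \<inter> {i<..}. (\<bar>real k - real i\<bar> + 1) powr (- \<kappa>))"
    using B by (subst sum.union_disjoint[symmetric]) (auto intro!: sum.cong)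
  also have "(\<Sum>k\<in>B \<inter> {..i}. (\<bar>real k - real i\<bar> + 1) powr (- \<kappa>)) = (\<Sum>k\<in>B \<inter> {..i}. ?g (i - k))"
    by (intro sum.cong) (auto simp: of_nat_diff abs_if add.commute)
  also have "(\<Sum>k\<in>B \<inter> {i<..}. (\<bar>real k - real i\<bar> + 1) powr (- \<kappa>)) = (\<Sum>k\<in>B \<inter> {i<..}. ?g (k - i))"
    by (intro sum.cong) (auto simp: of_nat_diff abs_if add.commute)
  also have "(\<Sum>k\<in>B \<inter> {..i}. ?g (i - k)) + (\<Sum>k\<in>B \<inter> {i<..}. ?g (k - i)) \<le> suminf ?g + suminf ?g"
    using B by (intro add_mono le) (auto simp: inj_on_def)
  finally show ?thesis by simp
qed

lemma (in prob_space) weighted_sum_second_moment: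
  fixes e :: "nat \<Rightarrow> 'a \<Rightarrow> real" and c :: "nat \<Rightarrow> real"
  assumes \<kappa>: "\<kappa> > 1" and B: "finite B" "\<And>i. i \<in> B \<Longrightarrow> 1 \<le> i"
    and int: "\<And>i k. 1 \<le> i \<Longrightarrow> 1 \<le> k \<Longrightarrow> integrable M (\<lambda>\<omega>. e i \<omega> * e k \<omega>)"
    and cov: "\<And>i k. 1 \<le> i \<Longrightarrow> 1 \<le> k \<Longrightarrow> \<bar>\<integral>\<omega>. e i \<omega> * e k \<omega> \<partial>M\<bar> \<le> C * (\<bar>real k - real i\<bar> + 1) powr (- \<kappa>)"
    and c: "\<And>i. i \<in> B \<Longrightarrow> \<bar>c i\<bar> \<le> b"
  shows "integrable M (\<lambda>\<omega>. (\<Sum>i\<in>B. c i * e i \<omega>)\<^sup>2)"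
    and "(\<integral>\<omega>. (\<Sum>i\<in>B. c i * e i \<omega>)\<^sup>2 \<partial>M) \<le> b\<^sup>2 * C * (2 * (\<Sum>n. real (Suc n) powr (- \<kappa>))) * real (card B)"
proof -
  let ?Z = "2 * (\<Sum>n. real (Suc n) powr (- \<kappa>))"
  have sq: "(\<Sum>i\<in>B. c i * e i \<omega>)\<^sup>2 = (\<Sum>i\<in>B. \<Sum>k\<in>B. (c i * c k) * (e i \<omega> * e k \<omega>))" for \<omega>
    by (simp add: power2_eq_square sum_product algebra_simps)
  show "integrable M (\<lambda>\<omega>. (\<Sum>i\<in>B. c i * e i \<omega>)\<^sup>2)"
    unfolding sq using int B by (intro Bochner_Integration.integrable_sum integrable_mult_right) auto
  have C: "0 \<le> C" using order_trans[OF abs_ge_zero cov[of 1 1]] by simp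
  have "(\<integral>\<omega>. (\<Sum>i\<in>B. c i * e i \<omega>)\<^sup>2 \<partial>M) = (\<Sum>i\<in>B. \<Sum>k\<in>B. (c i * c k) * (\<integral>\<omega>. e i \<omega> * e k \<omega> \<partial>M))"
    unfolding sq using int B by (subst Bochner_Integration.integral_sum; (intro Bochner_Integration.integrable_sum integrable_mult_right sum.cong refl)?)
      (auto simp: Bochner_Integration.integral_sum)
  also have "\<dots> \<le> (\<Sum>i\<in>B. \<Sum>k\<in>B. b\<^sup>2 * (C * (\<bar>real k - real i\<bar> + 1) powr (- \<kappa>)))"
  proof (intro sum_mono)
    fix i k assume ik: "i \<in> B" "k \<in> B"
    have "\<bar>(c i * c k) * (\<integral>\<omega>. e i \<omega> * e k \<omega> \<partial>M)\<bar> \<le> (b * b) * (C * (\<bar>real k - real i\<bar> + 1) powr (- \<kappa>))"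
      unfolding abs_mult using c[OF ik(1)] c[OF ik(2)] cov[of i k] B(2) ik
      by (intro mult_mono) (auto intro: mult_nonneg_nonneg order_trans[OF abs_ge_zero])
    then show "(c i * c k) * (\<integral>\<omega>. e i \<omega> * e k \<omega> \<partial>M) \<le> b\<^sup>2 * (C * (\<bar>real k - real i\<bar> + 1) powr (- \<kappa>))"
      by (simp add: power2_eq_square)
  qed
  also have "\<dots> = (\<Sum>i\<in>B. b\<^sup>2 * C * (\<Sum>k\<in>B. (\<bar>real k - real i\<bar> + 1) powr (- \<kappa>)))"
    by (simp add: sum_distrib_left mult.assoc)
  also have "\<dots> \<le> (\<Sum>i\<in>B. b\<^sup>2 * C * ?Z)"
    using C by (intro sum_mono mult_left_mono power_kernel_sum_le \<kappa> B) auto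
  finally show "(\<integral>\<omega>. (\<Sum>i\<in>B. c i * e i \<omega>)\<^sup>2 \<partial>M) \<le> b\<^sup>2 * C * ?Z * real (card B)" by (simp add: mult.commute)
qed

lemma square_diff_le: "(x - y)\<^sup>2 \<le> 2 * x\<^sup>2 + 2 * (y::real)\<^sup>2"
  using zero_le_power2[of "x + y"] by (simp add: power2_eq_square algebra_simps)

text \<open>A bridge at relative time \<open>p\<close> is \<open>1 - p\<close> times the sum before minus \<open>p\<close> times the sum after. If the second moments
of these sums are proportional to their lengths \<open>p\<close> and \<open>1 - p\<close>, bounding the
square of the difference by twice the sum of the squares yields the factor \<open>p (1 - p)\<close>.\<close>

lemma (in prob_space) pinned_second_moment:
  fixes X Y :: "'a \<Rightarrow> real"
  assumes X: "integrable M (\<lambda>\<omega>. (X \<omega>)\<^sup>2)" "X \<in> borel_measurable M" "expectation (\<lambda>\<omega>. (X \<omega>)\<^sup>2) \<le> G * p"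
    and Y: "integrable M (\<lambda>\<omega>. (Y \<omega>)\<^sup>2)" "Y \<in> borel_measurable M" "expectation (\<lambda>\<omega>. (Y \<omega>)\<^sup>2) \<le> G * (1 - p)"
  shows "integrable M (\<lambda>\<omega>. ((1 - p) * X \<omega> - p * Y \<omega>)\<^sup>2)"
    and "expectation (\<lambda>\<omega>. ((1 - p) * X \<omega> - p * Y \<omega>)\<^sup>2) \<le> 2 * G * (p * (1 - p))"
proof -
  have le: "((1 - p) * X \<omega> - p * Y \<omega>)\<^sup>2 \<le> 2 * (1 - p)\<^sup>2 * (X \<omega>)\<^sup>2 + 2 * p\<^sup>2 * (Y \<omega>)\<^sup>2" for \<omega>
    using square_diff_le[of "(1 - p) * X \<omega>" "p * Y \<omega>"] by (simp add: power_mult_distrib)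
  have i: "integrable M (\<lambda>\<omega>. 2 * (1 - p)\<^sup>2 * (X \<omega>)\<^sup>2 + 2 * p\<^sup>2 * (Y \<omega>)\<^sup>2)"
    using X Y by (intro Bochner_Integration.integrable_add integrable_mult_right) auto
  show *: "integrable M (\<lambda>\<omega>. ((1 - p) * X \<omega> - p * Y \<omega>)\<^sup>2)"
  proof (rule Bochner_Integration.integrable_bound[OF i])
    show "AE \<omega> in M. norm (((1 - p) * X \<omega> - p * Y \<omega>)\<^sup>2) \<le> norm (2 * (1 - p)\<^sup>2 * (X \<omega>)\<^sup>2 + 2 * p\<^sup>2 * (Y \<omega>)\<^sup>2)"
      using le by (intro AE_I2) (simp add: order_trans[OF _ abs_ge_self])
  qed (use X Y in measurable)
  have "expectation (\<lambda>\<omega>. ((1 - p) * X \<omega> - p * Y \<omega>)\<^sup>2) \<le> expectation (\<lambda>\<omega>. 2 * (1 - p)\<^sup>2 * (X \<omega>)\<^sup>2 + 2 * p\<^sup>2 * (Y \<omega>)\<^sup>2)"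
    using * i le by (intro integral_mono) auto
  also have "\<dots> = 2 * (1 - p)\<^sup>2 * expectation (\<lambda>\<omega>. (X \<omega>)\<^sup>2) + 2 * p\<^sup>2 * expectation (\<lambda>\<omega>. (Y \<omega>)\<^sup>2)"
    using X Y by simp
  also have "\<dots> \<le> 2 * (1 - p)\<^sup>2 * (G * p) + 2 * p\<^sup>2 * (G * (1 - p))"
    using X Y by (intro add_mono mult_left_mono) auto
  also have "\<dots> = 2 * G * (p * (1 - p))" by (simp add: power2_eq_square algebra_simps)
  finally show "expectation (\<lambda>\<omega>. ((1 - p) * X \<omega> - p * Y \<omega>)\<^sup>2) \<le> 2 * G * (p * (1 - p))" .
qed

lemma (in prob_space) bridge_second_moment:
  fixes x :: "nat \<Rightarrow> 'a \<Rightarrow> real"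
  assumes N: "0 < N" and k: "k \<le> N"
    and int: "\<And>B. B \<subseteq> {1..N} \<Longrightarrow> integrable M (\<lambda>\<omega>. (\<Sum>l\<in>B. x l \<omega>)\<^sup>2)"
    and le: "\<And>B. B \<subseteq> {1..N} \<Longrightarrow> expectation (\<lambda>\<omega>. (\<Sum>l\<in>B. x l \<omega>)\<^sup>2) \<le> G * (real (card B) / real N)"
    and [measurable]: "\<And>l. 1 \<le> l \<Longrightarrow> x l \<in> borel_measurable M"
    and y: "\<And>k \<omega>. k \<le> N \<Longrightarrow> \<omega> \<in> space M \<Longrightarrow> y \<omega> k = (\<Sum>l=1..k. x l \<omega>)"
  shows "integrable M (\<lambda>\<omega>. (bridge N (y \<omega>) k)\<^sup>2)"
    and "expectation (\<lambda>\<omega>. (bridge N (y \<omega>) k)\<^sup>2) \<le> 2 * G * (real k / real N * (1 - real k / real N))"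
proof -
  define p where "p = real k / real N"
  have eq: "bridge N (y \<omega>) k = (1 - p) * (\<Sum>l\<in>{1..k}. x l \<omega>) - p * (\<Sum>l\<in>{k<..N}. x l \<omega>)" if "\<omega> \<in> space M" for \<omega>
  proof -
    have "{1..N} = {1..k} \<union> {k<..N}" using k by auto
    then have "(\<Sum>l=1..N. x l \<omega>) = (\<Sum>l\<in>{1..k}. x l \<omega>) + (\<Sum>l\<in>{k<..N}. x l \<omega>)"
      by (subst sum.union_disjoint[symmetric]) auto
    then show ?thesis using y[OF _ that] k by (simp add: bridge_def p_def algebra_simps)
  qed
  have "1 - p = real (card {k<..N}) / real N" using N k by (simp add: p_def of_nat_diff field_simps)
  then have m: "expectation (\<lambda>\<omega>. (\<Sum>l\<in>{k<..N}. x l \<omega>)\<^sup>2) \<le> G * (1 - p)"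
    using le[of "{k<..N}"] by (auto simp: subset_iff)
  have m': "expectation (\<lambda>\<omega>. (\<Sum>l\<in>{1..k}. x l \<omega>)\<^sup>2) \<le> G * p"
    using le[of "{1..k}"] k by (simp add: p_def)
  have i: "integrable M (\<lambda>\<omega>. (\<Sum>l\<in>{k<..N}. x l \<omega>)\<^sup>2)" "integrable M (\<lambda>\<omega>. (\<Sum>l\<in>{1..k}. x l \<omega>)\<^sup>2)"
    using k by (intro int; auto)+
  have ms: "(\<lambda>\<omega>. \<Sum>l\<in>{k<..N}. x l \<omega>) \<in> borel_measurable M" "(\<lambda>\<omega>. \<Sum>l\<in>{1..k}. x l \<omega>) \<in> borel_measurable M"
    by (intro borel_measurable_sum; simp)+
  note P = pinned_second_moment[OF i(2) ms(2) m' i(1) ms(1) m]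
  show "integrable M (\<lambda>\<omega>. (bridge N (y \<omega>) k)\<^sup>2)"
    using P(1) by (rule Bochner_Integration.integrable_cong[THEN iffD1, OF refl, rotated]) (simp add: eq)
  have "expectation (\<lambda>\<omega>. (bridge N (y \<omega>) k)\<^sup>2) = expectation (\<lambda>\<omega>. ((1 - p) * (\<Sum>l\<in>{1..k}. x l \<omega>) - p * (\<Sum>l\<in>{k<..N}. x l \<omega>))\<^sup>2)"
    by (intro Bochner_Integration.integral_cong refl) (simp add: eq)
  then show "expectation (\<lambda>\<omega>. (bridge N (y \<omega>) k)\<^sup>2) \<le> 2 * G * (real k / real N * (1 - real k / real N))"
    using P(2) unfolding p_def by simp
qed

section \<open>The singular weight\<close>

definition trunc_weight :: "real \<Rightarrow> real \<Rightarrow> real" where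
  "trunc_weight \<delta> t = indicator {\<delta>..1 - \<delta>} t / (t * (1 - t))"

lemma trunc_weight_nonneg: "0 < \<delta> \<Longrightarrow> 0 \<le> trunc_weight \<delta> t"
  by (auto simp: trunc_weight_def indicator_def)

lemma bounded_trunc_weight:
  assumes "0 < \<delta>" shows "bounded_weight (trunc_weight \<delta>) (1 / \<delta>\<^sup>2)"
proof -
  have "trunc_weight \<delta> t \<le> 1 / \<delta>\<^sup>2" for t
  proof (cases "t \<in> {\<delta>..1 - \<delta>}")
    case True
    have "\<delta> * \<delta> \<le> t * (1 - t)" using True assms by (intro mult_mono) auto
    then show ?thesis using True assms by (simp add: trunc_weight_def power2_eq_square frac_le)
  qed (simp add: trunc_weight_def)
  then have "\<bar>trunc_weight \<delta> t\<bar> \<le> 1 / \<delta>\<^sup>2" for t using trunc_weight_nonneg[OF assms, of t] by simp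
  moreover have "trunc_weight \<delta> \<in> borel_measurable borel"
    unfolding trunc_weight_def[abs_def] by measurable
  ultimately show ?thesis by (simp add: bounded_weight_def)
qed

text \<open>The difference of the two energies is the energy for the weight \<open>1 / (t (1 - t))\<close> on the times within \<open>\<delta>\<close>, but not
within \<open>1/N\<close>, of an end point. There the second moment of the bridge is at most \<open>2 G t (1 - t)\<close>, so the expected
integrand is bounded and the domain has length at most \<open>2 \<delta>\<close>.\<close>

lemma (in prob_space) tail_energy_bound:
  assumes N: "0 < N" and \<delta>: "1 / real N \<le> \<delta>" "\<delta> \<le> 1 / 2" and G: "0 \<le> G"
    and int: "\<And>k. k \<le> N \<Longrightarrow> integrable M (\<lambda>\<omega>. (bridge N (y \<omega>) k)\<^sup>2)"
    and le: "\<And>k. k \<le> N \<Longrightarrow> expectation (\<lambda>\<omega>. (bridge N (y \<omega>) k)\<^sup>2) \<le> G * (real k / real N * (1 - real k / real N))"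
  shows "integrable M (\<lambda>\<omega>. \<bar>bridge_energy (trunc_weight (1 / real N)) N (y \<omega>) - bridge_energy (trunc_weight \<delta>) N (y \<omega>)\<bar>)"
    and "expectation (\<lambda>\<omega>. \<bar>bridge_energy (trunc_weight (1 / real N)) N (y \<omega>) - bridge_energy (trunc_weight \<delta>) N (y \<omega>)\<bar>)
      \<le> 4 * G * \<delta>"
proof -
  define r where "r t = trunc_weight (1 / real N) t - trunc_weight \<delta> t" for t
  define g where "g k = expectation (\<lambda>\<omega>. (bridge N (y \<omega>) k)\<^sup>2)" for k
  have \<delta>0: "0 < \<delta>" "0 < 1 / real N" using N \<delta> by (auto intro: less_le_trans[of 0 "1 / real N"])
  have ri1: "set_integrable lborel {0..1} (trunc_weight (1 / real N))" "set_integrable lborel {0..1} (trunc_weight \<delta>)"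
    by (rule bounded_weight_integrable[OF bounded_trunc_weight] ; use \<delta>0 in simp)+
  have ri: "set_integrable lborel {0..1} r" unfolding r_def using ri1 by (rule set_integral_diff)
  have r0: "0 \<le> r t" for t
  proof (cases "t \<in> {\<delta>..1 - \<delta>}")
    case True
    then have "t \<in> {1 / real N..1 - 1 / real N}" using \<delta> by auto
    then show ?thesis using True by (simp add: r_def trunc_weight_def)
  qed (use trunc_weight_nonneg[OF \<delta>0(2)] in \<open>simp add: r_def trunc_weight_def[of \<delta>]\<close>)
  have cell0: "0 \<le> cell_weight r N k" for k
    unfolding cell_weight_def set_lebesgue_integral_def
    by (rule integral_nonneg_AE) (auto simp: r0)
  have "bridge_energy (trunc_weight (1 / real N)) N z - bridge_energy (trunc_weight \<delta>) N z = bridge_energy r N z" for z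
  proof -
    have e: "bridge_energy w N z = (LBINT t:{0..1}. (bridge N z (nat \<lfloor>real N * t\<rfloor>))\<^sup>2 * w t)"
      if "set_integrable lborel {0..1} w" for w
      using set_integral_floor_grid(2)[OF that, of "\<lambda>k. (bridge N z k)\<^sup>2" N] by (simp add: bridge_energy_def)
    have i: "set_integrable lborel {0..1} (\<lambda>t. (bridge N z (nat \<lfloor>real N * t\<rfloor>))\<^sup>2 * w t)"
      if "set_integrable lborel {0..1} w" for w
      using set_integral_floor_grid(1)[OF that, of "\<lambda>k. (bridge N z k)\<^sup>2" N] .
    show ?thesis unfolding e[OF ri1(1)] e[OF ri1(2)] e[OF ri] r_def
      using set_integral_diff(2)[OF i[OF ri1(1)] i[OF ri1(2)]] by (simp add: right_diff_distrib)
  qed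
  moreover have nn: "0 \<le> bridge_energy r N z" for z
    unfolding bridge_energy_def by (intro sum_nonneg mult_nonneg_nonneg cell0) auto
  ultimately have eq: "\<bar>bridge_energy (trunc_weight (1 / real N)) N z - bridge_energy (trunc_weight \<delta>) N z\<bar> = bridge_energy r N z" for z
    by simp
  show "integrable M (\<lambda>\<omega>. \<bar>bridge_energy (trunc_weight (1 / real N)) N (y \<omega>) - bridge_energy (trunc_weight \<delta>) N (y \<omega>)\<bar>)"
    unfolding eq unfolding bridge_energy_def using int by (intro Bochner_Integration.integrable_sum integrable_mult_left) auto
  have "expectation (\<lambda>\<omega>. bridge_energy r N (y \<omega>)) = (\<Sum>k\<le>N. g k * cell_weight r N k)"
    unfolding bridge_energy_def g_def using int by (subst Bochner_Integration.integral_sum) auto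
  also have "\<dots> = (LBINT t:{0..1}. g (nat \<lfloor>real N * t\<rfloor>) * r t)"
    using set_integral_floor_grid(2)[OF ri, of g N] by simp
  also have "\<dots> \<le> (LBINT t:{0..1}. 2 * G * (indicator {0..\<delta>} t + indicator {1 - \<delta>..1} t))"
  proof (rule set_integral_mono[OF set_integral_floor_grid(1)[OF ri]])
    show "set_integrable lborel {0..1} (\<lambda>t. 2 * G * (indicator {0..\<delta>} t + indicator {1 - \<delta>..1} t))"
      by (rule bounded_weight_integrable[of _ "4 * G"]) (use G in \<open>auto simp: bounded_weight_def indicator_def\<close>)
    fix t :: real assume t: "t \<in> {0..1}"
    show "g (nat \<lfloor>real N * t\<rfloor>) * r t \<le> 2 * G * (indicator {0..\<delta>} t + indicator {1 - \<delta>..1} t)"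
    proof (cases "t \<in> {\<delta>..1 - \<delta>} \<or> t \<notin> {1 / real N..1 - 1 / real N}")
      case True
      then have "r t = 0" using \<delta> by (auto simp: r_def trunc_weight_def indicator_def)
      then show ?thesis using G by simp
    next
      case False
      define k where "k = nat \<lfloor>real N * t\<rfloor>"
      have k: "k \<le> N" unfolding k_def using t by (intro floor_grid_le) auto
      have km: "real k \<le> real N * t" "real N * t < real k + 1" using t by (auto simp: k_def)
      have "1 / real N \<le> t" "t \<le> 1 - 1 / real N" using False by auto
      then have tt: "0 < t" "t < 1" "1 / real N \<le> 1 - t" using \<delta>0(2) by linarith+
      have p: "real k / real N \<le> t" using km N by (simp add: field_simps)
      have "t \<le> (real k + 1) / real N" using km N by (simp add: field_simps)
      then have "1 - real k / real N \<le> (1 - t) + 1 / real N" by (simp add: add_divide_distrib)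
      \<comment> \<open>rounding down enlarges \<open>1 - t\<close> by at most \<open>1/N\<close>, hence at most doubles it\<close>
      then have q: "1 - real k / real N \<le> 2 * (1 - t)" "0 \<le> 1 - real k / real N" using tt k N by auto
      have "g k \<le> G * (real k / real N * (1 - real k / real N))" unfolding g_def by (rule le[OF k])
      also have "\<dots> \<le> G * (t * (2 * (1 - t)))" using p q tt G by (intro mult_left_mono mult_mono) auto
      finally have "g k * (1 / (t * (1 - t))) \<le> G * (t * (2 * (1 - t))) * (1 / (t * (1 - t)))"
        using tt by (intro mult_right_mono) auto
      moreover have "r t = 1 / (t * (1 - t))" using False by (simp add: r_def trunc_weight_def)
      moreover have "1 \<le> indicator {0..\<delta>} t + (indicator {1 - \<delta>..1} t :: real)"
        using False t by (auto simp: indicator_def)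
      then have "2 * G * 1 \<le> 2 * G * (indicator {0..\<delta>} t + indicator {1 - \<delta>..1} t)"
        using G by (intro mult_left_mono) auto
      moreover have "G * (t * (2 * (1 - t))) * (1 / (t * (1 - t))) = 2 * G * 1"
        using tt by (simp add: divide_eq_eq)
      ultimately show ?thesis unfolding k_def[symmetric] by simp
    qed
  qed
  also have "\<dots> = (LBINT t. 2 * G * indicator {0..\<delta>} t + 2 * G * indicator {1 - \<delta>..1} t)"
    unfolding set_lebesgue_integral_def using \<delta> \<delta>0 by (intro Bochner_Integration.integral_cong refl) (auto simp: indicator_def)
  also have "\<dots> = 4 * G * \<delta>"
    using \<delta>0 by (subst Bochner_Integration.integral_add) (auto simp: integrable_indicator_iff)
  finally show "expectation (\<lambda>\<omega>. \<bar>bridge_energy (trunc_weight (1 / real N)) N (y \<omega>) - bridge_energy (trunc_weight \<delta>) N (y \<omega>)\<bar>)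
      \<le> 4 * G * \<delta>" unfolding eq .
qed

context wiener
begin

lemma increment_second_moment:
  assumes st: "0 \<le> s" "s \<le> t"
  shows "integrable M' (\<lambda>\<omega>. (W t \<omega> - W s \<omega>)\<^sup>2)" "expectation (\<lambda>\<omega>. (W t \<omega> - W s \<omega>)\<^sup>2) = t - s"
proof -
  have "integrable M' (\<lambda>\<omega>. (W t \<omega> - W s \<omega>)\<^sup>2) \<and> expectation (\<lambda>\<omega>. (W t \<omega> - W s \<omega>)\<^sup>2) = t - s"
  proof (cases "s = t")
    case False
    then have lt: "s < t" using st by simp
    note D = W_increment_normal[OF st(1) lt]
    have m: "has_bochner_integral lborel (\<lambda>x. normal_density 0 (sqrt (t - s)) x * x\<^sup>2) (t - s)"
      using normal_moment_even[of "sqrt (t - s)" 0 1] lt by (simp add: numeral_2_eq_2 diff_divide_distrib)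
    show ?thesis
      using distributed_integrable[OF D, of "\<lambda>x. x\<^sup>2"] distributed_integral[OF D, of "\<lambda>x. x\<^sup>2"] m
      by (auto simp: has_bochner_integral_iff)
  qed simp
  then show "integrable M' (\<lambda>\<omega>. (W t \<omega> - W s \<omega>)\<^sup>2)" "expectation (\<lambda>\<omega>. (W t \<omega> - W s \<omega>)\<^sup>2) = t - s" by auto
qed

end

context wiener_clock
begin

text \<open>The decomposition into a part before and a part after \<open>t\<close>, with the Lipschitz bound
of the clock in the role of the moment bounds.\<close>

lemma limit_process_second_moment:
  assumes t: "0 \<le> t" "t \<le> 1"
  shows "integrable M' (\<lambda>\<omega>. (limit_process W \<sigma> a t \<omega>)\<^sup>2)"
    "expectation (\<lambda>\<omega>. (limit_process W \<sigma> a t \<omega>)\<^sup>2) \<le> 2 * (\<sigma>\<^sup>2 * A\<^sup>2) * (t * (1 - t))"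
proof -
  let ?b = "variance_clock \<sigma> a"
  have b: "0 \<le> ?b t" "?b t \<le> ?b 1" using clock_nonneg[OF t] clock_lipschitz(1)[of t 1 \<sigma>] t by auto
  have 0: "W 0 \<omega> = 0" if "\<omega> \<in> space M'" for \<omega> using W_zero[OF that] .
  have eq: "limit_process W \<sigma> a t \<omega> = (1 - t) * (W (?b t) \<omega> - W 0 \<omega>) - t * (W (?b 1) \<omega> - W (?b t) \<omega>)"
    if "\<omega> \<in> space M'" for \<omega>
    using 0[OF that] by (simp add: limit_process_def algebra_simps)
  have mm: "(\<lambda>\<omega>. W s' \<omega> - W s \<omega>) \<in> borel_measurable M'" if "0 \<le> s" "0 \<le> s'" for s s'
    using W_measurable[OF that(1)] W_measurable[OF that(2)] by measurable
  have "?b t - 0 \<le> \<sigma>\<^sup>2 * A\<^sup>2 * t" using clock_lipschitz(2)[of 0 t \<sigma>] t by (simp add: clock_zero)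
  moreover have "?b 1 - ?b t \<le> \<sigma>\<^sup>2 * A\<^sup>2 * (1 - t)" using clock_lipschitz(2)[of t 1 \<sigma>] t by simp
  ultimately have P: "integrable M' (\<lambda>\<omega>. ((1 - t) * (W (?b t) \<omega> - W 0 \<omega>) - t * (W (?b 1) \<omega> - W (?b t) \<omega>))\<^sup>2)"
    "expectation (\<lambda>\<omega>. ((1 - t) * (W (?b t) \<omega> - W 0 \<omega>) - t * (W (?b 1) \<omega> - W (?b t) \<omega>))\<^sup>2) \<le> 2 * (\<sigma>\<^sup>2 * A\<^sup>2) * (t * (1 - t))"
    using increment_second_moment[of 0 "?b t"] increment_second_moment[of "?b t" "?b 1"] b mm
    by (intro pinned_second_moment; simp)+
  show "integrable M' (\<lambda>\<omega>. (limit_process W \<sigma> a t \<omega>)\<^sup>2)"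
    using P(1) by (rule Bochner_Integration.integrable_cong[THEN iffD1, OF refl, rotated]) (simp add: eq)
  have "expectation (\<lambda>\<omega>. (limit_process W \<sigma> a t \<omega>)\<^sup>2) =
      expectation (\<lambda>\<omega>. ((1 - t) * (W (?b t) \<omega> - W 0 \<omega>) - t * (W (?b 1) \<omega> - W (?b t) \<omega>))\<^sup>2)"
    by (intro Bochner_Integration.integral_cong refl) (simp add: eq)
  then show "expectation (\<lambda>\<omega>. (limit_process W \<sigma> a t \<omega>)\<^sup>2) \<le> 2 * (\<sigma>\<^sup>2 * A\<^sup>2) * (t * (1 - t))" using P(2) by simp
qed

text \<open>By path continuity the process is the limit of its values at the grid points below \<open>t\<close>, and each discretisation takes
countably many times only.\<close>

lemma limit_process_jointly_measurable:
  "(\<lambda>x. indicator {0..1} (snd x) * limit_process W \<sigma> a (snd x) (fst x)) \<in> borel_measurable (M' \<Otimes>\<^sub>M lborel)"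
proof (rule borel_measurable_LIMSEQ_real)
  let ?u = "\<lambda>n x. indicator {0..1} (snd x) *
    (if nat \<lfloor>real n * snd x\<rfloor> \<le> n then limit_process W \<sigma> a (real (nat \<lfloor>real n * snd x\<rfloor>) / real n) (fst x) else 0)"
  fix x :: "'b \<times> real" assume "x \<in> space (M' \<Otimes>\<^sub>M lborel)"
  then have x: "fst x \<in> space M'" by (auto simp: space_pair_measure)
  show "(\<lambda>n. ?u n x) \<longlonglongrightarrow> indicator {0..1} (snd x) * limit_process W \<sigma> a (snd x) (fst x)"
  proof (cases "snd x \<in> {0..1}")
    case True
    then have le: "nat \<lfloor>real n * snd x\<rfloor> \<le> n" for n by (intro floor_grid_le) auto
    have "real (nat \<lfloor>real n * snd x\<rfloor>) / real n \<le> 1" for n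
      unfolding divide_le_eq_1 using of_nat_mono[OF le[of n], where 'a=real] by (smt (verit) of_nat_0_le_iff)
    then have "\<forall>\<^sub>F n in sequentially. real (nat \<lfloor>real n * snd x\<rfloor>) / real n \<in> {0..1}"
      by (intro always_eventually) simp
    then have "(\<lambda>n. limit_process W \<sigma> a (real (nat \<lfloor>real n * snd x\<rfloor>) / real n) (fst x)) \<longlonglongrightarrow> limit_process W \<sigma> a (snd x) (fst x)"
      using True
      by (intro continuous_on_tendsto_compose[OF limit_process_continuous[OF x] floor_ratio_tendsto]) auto
    then show ?thesis using True le by simp
  qed simp
next
  fix n :: nat
  let ?f = "\<lambda>k x. if k \<le> n then limit_process W \<sigma> a (real k / real n) (fst x) else 0"
  have "?f k \<in> borel_measurable (M' \<Otimes>\<^sub>M lborel)" for k :: nat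
    using limit_process_measurable[of "real k / real n"]
    by (cases "k \<le> n") (auto simp: divide_le_eq_1 intro: measurable_compose[OF measurable_fst])
  moreover have "(\<lambda>x :: 'b \<times> real. nat \<lfloor>real n * snd x\<rfloor>) \<in> (M' \<Otimes>\<^sub>M lborel) \<rightarrow>\<^sub>M count_space UNIV" by measurable
  ultimately have [measurable]: "(\<lambda>x. ?f (nat \<lfloor>real n * snd x\<rfloor>) x) \<in> borel_measurable (M' \<Otimes>\<^sub>M lborel)"
    by (rule measurable_compose_countable)
  show "(\<lambda>x. indicator {0..1} (snd x) * ?f (nat \<lfloor>real n * snd x\<rfloor>) x) \<in> borel_measurable (M' \<Otimes>\<^sub>M lborel)"
    by measurable
qed

lemma singular_energy_jointly_measurable:
  "(\<lambda>(\<omega>, t). indicator {0..1} t *\<^sub>R ((limit_process W \<sigma> a t \<omega>)\<^sup>2 / (t * (1 - t)))) \<in> borel_measurable (M' \<Otimes>\<^sub>M lborel)"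
proof -
  note [measurable] = limit_process_jointly_measurable
  have "(\<lambda>x. (indicator {0..1} (snd x) * limit_process W \<sigma> a (snd x) (fst x))\<^sup>2 / (snd x * (1 - snd x))) \<in> borel_measurable (M' \<Otimes>\<^sub>M lborel)"
    by measurable
  moreover have "(\<lambda>x. (indicator {0..1} (snd x) * limit_process W \<sigma> a (snd x) (fst x))\<^sup>2 / (snd x * (1 - snd x))) =
      (\<lambda>(\<omega>, t). indicator {0..1} t *\<^sub>R ((limit_process W \<sigma> a t \<omega>)\<^sup>2 / (t * (1 - t))))"
    by (auto simp: fun_eq_iff indicator_def)
  ultimately show ?thesis by simp
qed

lemma singular_energy_measurable:
  "(\<lambda>\<omega>. LBINT t:{0..1}. (limit_process W \<sigma> a t \<omega>)\<^sup>2 / (t * (1 - t))) \<in> borel_measurable M'"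
  unfolding set_lebesgue_integral_def
  by (rule lborel.borel_measurable_lebesgue_integral[OF singular_energy_jointly_measurable])

text \<open>By Tonelli's theorem the expected integral is the integral of \<open>E (\<Gamma> t)\<^sup>2 / (t (1 - t))\<close>, which is bounded.\<close>

lemma singular_energy_integrable:
  "AE \<omega> in M'. set_integrable lborel {0..1} (\<lambda>t. (limit_process W \<sigma> a t \<omega>)\<^sup>2 / (t * (1 - t)))"
proof -
  interpret P: pair_sigma_finite M' lborel ..
  define H where "H = (\<lambda>(\<omega>, t). indicator {0..1} t *\<^sub>R ((limit_process W \<sigma> a t \<omega>)\<^sup>2 / (t * (1 - t))))"
  have Hm [measurable]: "H \<in> borel_measurable (M' \<Otimes>\<^sub>M lborel)"
    unfolding H_def by (rule singular_energy_jointly_measurable)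
  have H0: "0 \<le> H x" for x by (auto simp: H_def indicator_def split: prod.split)
  have "(\<integral>\<^sup>+\<omega>. (\<integral>\<^sup>+t. ennreal (H (\<omega>, t)) \<partial>lborel) \<partial>M') = (\<integral>\<^sup>+t. (\<integral>\<^sup>+\<omega>. ennreal (H (\<omega>, t)) \<partial>M') \<partial>lborel)"
    by (rule P.Fubini[symmetric, where f="\<lambda>x. ennreal (H x)"]) measurable
  also have "\<dots> \<le> (\<integral>\<^sup>+t. ennreal (2 * (\<sigma>\<^sup>2 * A\<^sup>2)) * indicator {0..1::real} t \<partial>lborel)"
  proof (rule nn_integral_mono)
    fix t :: real
    show "(\<integral>\<^sup>+\<omega>. ennreal (H (\<omega>, t)) \<partial>M') \<le> ennreal (2 * (\<sigma>\<^sup>2 * A\<^sup>2)) * indicator {0..1} t"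
    proof (cases "0 < t \<and> t < 1")
      case True
      then have t: "0 \<le> t" "t \<le> 1" by auto
      have "(\<integral>\<^sup>+\<omega>. ennreal (H (\<omega>, t)) \<partial>M') = ennreal (expectation (\<lambda>\<omega>. (limit_process W \<sigma> a t \<omega>)\<^sup>2 / (t * (1 - t))))"
        unfolding H_def using limit_process_second_moment(1)[OF t] True
        by (subst nn_integral_eq_integral[symmetric]) (auto intro!: nn_integral_cong)
      also have "expectation (\<lambda>\<omega>. (limit_process W \<sigma> a t \<omega>)\<^sup>2 / (t * (1 - t))) \<le> 2 * (\<sigma>\<^sup>2 * A\<^sup>2)"
        using limit_process_second_moment(2)[OF t] True by (simp add: divide_le_eq)
      finally show ?thesis using True by (simp add: ennreal_leI)
    next
      case False
      then have "H (\<omega>, t) = 0" for \<omega> by (auto simp: H_def indicator_def)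
      then show ?thesis by simp
    qed
  qed
  also have "\<dots> < \<infinity>" by (simp add: nn_integral_cmult_indicator ennreal_mult_less_top)
  finally have "AE \<omega> in M'. (\<integral>\<^sup>+t. ennreal (H (\<omega>, t)) \<partial>lborel) \<noteq> \<infinity>"
    by (intro nn_integral_PInf_AE) (auto intro!: lborel.borel_measurable_nn_integral)
  then show ?thesis
  proof (rule AE_mp, intro AE_I2 impI)
    fix \<omega> assume \<omega>: "\<omega> \<in> space M'" and fin: "(\<integral>\<^sup>+t. ennreal (H (\<omega>, t)) \<partial>lborel) \<noteq> \<infinity>"
    have "(\<lambda>t. H (\<omega>, t)) \<in> borel_measurable lborel"
      using measurable_compose[OF measurable_Pair1'[OF \<omega>] Hm] .
    then have "integrable lborel (\<lambda>t. H (\<omega>, t))"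
      using fin H0 by (intro integrableI_nonneg) (auto simp: top.not_eq_extremum)
    then show "set_integrable lborel {0..1} (\<lambda>t. (limit_process W \<sigma> a t \<omega>)\<^sup>2 / (t * (1 - t)))"
      by (simp add: H_def set_integrable_def)
  qed
qed

text \<open>Dominated convergence; the end points, where the truncated and the full integrand agree as well, have weight zero
because division by zero is zero.\<close>

lemma trunc_energy_tendsto:
  assumes \<omega>: "\<omega> \<in> space M'" 
    and int: "set_integrable lborel {0..1} (\<lambda>t. (limit_process W \<sigma> a t \<omega>)\<^sup>2 / (t * (1 - t)))"
  shows "(\<lambda>p. LBINT t:{0..1}. (limit_process W \<sigma> a t \<omega>)\<^sup>2 * trunc_weight (1 / real (Suc p)) t) \<longlonglongrightarrow>
    (LBINT t:{0..1}. (limit_process W \<sigma> a t \<omega>)\<^sup>2 / (t * (1 - t)))"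
proof -
  let ?h = "\<lambda>t. indicator {0..1} t *\<^sub>R ((limit_process W \<sigma> a t \<omega>)\<^sup>2 / (t * (1 - t)))"
  have eq: "indicator {0..1} t *\<^sub>R ((limit_process W \<sigma> a t \<omega>)\<^sup>2 * trunc_weight \<delta> t) = indicator {\<delta>..1 - \<delta>} t * ?h t" for \<delta> t
    by (simp add: trunc_weight_def)
  have hi: "integrable lborel ?h" using int by (simp add: set_integrable_def)
  show ?thesis
    unfolding set_lebesgue_integral_def eq
  proof (rule integral_dominated_convergence[where w="\<lambda>t. \<bar>?h t\<bar>"])
    show "?h \<in> borel_measurable lborel" using hi by simp
    then show "(\<lambda>t. indicator {1 / real (Suc p)..1 - 1 / real (Suc p)} t * ?h t) \<in> borel_measurable lborel" for p by measurable
    show "integrable lborel (\<lambda>t. \<bar>?h t\<bar>)" by (rule integrable_abs[OF hi])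
    show "AE t in lborel. norm (indicator {1 / real (Suc p)..1 - 1 / real (Suc p)} t * ?h t) \<le> \<bar>?h t\<bar>" for p
      by (intro AE_I2) (auto simp: indicator_def)
    show "AE t in lborel. (\<lambda>p. indicator {1 / real (Suc p)..1 - 1 / real (Suc p)} t * ?h t) \<longlonglongrightarrow> ?h t"
    proof (intro AE_I2)
      fix t :: real
      show "(\<lambda>p. indicator {1 / real (Suc p)..1 - 1 / real (Suc p)} t * ?h t) \<longlonglongrightarrow> ?h t"
      proof (cases "0 < t \<and> t < 1")
        case True
        have z: "(\<lambda>p. 1 / real (Suc p)) \<longlonglongrightarrow> 0" using LIMSEQ_inverse_real_of_nat by (simp add: inverse_eq_divide)
        have "\<forall>\<^sub>F p in sequentially. 1 / real (Suc p) < min t (1 - t)"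
          using order_tendstoD(2)[OF z, of "min t (1 - t)"] True by simp
        then have "\<forall>\<^sub>F p in sequentially. indicator {1 / real (Suc p)..1 - 1 / real (Suc p)} t * ?h t = ?h t"
          by eventually_elim (auto simp: indicator_def)
        then show ?thesis by (rule tendsto_eventually)
      next
        case False
        then have h0: "?h t = 0" by (auto simp: indicator_def)
        show ?thesis unfolding h0 by simp
      qed
    qed
  qed
qed

end

text \<open>The cut-off \<open>\<delta>\<close> is chosen first: the truncated energy at sample size \<open>N\<close> is within \<open>L * 8 G \<delta>\<close> of the full one in
the expectation of a test function, uniformly in \<open>N \<ge> 1/\<delta>\<close>; it converges by the case of bounded weights; and
the truncated energy of the limit is close to the full one.\<close>

lemma (in wiener_clock) singular_energy_convergence:
  fixes M :: "'a measure" and e :: "nat \<Rightarrow> 'a \<Rightarrow> real" and \<psi> :: "real \<Rightarrow> real"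
  assumes M: "prob_space M" and e: "\<And>i. 1 \<le> i \<Longrightarrow> e i \<in> borel_measurable M"
    and fclt: "skorokhod_weak_conv M (partial_sum_path e) M' (\<lambda>\<omega>. \<lambda>t\<in>{0..1}. \<sigma> * W t \<omega>)"
    and \<kappa>: "\<kappa> > 1"
    and int: "\<And>i k. 1 \<le> i \<Longrightarrow> 1 \<le> k \<Longrightarrow> integrable M (\<lambda>\<omega>. e i \<omega> * e k \<omega>)"
    and cov: "\<And>i k. 1 \<le> i \<Longrightarrow> 1 \<le> k \<Longrightarrow> \<bar>\<integral>\<omega>. e i \<omega> * e k \<omega> \<partial>M\<bar> \<le> C * (\<bar>real k - real i\<bar> + 1) powr (- \<kappa>)"
    and \<psi>: "lipschitz_test L \<psi>"
  shows "(\<lambda>N. \<integral>\<omega>. \<psi> (bridge_energy (trunc_weight (1 / real N)) N (weighted_sum a (partial_sum_path e N \<omega>) N)) \<partial>M)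
    \<longlonglongrightarrow> (\<integral>\<omega>. \<psi> (LBINT t:{0..1}. (limit_process W \<sigma> a t \<omega>)\<^sup>2 / (t * (1 - t))) \<partial>M')"
proof (rule tendstoI)
  fix \<epsilon> :: real assume \<epsilon>: "\<epsilon> > 0"
  interpret M: prob_space M by fact
  define F where "F \<delta> N \<omega> = bridge_energy (trunc_weight \<delta>) N (weighted_sum a (partial_sum_path e N \<omega>) N)" for \<delta> N \<omega>
  define Q where "Q \<delta> \<omega> = (LBINT t:{0..1}. (limit_process W \<sigma> a t \<omega>)\<^sup>2 * trunc_weight \<delta> t)" for \<delta> \<omega>
  define Q0 where "Q0 \<omega> = (LBINT t:{0..1}. (limit_process W \<sigma> a t \<omega>)\<^sup>2 / (t * (1 - t)))" for \<omega>
  define G where "G = A\<^sup>2 * C * (2 * (\<Sum>n. real (Suc n) powr (- \<kappa>)))"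
  note \<psi>b = lipschitz_test_bounds[OF \<psi>]
  note [measurable] = lipschitz_test_measurable[OF \<psi>]
  have Fm [measurable]: "F \<delta> N \<in> borel_measurable M" for \<delta> N
    unfolding F_def[abs_def] by (rule bridge_energy_partial_sum_measurable[OF e])
  have C: "0 \<le> C" using order_trans[OF abs_ge_zero cov[of 1 1]] by simp
  \<comment> \<open>the kernel sum bounds the singleton sum at \<open>i = 1\<close>, which shows that the constant is nonnegative\<close>
  have "0 \<le> (\<Sum>k\<in>{1::nat}. (\<bar>real k - real 1\<bar> + 1) powr (- \<kappa>))" by simp
  also have "\<dots> \<le> 2 * (\<Sum>n. real (Suc n) powr (- \<kappa>))" by (rule power_kernel_sum_le[OF \<kappa>]) simp
  finally have G: "0 \<le> G" unfolding G_def using C by (intro mult_nonneg_nonneg) auto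
  have tail: "integrable M (\<lambda>\<omega>. \<bar>F (1 / real N) N \<omega> - F \<delta> N \<omega>\<bar>)"
    "M.expectation (\<lambda>\<omega>. \<bar>F (1 / real N) N \<omega> - F \<delta> N \<omega>\<bar>) \<le> 8 * G * \<delta>"
    if N: "0 < N" and \<delta>: "1 / real N \<le> \<delta>" "\<delta> \<le> 1 / 2" for N \<delta>
  proof -
    define x where "x l \<omega> = (a (real l / real N) / sqrt (real N)) * e l \<omega>" for l \<omega>
    have xm: "x l \<in> borel_measurable M" if "1 \<le> l" for l
      unfolding x_def[abs_def] using e[OF that] by measurable
    have c: "\<bar>a (real l / real N) / sqrt (real N)\<bar> \<le> A / sqrt (real N)" if "l \<in> {1..N}" for l
      using A[of "real l / real N"] that by (auto simp: divide_right_mono divide_le_eq_1)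
    have y: "weighted_sum a (partial_sum_path e N \<omega>) N k = (\<Sum>l=1..k. x l \<omega>)" if "k \<le> N" for k \<omega>
      unfolding weighted_sum_partial_sum_path[OF N that] x_def by (simp add: sum_divide_distrib)
    have m: "integrable M (\<lambda>\<omega>. (\<Sum>l\<in>B. x l \<omega>)\<^sup>2)"
      "M.expectation (\<lambda>\<omega>. (\<Sum>l\<in>B. x l \<omega>)\<^sup>2) \<le> G * (real (card B) / real N)" if B: "B \<subseteq> {1..N}" for B
    proof -
      have fin: "finite B" using B finite_subset by blast
      have B1: "1 \<le> i" "\<bar>a (real i / real N) / sqrt (real N)\<bar> \<le> A / sqrt (real N)" if "i \<in> B" for i
        using B that c[of i] by auto
      note P = M.weighted_sum_second_moment[OF \<kappa> fin B1(1) int cov B1(2)]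
      show "integrable M (\<lambda>\<omega>. (\<Sum>l\<in>B. x l \<omega>)\<^sup>2)" unfolding x_def by (rule P(1))
      have "(A / sqrt (real N))\<^sup>2 * C * (2 * (\<Sum>n. real (Suc n) powr (- \<kappa>))) * real (card B) = G * (real (card B) / real N)"
        using N by (simp add: G_def power_divide)
      then show "M.expectation (\<lambda>\<omega>. (\<Sum>l\<in>B. x l \<omega>)\<^sup>2) \<le> G * (real (card B) / real N)"
        unfolding x_def using P(2) by simp
    qed
    have b: "integrable M (\<lambda>\<omega>. (bridge N (weighted_sum a (partial_sum_path e N \<omega>) N) k)\<^sup>2)"
      "M.expectation (\<lambda>\<omega>. (bridge N (weighted_sum a (partial_sum_path e N \<omega>) N) k)\<^sup>2) \<le> 2 * G * (real k / real N * (1 - real k / real N))"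
      if "k \<le> N" for k
      by (rule M.bridge_second_moment[OF N that m xm y]; assumption)+
    have "0 \<le> 2 * G" using G by simp
    note T = M.tail_energy_bound[OF N \<delta> this b]
    show "integrable M (\<lambda>\<omega>. \<bar>F (1 / real N) N \<omega> - F \<delta> N \<omega>\<bar>)" unfolding F_def by (rule T(1))
    show "M.expectation (\<lambda>\<omega>. \<bar>F (1 / real N) N \<omega> - F \<delta> N \<omega>\<bar>) \<le> 8 * G * \<delta>"
      unfolding F_def using T(2) by simp
  qed
  have "(\<lambda>p. \<integral>\<omega>. \<psi> (Q (1 / real (Suc p)) \<omega>) \<partial>M') \<longlonglongrightarrow> (\<integral>\<omega>. \<psi> (Q0 \<omega>) \<partial>M')"
  proof (rule integral_dominated_convergence[where w="\<lambda>_. 1"])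
    show "(\<lambda>\<omega>. \<psi> (Q (1 / real (Suc p)) \<omega>)) \<in> borel_measurable M'" for p
      unfolding Q_def
      by (intro measurable_compose[OF limit_energy_measurable[OF bounded_trunc_weight] lipschitz_test_measurable[OF \<psi>]]) simp
    show "(\<lambda>\<omega>. \<psi> (Q0 \<omega>)) \<in> borel_measurable M'"
      unfolding Q0_def by (intro measurable_compose[OF singular_energy_measurable lipschitz_test_measurable[OF \<psi>]])
    show "AE \<omega> in M'. (\<lambda>p. \<psi> (Q (1 / real (Suc p)) \<omega>)) \<longlonglongrightarrow> \<psi> (Q0 \<omega>)"
      using singular_energy_integrable
    proof (rule AE_mp, intro AE_I2 impI)
      fix \<omega> assume "\<omega> \<in> space M'" "set_integrable lborel {0..1} (\<lambda>t. (limit_process W \<sigma> a t \<omega>)\<^sup>2 / (t * (1 - t)))"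
      then show "(\<lambda>p. \<psi> (Q (1 / real (Suc p)) \<omega>)) \<longlonglongrightarrow> \<psi> (Q0 \<omega>)"
        unfolding Q_def Q0_def by (intro isCont_tendsto_compose[OF lipschitz_test_isCont[OF \<psi>]] trunc_energy_tendsto)
    qed
    show "AE \<omega> in M'. norm (\<psi> (Q (1 / real (Suc p)) \<omega>)) \<le> 1" for p
      using \<psi>b(2,3) by (intro AE_I2) auto
  qed auto
  then have l1: "\<forall>\<^sub>F p in sequentially. dist (\<integral>\<omega>. \<psi> (Q (1 / real (Suc p)) \<omega>) \<partial>M') (\<integral>\<omega>. \<psi> (Q0 \<omega>) \<partial>M') < \<epsilon> / 4"
    by (rule tendstoD) (use \<epsilon> in simp)
  have "(\<lambda>p. L * (8 * G * (1 / real (Suc p)))) \<longlonglongrightarrow> L * (8 * G * 0)"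
    using LIMSEQ_inverse_real_of_nat by (intro tendsto_intros) (simp add: inverse_eq_divide)
  then have l2: "\<forall>\<^sub>F p in sequentially. L * (8 * G * (1 / real (Suc p))) < \<epsilon> / 4"
    by (rule order_tendstoD(2)) (use \<epsilon> in simp)
  obtain p where p: "0 < p" and p1: "dist (\<integral>\<omega>. \<psi> (Q (1 / real (Suc p)) \<omega>) \<partial>M') (\<integral>\<omega>. \<psi> (Q0 \<omega>) \<partial>M') < \<epsilon> / 4"
    and p2: "L * (8 * G * (1 / real (Suc p))) < \<epsilon> / 4"
    using eventually_happens'[OF sequentially_bot eventually_conj[OF eventually_gt_at_top[of 0] eventually_conj[OF l1 l2]]]
    by blast
  define \<delta> where "\<delta> = 1 / real (Suc p)"
  have \<delta>: "0 < \<delta>" "\<delta> \<le> 1 / 2" unfolding \<delta>_def using p by (auto intro!: divide_left_mono)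
  have "(\<lambda>N. \<integral>\<omega>. \<psi> (F \<delta> N \<omega>) \<partial>M) \<longlonglongrightarrow> (\<integral>\<omega>. \<psi> (Q \<delta> \<omega>) \<partial>M')"
    unfolding F_def Q_def by (rule energy_convergence[OF M e fclt bounded_trunc_weight[OF \<delta>(1)] \<psi>])
  then have "\<forall>\<^sub>F N in sequentially. dist (\<integral>\<omega>. \<psi> (F \<delta> N \<omega>) \<partial>M) (\<integral>\<omega>. \<psi> (Q \<delta> \<omega>) \<partial>M') < \<epsilon> / 4"
    by (rule tendstoD) (use \<epsilon> in simp)
  then have "\<forall>\<^sub>F N in sequentially. dist (\<integral>\<omega>. \<psi> (F (1 / real N) N \<omega>) \<partial>M) (\<integral>\<omega>. \<psi> (Q0 \<omega>) \<partial>M') < \<epsilon>"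
    using eventually_ge_at_top[of "Suc p"]
  proof eventually_elim
    fix N assume c: "dist (\<integral>\<omega>. \<psi> (F \<delta> N \<omega>) \<partial>M) (\<integral>\<omega>. \<psi> (Q \<delta> \<omega>) \<partial>M') < \<epsilon> / 4" and Np: "Suc p \<le> N"
    have N: "0 < N" "1 / real N \<le> \<delta>" unfolding \<delta>_def using Np by (auto intro!: divide_left_mono)
    note t = tail[OF N \<delta>(2)]
    have "\<bar>M.expectation (\<lambda>\<omega>. \<psi> (F (1 / real N) N \<omega>)) - M.expectation (\<lambda>\<omega>. \<psi> (F \<delta> N \<omega>))\<bar>
        \<le> M.expectation (\<lambda>\<omega>. min 1 (L * \<bar>F (1 / real N) N \<omega> - F \<delta> N \<omega>\<bar>))"
      by (rule M.expectation_test_diff[OF \<psi>]) auto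
    also have "\<dots> \<le> M.expectation (\<lambda>\<omega>. L * \<bar>F (1 / real N) N \<omega> - F \<delta> N \<omega>\<bar>)"
    proof (rule integral_mono)
      show "integrable M (\<lambda>\<omega>. min 1 (L * \<bar>F (1 / real N) N \<omega> - F \<delta> N \<omega>\<bar>))"
        using \<psi>b(1) by (intro M.integrable_const_bound[where B=1] AE_I2) auto
    qed (use t(1) in auto)
    also have "\<dots> \<le> L * (8 * G * \<delta>)" using t(2) \<psi>b(1) by (simp add: mult_left_mono)
    finally show "dist (\<integral>\<omega>. \<psi> (F (1 / real N) N \<omega>) \<partial>M) (\<integral>\<omega>. \<psi> (Q0 \<omega>) \<partial>M') < \<epsilon>"
      using c p1 p2 \<epsilon> unfolding \<delta>_def[symmetric] dist_real_def by linarith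
  qed
  then show "\<forall>\<^sub>F N in sequentially. dist (\<integral>\<omega>. \<psi> (bridge_energy (trunc_weight (1 / real N)) N (weighted_sum a (partial_sum_path e N \<omega>) N)) \<partial>M)
      (\<integral>\<omega>. \<psi> (LBINT t:{0..1}. (limit_process W \<sigma> a t \<omega>)\<^sup>2 / (t * (1 - t))) \<partial>M') < \<epsilon>"
    unfolding F_def Q0_def .
qed

section \<open>The CUSUM process\<close>

text \<open>The common mean contributes \<open>k \<mu>\<close> to the partial sum and \<open>k/N * (N \<mu>)\<close> to its centring.\<close>

lemma cusum_eq_bridge:
  assumes N: "0 < N" and t: "0 \<le> t" "t \<le> 1"
    and X: "\<And>i. 1 \<le> i \<Longrightarrow> i \<le> N \<Longrightarrow> X N i \<omega> = \<mu> + a (real i / real N) * e i \<omega>"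
  shows "cusum X N t \<omega> = bridge N (weighted_sum a (partial_sum_path e N \<omega>) N) (nat \<lfloor>real N * t\<rfloor>)"
proof -
  define k where "k = nat \<lfloor>real N * t\<rfloor>"
  have k: "k \<le> N" unfolding k_def by (rule floor_grid_le[OF t])
  have fl: "real_of_int \<lfloor>real N * t\<rfloor> = real k" using t by (simp add: k_def)
  have "(\<Sum>l=1..j. X N l \<omega>) = real j * \<mu> + (\<Sum>l=1..j. a (real l / real N) * e l \<omega>)" if "j \<le> N" for j
  proof -
    have "(\<Sum>l=1..j. X N l \<omega>) = (\<Sum>l=1..j. \<mu> + a (real l / real N) * e l \<omega>)"
      using that by (intro sum.cong refl X) auto
    then show ?thesis by (simp add: sum.distrib)
  qed
  then show ?thesis
    unfolding cusum_def bridge_def fl k_def[symmetric]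
      weighted_sum_partial_sum_path[OF N k] weighted_sum_partial_sum_path[OF N order.refl]
    using k N by (simp add: field_simps)
qed

lemma cusum_energy:
  assumes X: "\<And>i. 1 \<le> i \<Longrightarrow> i \<le> N \<Longrightarrow> X N i \<omega> = \<mu> + a (real i / real N) * e i \<omega>"
    and r: "set_integrable lborel {0..1} r"
  shows "(LBINT t:{0..1}. (cusum X N t \<omega>)\<^sup>2 * r t) = bridge_energy r N (weighted_sum a (partial_sum_path e N \<omega>) N)"
proof (cases "N = 0")
  case True
  then show ?thesis
    by (simp add: cusum_def bridge_energy_def bridge_def weighted_sum_def set_lebesgue_integral_def)
next
  case False
  define y where "y = weighted_sum a (partial_sum_path e N \<omega>) N"
  have "(LBINT t:{0..1}. (cusum X N t \<omega>)\<^sup>2 * r t) = (LBINT t:{0..1}. (bridge N y (nat \<lfloor>real N * t\<rfloor>))\<^sup>2 * r t)"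
    unfolding y_def using False X by (intro set_lebesgue_integral_cong) (auto simp: cusum_eq_bridge)
  also have "\<dots> = bridge_energy r N y"
    using set_integral_floor_grid(2)[OF r, of "\<lambda>k. (bridge N y k)\<^sup>2" N] by (simp add: bridge_energy_def)
  finally show ?thesis unfolding y_def .
qed

text \<open>A sample of size zero is covered as well, both sides being zero: the CUSUM process carries the factor
\<open>1 / sqrt 0 = 0\<close>.\<close>

lemma cusum_singular_energy:
  assumes X: "\<And>i. 1 \<le> i \<Longrightarrow> i \<le> N \<Longrightarrow> X N i \<omega> = \<mu> + a (real i / real N) * e i \<omega>"
  shows "(LBINT t:{1 / real N..1 - 1 / real N}. (cusum X N t \<omega>)\<^sup>2 / (t * (1 - t)))
    = bridge_energy (trunc_weight (1 / real N)) N (weighted_sum a (partial_sum_path e N \<omega>) N)"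
proof (cases "N = 0")
  case True
  then show ?thesis
    by (simp add: cusum_def bridge_energy_def bridge_def weighted_sum_def set_lebesgue_integral_def)
next
  case False
  have "1 / real N \<le> t \<Longrightarrow> 0 \<le> t" for t using order_trans[of 0 "1 / real N" t] by simp
  moreover have "t \<le> 1 - 1 / real N \<Longrightarrow> t \<le> 1" for t using order_trans[of t "1 - 1 / real N" 1] by simp
  ultimately have "(LBINT t:{1 / real N..1 - 1 / real N}. (cusum X N t \<omega>)\<^sup>2 / (t * (1 - t)))
      = (LBINT t:{0..1}. (cusum X N t \<omega>)\<^sup>2 * trunc_weight (1 / real N) t)"
    unfolding set_lebesgue_integral_def trunc_weight_def
    by (intro Bochner_Integration.integral_cong refl) (auto simp: indicator_def)
  also have "\<dots> = bridge_energy (trunc_weight (1 / real N)) N (weighted_sum a (partial_sum_path e N \<omega>) N)"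
    using False by (intro cusum_energy[where \<mu>=\<mu>] bounded_weight_integrable[OF bounded_trunc_weight] X) auto
  finally show ?thesis .
qed

theorem corollary2p2:
  fixes M :: "'a measure" and e :: "nat \<Rightarrow> 'a \<Rightarrow> real"
    and M' :: "'b measure" and W :: "real \<Rightarrow> 'b \<Rightarrow> real"
    and a :: "real \<Rightarrow> real" and \<sigma> :: real
    and \<mu> :: "nat \<Rightarrow> nat \<Rightarrow> real" and u X :: "nat \<Rightarrow> nat \<Rightarrow> 'a \<Rightarrow> real"
  assumes "prob_space M"
    and X: "\<And>N i \<omega>. 1 \<le> i \<Longrightarrow> i \<le> N \<Longrightarrow> \<omega> \<in> space M \<Longrightarrow> X N i \<omega> = \<mu> N i + u N i \<omega>"
    and u: "\<And>N i \<omega>. 1 \<le> i \<Longrightarrow> i \<le> N \<Longrightarrow> \<omega> \<in> space M \<Longrightarrow> u N i \<omega> = a (real i / real N) * e i \<omega>"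
    and a: "bounded_variation_on 0 1 a"
    and e_integrable: "\<And>i. 1 \<le> i \<Longrightarrow> integrable M (e i)"
    and e_centered: "\<And>i. 1 \<le> i \<Longrightarrow> (\<integral>\<omega>. e i \<omega> \<partial>M) = 0"
    and \<sigma>: "\<sigma> > 0"
    and W: "wiener_process M' W"
    and fclt: "skorokhod_weak_conv
      M (\<lambda>N \<omega>. \<lambda>t\<in>{0..1}. 1 / sqrt (real N) * (\<Sum>l=1..nat \<lfloor>real N * t\<rfloor>. e l \<omega>))
      M' (\<lambda>\<omega>. \<lambda>t\<in>{0..1}. \<sigma> * W t \<omega>)"
    and H0: "\<And>N i j. i \<in> {1..N} \<Longrightarrow> j \<in> {1..N} \<Longrightarrow> \<mu> N i = \<mu> N j"
  shows "conv_in_distr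
           M (\<lambda>N \<omega>. LBINT t:{0..1}. (cusum X N t \<omega>)\<^sup>2)
           M' (\<lambda>\<omega>. LBINT t:{0..1}. (limit_process W \<sigma> a t \<omega>)\<^sup>2) \<and>
         ((\<exists>\<kappa>>1. \<exists>C. \<forall>i\<ge>1. \<forall>k\<ge>1. integrable M (\<lambda>\<omega>. e i \<omega> * e k \<omega>) \<and>
             \<bar>\<integral>\<omega>. e i \<omega> * e k \<omega> \<partial>M\<bar> \<le> C * (\<bar>real k - real i\<bar> + 1) powr (- \<kappa>)) \<longrightarrow>
          (AE \<omega> in M'. set_integrable lborel {0..1}
             (\<lambda>t. (limit_process W \<sigma> a t \<omega>)\<^sup>2 / (t * (1 - t)))) \<and>
          conv_in_distr
            M (\<lambda>N \<omega>. LBINT t:{1 / real N..1 - 1 / real N}. (cusum X N t \<omega>)\<^sup>2 / (t * (1 - t)))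
            M' (\<lambda>\<omega>. LBINT t:{0..1}. (limit_process W \<sigma> a t \<omega>)\<^sup>2 / (t * (1 - t))))"
proof -
  interpret M: prob_space M by fact
  obtain v where v: "\<And>s t. 0 \<le> s \<Longrightarrow> s \<le> t \<Longrightarrow> t \<le> 1 \<Longrightarrow> \<bar>a t - a s\<bar> \<le> v t - v s"
    using bounded_variation_dominated[OF a] by (metis zero_le_one)
  \<comment> \<open>bounded variation bounds the weight itself\<close>
  have A: "\<bar>a t\<bar> \<le> \<bar>a 0\<bar> + (v 1 - v 0)" if "0 \<le> t" "t \<le> 1" for t
    using v[of 0 t] v[of t 1] that by linarith
  interpret wiener_clock M' W a v "\<bar>a 0\<bar> + (v 1 - v 0)" \<sigma>
    using W v A by unfold_locales auto
  have e: "e i \<in> borel_measurable M" if "1 \<le> i" for i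
    using e_integrable[OF that] by simp
  have conv: "skorokhod_weak_conv M (partial_sum_path e) M' (\<lambda>\<omega>. \<lambda>t\<in>{0..1}. \<sigma> * W t \<omega>)"
    using fclt unfolding partial_sum_path_def[abs_def] .
  have X': "X N i \<omega> = \<mu> N 1 + a (real i / real N) * e i \<omega>" if "1 \<le> i" "i \<le> N" "\<omega> \<in> space M" for N i \<omega>
    using X[OF that] u[OF that] H0[of i N 1] that by simp
  have one: "bounded_weight (\<lambda>_. 1) 1" by (simp add: bounded_weight_def)
  let ?E = "\<lambda>r N \<omega>. bridge_energy r N (weighted_sum a (partial_sum_path e N \<omega>) N)"
  have E1: "(LBINT t:{0..1}. (cusum X N t \<omega>)\<^sup>2) = ?E (\<lambda>_. 1) N \<omega>" if "\<omega> \<in> space M" for N \<omega>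
    using cusum_energy[where X=X and N=N and \<omega>=\<omega> and \<mu>="\<mu> N 1" and a=a and e=e and r="\<lambda>_. 1"]
      X'[OF _ _ that] bounded_weight_integrable[OF one] by simp
  have E2: "(LBINT t:{1 / real N..1 - 1 / real N}. (cusum X N t \<omega>)\<^sup>2 / (t * (1 - t))) = ?E (trunc_weight (1 / real N)) N \<omega>"
    if "\<omega> \<in> space M" for N \<omega>
    by (rule cusum_singular_energy[where \<mu>="\<mu> N 1"]) (rule X'[OF _ _ that])
  note Em = bridge_energy_partial_sum_measurable[OF e]
  have "conv_in_distr M (\<lambda>N \<omega>. LBINT t:{0..1}. (cusum X N t \<omega>)\<^sup>2)
      M' (\<lambda>\<omega>. LBINT t:{0..1}. (limit_process W \<sigma> a t \<omega>)\<^sup>2)"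
  proof (rule conv_in_distrI[OF M.prob_space_axioms prob_space_axioms])
    show "(\<lambda>\<omega>. LBINT t:{0..1}. (cusum X N t \<omega>)\<^sup>2) \<in> borel_measurable M" for N
      by (subst measurable_cong[OF E1]) (auto intro: Em)
    show "(\<lambda>\<omega>. LBINT t:{0..1}. (limit_process W \<sigma> a t \<omega>)\<^sup>2) \<in> borel_measurable M'"
      using limit_energy_measurable[OF one] by simp
    fix L \<psi> assume \<psi>: "lipschitz_test L \<psi>"
    show "(\<lambda>N. \<integral>\<omega>. \<psi> (LBINT t:{0..1}. (cusum X N t \<omega>)\<^sup>2) \<partial>M)
        \<longlonglongrightarrow> (\<integral>\<omega>. \<psi> (LBINT t:{0..1}. (limit_process W \<sigma> a t \<omega>)\<^sup>2) \<partial>M')"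
      using energy_convergence[OF M.prob_space_axioms e conv one \<psi>] by (simp add: E1 cong: Bochner_Integration.integral_cong)
  qed
  moreover have "conv_in_distr
      M (\<lambda>N \<omega>. LBINT t:{1 / real N..1 - 1 / real N}. (cusum X N t \<omega>)\<^sup>2 / (t * (1 - t)))
      M' (\<lambda>\<omega>. LBINT t:{0..1}. (limit_process W \<sigma> a t \<omega>)\<^sup>2 / (t * (1 - t)))"
    if \<kappa>: "\<kappa> > 1" and C: "\<forall>i\<ge>1. \<forall>k\<ge>1. integrable M (\<lambda>\<omega>. e i \<omega> * e k \<omega>) \<and>
        \<bar>\<integral>\<omega>. e i \<omega> * e k \<omega> \<partial>M\<bar> \<le> C * (\<bar>real k - real i\<bar> + 1) powr (- \<kappa>)" for \<kappa> C
  proof (rule conv_in_distrI[OF M.prob_space_axioms prob_space_axioms _ singular_energy_measurable])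
    show "(\<lambda>\<omega>. LBINT t:{1 / real N..1 - 1 / real N}. (cusum X N t \<omega>)\<^sup>2 / (t * (1 - t))) \<in> borel_measurable M" for N
      by (subst measurable_cong[OF E2]) (auto intro: Em)
    fix L \<psi> assume \<psi>: "lipschitz_test L \<psi>"
    show "(\<lambda>N. \<integral>\<omega>. \<psi> (LBINT t:{1 / real N..1 - 1 / real N}. (cusum X N t \<omega>)\<^sup>2 / (t * (1 - t))) \<partial>M)
        \<longlonglongrightarrow> (\<integral>\<omega>. \<psi> (LBINT t:{0..1}. (limit_process W \<sigma> a t \<omega>)\<^sup>2 / (t * (1 - t))) \<partial>M')"
      using singular_energy_convergence[OF M.prob_space_axioms e conv \<kappa> _ _ \<psi>, of C] C
      by (simp add: E2 cong: Bochner_Integration.integral_cong)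
  qed
  ultimately show ?thesis using singular_energy_integrable by blast
qed

end
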